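(* Let $m\in\mathbb N$, $m\ge1$, and let $\Omega\subset\mathbb R^3$ be an $m$-admissible domain. Let $\mu=\sqrt{\langle N,X\rangle^2+\langle N,Y\rangle^2}\,\mathcal H^2\llcorner\partial\Omega$, where $N$ is the Euclidean unit normal to $\partial\Omega$, $\langle\cdot,\cdot\rangle$ the Euclidean scalar product and $\mathcal H^2\llcorner\partial\Omega$ the Euclidean surface measure on $\partial\Omega$. Then there exist $C>0$ and $r_0>0$ such that for all $p\in\partial\Omega$ and $0<r\le r_0$, $$C^{-1}\frac{|B(p,r)|}{r}\le\mu(B(p,r))\le C\frac{|B(p,r)|}{r},$$ where $|\cdot|$ denotes Lebesgue measure in $\mathbb R^3$.
   Context: Write points of $\mathbb R^3=\mathbb C\times\mathbb R$ as $(z,t)=(x,y,t)$. For a real parameter $m\ge1$ consider the vector fields $X=\partial_x+|z|^{2m}y\,\partial_t$ and $Y=\partial_y-|z|^{2m}x\,\partial_t$. An absolutely continuous curve $\gamma:[0,1]\to\mathbb R^3$ is horizontal if $\dot\gamma(s)=\alpha(s)X(\gamma(s))+\beta(s)Y(\gamma(s))$ for a.e. $s$, with length $\int_0^1|(\alpha(s),\beta(s))|\,ds$; the Carnot–Carathéodory distance $d(p,q)$ is the infimum of lengths of horizontal curves joining $p$ to $q$, and $B(p,r)=\{q:d(p,q)<r\}$. For an open set $A\subset\mathbb R^2$ and $\phi\in C^\infty(A)$, the graph $\{(z,\phi(z)):z\in A\}$ is an $m$-admissible graph if there is $C>0$ with $|D^3\phi(z)|\le C|z|^{2m-1}$, $|D^2\phi(z)|\le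 C|z|^{2m}$, $|D\phi(z)|\le C|z|^{2m+1}$ for all $z\in A$, where $|D^k\phi(z)|$ is the maximum of the absolute values of all $k$-th order partial derivatives of $\phi$ at $z$. A point $p\in\partial\Omega$ of a smooth boundary is characteristic if $X(p)$ and $Y(p)$ are both tangent to $\partial\Omega$ at $p$. A bounded domain $\Omega\subset\mathbb R^3$ with $C^\infty$ boundary is $m$-admissible if every characteristic point $p\in\partial\Omega$ has a neighborhood $U_p$ in $\mathbb R^3$ such that $\partial\Omega\cap U_p$ is an $m$-admissible graph. *)

theory Defs
  imports "HOL-Analysis.Analysis"
begin

text \<open>Points of R^3 = C x R are written (z,t) :: complex \<times> real; Re z = x, Im z = y.\<close>

type_synonym pt = "complex \<times> real"

text \<open>The vector fields X = d/dx + |z|^(2m) y d/dt and Y = d/dy - |z|^(2m) x d/dt.\<close>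
definition Xf :: "real \<Rightarrow> pt \<Rightarrow> pt" where
  "Xf m p = (1, cmod (fst p) powr (2*m) * Im (fst p))"

definition Yf :: "real \<Rightarrow> pt \<Rightarrow> pt" where
  "Yf m p = (\<i>, - (cmod (fst p) powr (2*m) * Re (fst p)))"

definition abs_cont_01 :: "(real \<Rightarrow> 'a::real_normed_vector) \<Rightarrow> bool" where
  "abs_cont_01 g \<longleftrightarrow> (\<forall>e>0. \<exists>d>0. \<forall>(n::nat) (a::nat\<Rightarrow>real) b.
      (\<forall>i<n. 0 \<le> a i \<and> a i \<le> b i \<and> b i \<le> 1) \<and>
      (\<forall>i<n. \<forall>j<n. i \<noteq> j \<longrightarrow> b i \<le> a j \<or> b j \<le> a i) \<and>
      (\<Sum>i<n. b i - a i) < d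
      \<longrightarrow> (\<Sum>i<n. norm (g (b i) - g (a i))) < e)"

definition horizontal :: "real \<Rightarrow> (real \<Rightarrow> pt) \<Rightarrow> (real \<Rightarrow> real) \<Rightarrow> (real \<Rightarrow> real) \<Rightarrow> bool" where
  "horizontal m g \<alpha> \<beta> \<longleftrightarrow> abs_cont_01 g \<and>
     (AE s in lebesgue. s \<in> {0..1} \<longrightarrow>
        (g has_vector_derivative (\<alpha> s *\<^sub>R Xf m (g s) + \<beta> s *\<^sub>R Yf m (g s))) (at s))"

definition hlength :: "(real \<Rightarrow> real) \<Rightarrow> (real \<Rightarrow> real) \<Rightarrow> ennreal" where
  "hlength \<alpha> \<beta> = (\<integral>\<^sup>+ s. indicator {0..1} s * ennreal (sqrt ((\<alpha> s)\<^sup>2 + (\<beta> s)\<^sup>2)) \<partial>lebesgue)"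

text \<open>Carnot-Caratheodory distance (value \<infinity> if no horizontal curve joins p to q).\<close>
definition cc_dist :: "real \<Rightarrow> pt \<Rightarrow> pt \<Rightarrow> ennreal" where
  "cc_dist m p q = Inf {L. \<exists>g \<alpha> \<beta>. horizontal m g \<alpha> \<beta> \<and> g 0 = p \<and> g 1 = q \<and> L = hlength \<alpha> \<beta>}"

definition cc_ball :: "real \<Rightarrow> pt \<Rightarrow> real \<Rightarrow> pt set" where
  "cc_ball m p r = {q. cc_dist m p q < ennreal r}"

fun iter_pd :: "'a::euclidean_space list \<Rightarrow> ('a \<Rightarrow> real) \<Rightarrow> 'a \<Rightarrow> real" where
  "iter_pd [] f = f"
| "iter_pd (b # bs) f = iter_pd bs (\<lambda>x. frechet_derivative f (at x) b)"

definition smooth_on :: "'a::euclidean_space set \<Rightarrow> ('a \<Rightarrow> real) \<Rightarrow> bool" where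
  "smooth_on U f \<longleftrightarrow> open U \<and>
     (\<forall>bs. set bs \<subseteq> Basis \<longrightarrow> (\<forall>x\<in>U. iter_pd bs f differentiable (at x)))"

definition defining_fn :: "pt set \<Rightarrow> pt set \<Rightarrow> (pt \<Rightarrow> real) \<Rightarrow> bool" where
  "defining_fn \<Omega> U \<rho> \<longleftrightarrow> open U \<and> smooth_on U \<rho> \<and>
     (\<forall>x\<in>U. frechet_derivative \<rho> (at x) \<noteq> (\<lambda>v. 0)) \<and>
     \<Omega> \<inter> U = {x\<in>U. \<rho> x < 0}"

definition smooth_boundary :: "pt set \<Rightarrow> bool" where
  "smooth_boundary \<Omega> \<longleftrightarrow> (\<forall>p\<in>frontier \<Omega>. \<exists>U \<rho>. p \<in> U \<and> defining_fn \<Omega> U \<rho>)"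

definition bounded_smooth_domain :: "pt set \<Rightarrow> bool" where
  "bounded_smooth_domain \<Omega> \<longleftrightarrow> open \<Omega> \<and> connected \<Omega> \<and> \<Omega> \<noteq> {} \<and> bounded \<Omega> \<and> smooth_boundary \<Omega>"

definition unit_normal :: "pt set \<Rightarrow> pt \<Rightarrow> pt" where
  "unit_normal \<Omega> p = (SOME N. \<exists>U \<rho> g. p \<in> U \<and> defining_fn \<Omega> U \<rho> \<and>
       (\<rho> has_derivative (\<lambda>v. g \<bullet> v)) (at p) \<and> g \<noteq> 0 \<and> N = g /\<^sub>R norm g)"

definition characteristic :: "real \<Rightarrow> pt set \<Rightarrow> pt \<Rightarrow> bool" where
  "characteristic m \<Omega> p \<longleftrightarrow> p \<in> frontier \<Omega> \<and>
     unit_normal \<Omega> p \<bullet> Xf m p = 0 \<and> unit_normal \<Omega> p \<bullet> Yf m p = 0"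

text \<open>m-admissible graph: S = {(z, \<phi> z). z \<in> A}, A open, \<phi> smooth, derivative bounds.
  |D^k \<phi>(z)| \<le> B is written as a bound on every k-th order partial derivative.\<close>
definition admissible_graph :: "real \<Rightarrow> pt set \<Rightarrow> bool" where
  "admissible_graph m S \<longleftrightarrow> (\<exists>A \<phi>. open A \<and> smooth_on A \<phi> \<and> S = (\<lambda>z. (z, \<phi> z)) ` A \<and>
     (\<exists>C>0. \<forall>z\<in>A. \<forall>bs. set bs \<subseteq> Basis \<longrightarrow>
        (length bs = 3 \<longrightarrow> \<bar>iter_pd bs \<phi> z\<bar> \<le> C * cmod z powr (2*m - 1)) \<and>
        (length bs = 2 \<longrightarrow> \<bar>iter_pd bs \<phi> z\<bar> \<le> C * cmod z powr (2*m)) \<and>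
        (length bs = 1 \<longrightarrow> \<bar>iter_pd bs \<phi> z\<bar> \<le> C * cmod z powr (2*m + 1))))"

definition admissible_domain :: "real \<Rightarrow> pt set \<Rightarrow> bool" where
  "admissible_domain m \<Omega> \<longleftrightarrow> bounded_smooth_domain \<Omega> \<and>
     (\<forall>p. characteristic m \<Omega> p \<longrightarrow>
        (\<exists>U. open U \<and> p \<in> U \<and> admissible_graph m (frontier \<Omega> \<inter> U)))"

text \<open>Two-dimensional Hausdorff measure on pt (normalised so that it equals surface area).\<close>
definition hausdorff2_outer :: "pt set \<Rightarrow> ennreal" where
  "hausdorff2_outer A = (SUP \<delta>\<in>{0<..}. INF U \<in> {U :: nat \<Rightarrow> pt set. A \<subseteq> (\<Union>i. U i) \<and>
       (\<forall>i. bounded (U i) \<and> diameter (U i) \<le> \<delta>)}.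
       (\<Sum>i. ennreal (pi / 4 * (diameter (U i))\<^sup>2)))"

definition hausdorff2 :: "pt measure" where
  "hausdorff2 = measure_of UNIV (sets borel) hausdorff2_outer"

definition mu :: "real \<Rightarrow> pt set \<Rightarrow> pt set \<Rightarrow> ennreal" where
  "mu m \<Omega> E = (\<integral>\<^sup>+ x. indicator (E \<inter> frontier \<Omega>) x *
       ennreal (sqrt ((unit_normal \<Omega> x \<bullet> Xf m x)\<^sup>2 + (unit_normal \<Omega> x \<bullet> Yf m x)\<^sup>2)) \<partial>hausdorff2)"

end

theory Submission
  imports Defs
begin

text \<open>
  Two-sided bounds on curves show that the metric ball \<open>B(p, r)\<close> is comparable with the twisted box
  \<open>|z - z_p| < r\<close>, \<open>|t - t_p - \<langle>linear in z - z_p\<rangle>| < r^2 (|z_p| + r)^(2m)\<close>, of volume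
  \<open>2 pi r^4 (|z_p| + r)^(2m)\<close>; the vertical direction is reached by lifting closed loops made of
  radial segments and circular arcs. It remains to see that \<open>\<mu>\<close> of a box is comparable with
  \<open>r^3 (|z_p| + r)^(2m)\<close>, locally uniformly in \<open>p\<close>; compactness of the boundary does the rest. Near a
  noncharacteristic point the boundary is transversal to a constant horizontal direction and is, in
  flow coordinates, a Lipschitz graph over a region of area of that order. Near a characteristic
  point the boundary is a graph \<open>t = \<phi>(z)\<close>, and the density of \<open>\<mu>\<close> is comparable with \<open>|F|\<close> for
  \<open>F = grad \<phi> + i |z|^(2m) z\<close>, whose Lipschitz constant in a box is \<open>O((|z_p| + r)^(2m))\<close> by
  admissibility. If \<open>|F(z_p)|\<close> is large compared with \<open>r (|z_p| + r)^(2m)\<close>, the box cuts out a strip on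
  which \<open>F\<close> is almost constant; otherwise it cuts out a full disc, on part of which \<open>F\<close> cannot be
  smaller than this because \<open>\<phi>\<close> is single valued along the loops.
\<close>

text \<open>Dividing the volume of the box by 2 pi r leaves the target r^3 (|z_p| + r)^(2m). The
  weight (|z_p| + r)^(2m) interpolates between |z_p|^(2m) and r^(2m) and degenerates at the axis z =
  0. Hence every Lipschitz bound on grad \<phi> and F must carry the radius of the box at hand; a
  bound with the radius of a fixed neighbourhood would lose the factor to be proved. The constants
  must moreover be the same for all p near a given boundary point, so both locales express their
  radius and constant through shared parameters. Points near a characteristic point may or may not
  be characteristic, and |F(z_p)| can have any size relative to r (|z_p| + r)^(2m). In the strip
  case the density is about |F| and the width about r^2 (|z_p| + r)^(2m) / |F|, so that |F| cancels
  from the product. Only orders of magnitude matter, so surface measure is handled without an area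
  formula: an upper bound needs a Lipschitz chart on a rectangle, a lower bound an inverse Lipschitz
  estimate.\<close>

section \<open>Absolutely continuous curves\<close>

text \<open>Gauge integrals see a function through tagged divisions, so absolute continuity is
  transferred from numbered disjoint intervals to that form.\<close>

lemma abs_cont_01_tagged:
  fixes g :: "real \<Rightarrow> 'a::real_normed_vector"
  assumes "abs_cont_01 g" "0 < e"
  obtains d where "0 < d"
    "\<And>p. \<lbrakk>p tagged_partial_division_of {0..1}; (\<Sum>(x,K)\<in>p. measure lborel K) < d\<rbrakk>
       \<Longrightarrow> (\<Sum>(x,K)\<in>p. norm (g (Sup K) - g (Inf K))) < e"
proof -
  have "\<exists>d>0. \<forall>(n::nat) (a::nat\<Rightarrow>real) b. (\<forall>i<n. 0 \<le> a i \<and> a i \<le> b i \<and> b i \<le> 1) \<and>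
      (\<forall>i<n. \<forall>j<n. i \<noteq> j \<longrightarrow> b i \<le> a j \<or> b j \<le> a i) \<and>
      (\<Sum>i<n. b i - a i) < d \<longrightarrow> (\<Sum>i<n. norm (g (b i) - g (a i))) < e"
    using assms unfolding abs_cont_01_def by simp
  then obtain d where d: "0 < d" and H: "\<forall>(n::nat) (a::nat\<Rightarrow>real) b. (\<forall>i<n. 0 \<le> a i \<and> a i \<le> b i \<and> b i \<le> 1) \<and>
      (\<forall>i<n. \<forall>j<n. i \<noteq> j \<longrightarrow> b i \<le> a j \<or> b j \<le> a i) \<and>
      (\<Sum>i<n. b i - a i) < d \<longrightarrow> (\<Sum>i<n. norm (g (b i) - g (a i))) < e"
    by (elim exE conjE)
  note ac = H[THEN spec, THEN spec, THEN spec, THEN mp, OF conjI, OF _ conjI]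
  show ?thesis
  proof (rule that[OF d])
    fix p assume p: "p tagged_partial_division_of {0..1::real}"
      and len: "(\<Sum>(x,K)\<in>p. measure lborel K) < d"
    \<comment> \<open>A degenerate interval inside another one would violate the disjointness condition in \<open>abs_cont_01\<close>.\<close>
    define q where "q = {y\<in>p. Inf (snd y) < Sup (snd y)}"
    have fp: "finite p" using p by (auto simp: tagged_partial_division_of_def)
    then have fq: "finite q" by (auto simp: q_def)
    have K: "\<exists>u v. K = {u..v} \<and> u \<le> v \<and> Inf K = u \<and> Sup K = v \<and> 0 \<le> u \<and> v \<le> 1" if "(x,K) \<in> p" for x K
    proof -
      from p that obtain u v where uv: "K = cbox u v" "x \<in> K" "K \<subseteq> {0..1}"
        unfolding tagged_partial_division_of_def by metis
      then show ?thesis by (intro exI[of _ u] exI[of _ v]) auto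
    qed
    obtain h where h: "bij_betw h {..<card q} q"
      using ex_bij_betw_nat_finite[OF fq] by (auto simp: atLeast0LessThan)
    define a where "a i = Inf (snd (h i))" for i
    define b where "b i = Sup (snd (h i))" for i
    have hq: "h i \<in> q" if "i < card q" for i using h that by (auto simp: bij_betw_def)
    have sums: "(\<Sum>i<card q. F (h i)) = (\<Sum>y\<in>q. F y)" for F :: "real \<times> real set \<Rightarrow> real"
      using sum.reindex_bij_betw[OF h] by simp
    have "(\<Sum>i<card q. norm (g (b i) - g (a i))) < e"
    proof (rule ac)
      show "\<forall>i<card q. 0 \<le> a i \<and> a i \<le> b i \<and> b i \<le> 1"
      proof (intro allI impI)
        fix i assume "i < card q"
        with hq have "(fst (h i), snd (h i)) \<in> p" by (auto simp: q_def)
        from K[OF this] show "0 \<le> a i \<and> a i \<le> b i \<and> b i \<le> 1" by (auto simp: a_def b_def)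
      qed
      show "\<forall>i<card q. \<forall>j<card q. i \<noteq> j \<longrightarrow> b i \<le> a j \<or> b j \<le> a i"
      proof (intro allI impI)
        fix i j assume ij: "i < card q" "j < card q" "i \<noteq> j"
        then have "h i \<noteq> h j" using h by (auto simp: bij_betw_def inj_on_def)
        moreover have hi: "(fst (h i), snd (h i)) \<in> p" "(fst (h j), snd (h j)) \<in> p"
          and lt: "a i < b i" "a j < b j"
          using hq ij by (auto simp: q_def a_def b_def)
        ultimately have "interior (snd (h i)) \<inter> interior (snd (h j)) = {}"
          using p unfolding tagged_partial_division_of_def by (metis prod.collapse)
        moreover obtain u v where "snd (h i) = {u..v}" "a i = u" "b i = v" using K[OF hi(1)] by (auto simp: a_def b_def)
        moreover obtain u' v' where "snd (h j) = {u'..v'}" "a j = u'" "b j = v'" using K[OF hi(2)] by (auto simp: a_def b_def)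
        ultimately have dis: "{a i<..<b i} \<inter> {a j<..<b j} = {}" by simp
        show "b i \<le> a j \<or> b j \<le> a i"
        proof (rule ccontr)
          assume "\<not> ?thesis"
          then have "max (a i) (a j) < min (b i) (b j)" using lt by auto
          then obtain w where "max (a i) (a j) < w" "w < min (b i) (b j)" using dense by blast
          then have "w \<in> {a i<..<b i} \<inter> {a j<..<b j}" by auto
          with dis show False by blast
        qed
      qed
      have "(\<Sum>i<card q. b i - a i) = (\<Sum>y\<in>q. Sup (snd y) - Inf (snd y))"
        unfolding a_def b_def by (rule sums)
      also have "\<dots> = (\<Sum>y\<in>q. measure lborel (snd y))"
      proof (rule sum.cong[OF refl])
        fix y assume "y \<in> q"
        then have "(fst y, snd y) \<in> p" by (auto simp: q_def)
        from K[OF this] obtain u v where "snd y = {u..v}" "u \<le> v" by blast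
        then show "Sup (snd y) - Inf (snd y) = measure lborel (snd y)" by simp
      qed
      also have "\<dots> \<le> (\<Sum>y\<in>p. measure lborel (snd y))"
        by (rule sum_mono2) (auto simp: fp q_def)
      finally show "(\<Sum>i<card q. b i - a i) < d" using len by (simp add: split_def)
    qed
    moreover have "(\<Sum>i<card q. norm (g (b i) - g (a i))) = (\<Sum>y\<in>q. norm (g (Sup (snd y)) - g (Inf (snd y))))"
      unfolding a_def b_def by (rule sums)
    moreover have "(\<Sum>y\<in>q. norm (g (Sup (snd y)) - g (Inf (snd y)))) = (\<Sum>y\<in>p. norm (g (Sup (snd y)) - g (Inf (snd y))))"
    proof (rule sum.mono_neutral_left[OF fp])
      show "\<forall>y\<in>p - q. norm (g (Sup (snd y)) - g (Inf (snd y))) = 0"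
      proof
        fix y assume y: "y \<in> p - q"
        then have "(fst y, snd y) \<in> p" by auto
        from K[OF this] y show "norm (g (Sup (snd y)) - g (Inf (snd y))) = 0" by (auto simp: q_def)
      qed
    qed (auto simp: q_def)
    ultimately show "(\<Sum>(x,K)\<in>p. norm (g (Sup K) - g (Inf K))) < e" by (simp add: split_def)
  qed
qed

text \<open>Fundamental theorem of calculus for the gauge integral. Intervals tagged outside
  \<open>N\<close> are controlled by differentiability at the tag. Those tagged in \<open>N\<close>
  lie in an open set of small measure, where absolute continuity makes the increments of
  \<open>g\<close> small, while their Riemann terms vanish because \<open>f\<close> is 0 on
  \<open>N\<close>.\<close>

theorem abs_cont_01_has_integral:
  fixes g :: "real \<Rightarrow> 'a::euclidean_space"
  assumes ac: "abs_cont_01 g" and N: "negligible N" and c: "0 \<le> c" "c \<le> 1"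
    and deriv: "\<And>x. x \<in> {0..1} - N \<Longrightarrow> (g has_vector_derivative f x) (at x)"
    and zero: "\<And>x. x \<in> N \<Longrightarrow> f x = 0"
  shows "(f has_integral (g c - g 0)) {0..c}"
  unfolding has_integral_real
proof (intro allI impI)
  fix e :: real assume e: "0 < e"
  obtain d where d: "0 < d" and acd: "\<And>p. \<lbrakk>p tagged_partial_division_of {0..1}; (\<Sum>(x,K)\<in>p. measure lborel K) < d\<rbrakk>
       \<Longrightarrow> (\<Sum>(x,K)\<in>p. norm (g (Sup K) - g (Inf K))) < e/2"
    using abs_cont_01_tagged[OF ac, of "e/2"] e by auto
  have "N \<in> sets lebesgue" using N by (simp add: negligible_imp_sets)
  then obtain T where T: "open T" "N \<subseteq> T" "T - N \<in> lmeasurable" "emeasure lebesgue (T - N) < ennreal d"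
    using sets_lebesgue_outer_open d by blast
  have TL: "T \<in> lmeasurable" 
    using T(2,3) N by (metis Diff_partition Un_commute fmeasurable.Un negligible_imp_measurable)
  have "emeasure lebesgue T = emeasure lebesgue (T - N)"
    using N T by (intro emeasure_Diff_null_set[symmetric]) (auto simp: negligible_iff_null_sets)
  with T(4) have Td: "measure lebesgue T < d"
    using TL d by (metis emeasure_eq_measure2 ennreal_less_iff measure_nonneg)
  have "\<exists>\<delta>>0. (x \<in> {0..1} - N \<longrightarrow> (\<forall>y. norm (y-x) < \<delta> \<longrightarrow> norm (g y - g x - (y-x) *\<^sub>R f x) \<le> e/4 * norm (y-x)))
      \<and> (x \<in> N \<longrightarrow> ball x \<delta> \<subseteq> T)" for x
  proof (cases "x \<in> N")
    case True
    then show ?thesis using T open_contains_ball by blast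
  next
    case False
    show ?thesis
    proof (cases "x \<in> {0..1}")
      case True
      with False deriv[of x] have "\<forall>e>0. \<exists>d>0. \<forall>y. norm (y - x) < d \<longrightarrow> norm (g y - g x - (y - x) *\<^sub>R f x) \<le> e * norm (y - x)"
        unfolding has_vector_derivative_def has_derivative_at_alt by blast
      moreover have "0 < e/4" using e by simp
      ultimately show ?thesis using False by blast
    qed (use False in \<open>auto intro: exI[of _ 1]\<close>)
  qed
  then obtain \<delta> where \<delta>: "\<And>x. 0 < \<delta> x" "\<And>x y. x \<in> {0..1} - N \<Longrightarrow> norm (y-x) < \<delta> x \<Longrightarrow> norm (g y - g x - (y-x) *\<^sub>R f x) \<le> e/4 * norm (y-x)"
      "\<And>x. x \<in> N \<Longrightarrow> ball x (\<delta> x) \<subseteq> T" by metis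
  show "\<exists>\<gamma>. gauge \<gamma> \<and> (\<forall>\<D>. \<D> tagged_division_of {0..c} \<and> \<gamma> fine \<D> \<longrightarrow>
        norm (sum (\<lambda>(x,k). measure lborel k *\<^sub>R f x) \<D> - (g c - g 0)) < e)"
  proof (intro exI conjI allI impI)
    show "gauge (\<lambda>x. ball x (\<delta> x))" using \<delta>(1) by (rule gauge_ball_dependent[rule_format])
  next
    fix p assume "p tagged_division_of {0..c} \<and> (\<lambda>x. ball x (\<delta> x)) fine p"
    then have p: "p tagged_division_of {0..c}" and fine: "(\<lambda>x. ball x (\<delta> x)) fine p" by auto
    have fp: "finite p" using p by auto
    have K: "\<exists>u v. K = {u..v} \<and> u \<le> v \<and> Inf K = u \<and> Sup K = v \<and> 0 \<le> u \<and> v \<le> c \<and> u \<le> x \<and> x \<le> v \<and> {u..v} \<subseteq> ball x (\<delta> x)" if "(x,K) \<in> p" for x K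
    proof -
      from p that obtain u v where uv: "K = cbox u v" "x \<in> K" "K \<subseteq> {0..c}"
        unfolding tagged_division_of_def tagged_partial_division_of_def by metis
      moreover have "K \<subseteq> ball x (\<delta> x)" using fine that by blast
      ultimately show ?thesis by (intro exI[of _ u] exI[of _ v]) auto
    qed
    let ?G = "\<lambda>(x,K). g (Sup K) - g (Inf K)"
    let ?F = "\<lambda>(x,K). measure lborel K *\<^sub>R f x"
    define q where "q = {y\<in>p. fst y \<in> N}"
    have gsum: "g c - g 0 = sum ?G p" using additive_tagged_division_1[OF c(1) p, where f=g] by simp
    have csum: "(\<Sum>(x,K)\<in>p. measure lborel K) = c"
      using additive_content_tagged_division[of p 0 c] p c by simp
    have qp: "q \<subseteq> p" by (auto simp: q_def)
    have "norm (sum ?F p - sum ?G p) \<le> (\<Sum>y\<in>p. norm (?F y - ?G y))"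
      by (simp add: sum_subtractf[symmetric] norm_sum)
    also have "\<dots> = (\<Sum>y\<in>q. norm (?F y - ?G y)) + (\<Sum>y\<in>p-q. norm (?F y - ?G y))"
      using sum.subset_diff[OF qp fp, of "\<lambda>y. norm (?F y - ?G y)"] by simp
    also have "(\<Sum>y\<in>q. norm (?F y - ?G y)) = (\<Sum>(x,K)\<in>q. norm (g (Sup K) - g (Inf K)))"
      by (rule sum.cong) (auto simp: q_def zero norm_minus_commute)
    also have "\<dots> < e/2"
    proof (rule acd)
      have pp: "p tagged_partial_division_of {0..1}"
      proof -
        have "K \<subseteq> {0..1}" if xK: "(x,K) \<in> p" for x K
        proof -
          obtain u v where "K = {u..v}" "0 \<le> u" "v \<le> c" using K[OF xK] by blast
          with c show ?thesis by auto
        qed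
        with p show ?thesis unfolding tagged_division_of_def tagged_partial_division_of_def by simp
      qed
      then show qq: "q tagged_partial_division_of {0..1}" using qp tagged_partial_division_subset by blast
      have qd: "q tagged_division_of \<Union>(snd ` q)" using tagged_partial_division_of_Union_self[OF qq] .
      have clq: "closed K" if "K \<in> snd ` q" for K :: "real set"
      proof -
        obtain x where "(x,K) \<in> p" using \<open>K \<in> snd ` q\<close> qp by force
        then obtain u v where "K = {u..v}" using K by blast
        then show ?thesis by simp
      qed
      have UL: "\<Union>(snd ` q) \<in> sets lebesgue"
      proof (rule sets.finite_Union)
        show "finite (snd ` q)" using finite_subset[OF qp fp] by simp
        show "snd ` q \<subseteq> sets lebesgue"
          using clq borel_closed sets_completionI_sets sets_lborel by blast
      qed
      \<comment> \<open>The intervals do not overlap, so integrating 1 over their union turns the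
        sum of lengths into a single measure, which that of \<open>T\<close> bounds.\<close>
      have "((\<lambda>x. 1::real) has_integral (\<Sum>(x,K)\<in>q. measure lborel K)) (\<Union>(snd ` q))"
      proof (rule has_integral_combine_tagged_division[OF qd])
        fix x L assume "(x, L) \<in> q"
        then obtain u v where "L = cbox u v" using K qp by (metis subsetD box_real(2))
        then show "((\<lambda>x. 1::real) has_integral measure lborel L) L"
          using has_integral_const[of "1::real" u v] by simp
      qed
      then have "(\<Sum>(x,K)\<in>q. measure lborel K) = measure lebesgue (\<Union>(snd ` q))"
        using UL by (metis has_integral_integrable integral_unique lmeasurable_iff_integrable_on lmeasure_integral)
      also have "\<dots> \<le> measure lebesgue T"
      proof (rule measure_mono_fmeasurable)
        show "\<Union>(snd ` q) \<subseteq> T" 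
        proof
          fix w assume "w \<in> \<Union>(snd ` q)"
          then obtain x L where "(x,L) \<in> p" "x \<in> N" "w \<in> L" by (auto simp: q_def)
          then show "w \<in> T" using K[of x L] \<delta>(3)[of x] by auto
        qed
      qed (rule UL, rule TL)
      finally show "(\<Sum>(x,K)\<in>q. measure lborel K) < d" using Td by simp
    qed
    also have "(\<Sum>y\<in>p-q. norm (?F y - ?G y)) \<le> (\<Sum>y\<in>p-q. e/4 * measure lborel (snd y))"
    proof (rule sum_mono)
      fix y assume y: "y \<in> p - q"
      obtain x L where yx: "y = (x, L)" by force
      with y have xL: "(x,L) \<in> p" and xN: "x \<notin> N" by (auto simp: q_def)
      from K[OF xL] obtain u v where uv: "L = {u..v}" "u \<le> v" "Inf L = u" "Sup L = v" "0 \<le> u" "v \<le> c" "u \<le> x" "x \<le> v" "{u..v} \<subseteq> ball x (\<delta> x)" by auto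
      have "norm (u - x) < \<delta> x" "norm (v - x) < \<delta> x"
        using uv(2,9) by (force simp: dist_real_def)+
      moreover have "x \<in> {0..1} - N" using xN uv c by auto
      ultimately have 1: "norm (g u - g x - (u-x) *\<^sub>R f x) \<le> e/4 * norm (u-x)"
        "norm (g v - g x - (v-x) *\<^sub>R f x) \<le> e/4 * norm (v-x)"
        using \<delta>(2) by blast+
      \<comment> \<open>The increment over [u, v] is split at the tag x, so both halves are compared
        with the derivative at x.\<close>
      have "norm ((v - u) *\<^sub>R f x - (g v - g u)) = norm ((g u - g x - (u-x) *\<^sub>R f x) - (g v - g x - (v-x) *\<^sub>R f x))"
        by (simp add: algebra_simps)
      also have "\<dots> \<le> e/4 * norm (u-x) + e/4 * norm (v-x)"
        using norm_triangle_ineq4 1 by (meson add_mono order_trans)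
      also have "\<dots> = e/4 * (v - u)" using uv(7,8) by (simp add: field_simps)
      finally show "norm (?F y - ?G y) \<le> e/4 * measure lborel (snd y)" using uv yx by simp
    qed
    also have "\<dots> \<le> (\<Sum>y\<in>p. e/4 * measure lborel (snd y))" using e by (intro sum_mono2) (auto simp: fp)
    also have "\<dots> = e/4 * c" using csum by (simp only: sum_distrib_left[symmetric] split_def)
    also have "\<dots> \<le> e/4" using c e by simp
    finally show "norm (sum ?F p - (g c - g 0)) < e" using e gsum by simp
  qed
qed

section \<open>Horizontal curves\<close>

definition twist :: "nat \<Rightarrow> complex \<Rightarrow> complex" where
  "twist m z = cmod z ^ (2*m) *\<^sub>R z"

text \<open>The height velocity forced on a horizontal curve at z with planar velocity w, that is,
  the form |z|^(2m) (y dx - x dy) at w. As an imaginary part it is easily evaluated in polar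
  coordinates.\<close>

definition hslope :: "nat \<Rightarrow> complex \<Rightarrow> complex \<Rightarrow> real" where
  "hslope m z w = Im (twist m z * cnj w)"

lemma hfield_eq:
  assumes "m \<ge> 1"
  shows "a *\<^sub>R Xf (real m) p + b *\<^sub>R Yf (real m) p = (Complex a b, hslope m (fst p) (Complex a b))"
proof -
  \<comment> \<open>At z = 0 the two powers agree because m >= 1; for m = 0 they would differ, since
    0 powr 0 is 0.\<close>
  have "cmod (fst p) powr (2 * real m) = cmod (fst p) ^ (2*m)"
    using assms by (cases "fst p = 0") (auto simp: powr_realpow[symmetric] power_0_left)
  then show ?thesis
    by (simp add: Xf_def Yf_def hslope_def twist_def complex_eq_iff algebra_simps)
qed

lemma hslope_add: "hslope m z (v + w) = hslope m z v + hslope m z w"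
  and hslope_diff: "hslope m z (v - w) = hslope m z v - hslope m z w"
  and hslope_minus: "hslope m z (- w) = - hslope m z w"
  and hslope_scaleR: "hslope m z (c *\<^sub>R w) = c * hslope m z w"
  and hslope_zero [simp]: "hslope m z 0 = 0"
  by (simp_all add: hslope_def algebra_simps)

lemma bounded_linear_hslope: "bounded_linear (hslope m z)"
proof (rule bounded_linear_intro[of _ "cmod (twist m z)"])
  fix w show "norm (hslope m z w) \<le> norm w * cmod (twist m z)"
    using abs_Im_le_cmod[of "twist m z * cnj w"] by (simp only: hslope_def norm_mult complex_mod_cnj real_norm_def mult.commute)
qed (simp_all only: hslope_add hslope_scaleR real_scaleR_def)

lemma abs_diff_hslope_le: "\<bar>hslope m z v - hslope m z' v\<bar> \<le> cmod (twist m z - twist m z') * cmod v"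
proof -
  have "hslope m z v - hslope m z' v = Im ((twist m z - twist m z') * cnj v)"
    by (simp add: hslope_def algebra_simps)
  also have "\<bar>\<dots>\<bar> \<le> cmod ((twist m z - twist m z') * cnj v)" by (rule abs_Im_le_cmod)
  finally show ?thesis by (simp add: norm_mult)
qed

lemma abs_hslope_le: "\<bar>hslope m z v\<bar> \<le> cmod z ^ (2*m+1) * cmod v"
  using abs_Im_le_cmod[of "twist m z * cnj v"] by (simp add: hslope_def twist_def norm_mult ac_simps)

lemma abs_power_diff_le:
  fixes a b R :: real
  assumes "0 \<le> a" "a \<le> R" "0 \<le> b" "b \<le> R"
  shows "\<bar>a ^ Suc n - b ^ Suc n\<bar> \<le> real (Suc n) * R ^ n * \<bar>a - b\<bar>"
proof (induction n)
  case 0 then show ?case by simp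
next
  case (Suc n)
  have "a ^ Suc (Suc n) - b ^ Suc (Suc n) = a * (a ^ Suc n - b ^ Suc n) + (a - b) * b ^ Suc n"
    by (simp add: algebra_simps)
  also have "\<bar>\<dots>\<bar> \<le> a * \<bar>a ^ Suc n - b ^ Suc n\<bar> + \<bar>a - b\<bar> * b ^ Suc n"
    using assms by (intro order_trans[OF abs_triangle_ineq]) (simp add: abs_mult)
  also have "\<dots> \<le> R * (real (Suc n) * R ^ n * \<bar>a - b\<bar>) + \<bar>a - b\<bar> * R ^ Suc n"
    using assms Suc.IH by (intro add_mono mult_mono power_mono) auto
  also have "\<dots> = real (Suc (Suc n)) * R ^ Suc n * \<bar>a - b\<bar>" by (simp add: algebra_simps)
  finally show ?case .
qed

text \<open>Moving the factor z contributes 1 and changing |z|^(2m) contributes 2m, whence 2m +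
  1.\<close>

lemma twist_lipschitz:
  assumes "m \<ge> 1" "cmod z \<le> R" "cmod w \<le> R"
  shows "cmod (twist m z - twist m w) \<le> (2 * real m + 1) * R ^ (2*m) * cmod (z - w)"
proof -
  have R: "0 \<le> R" using assms(2) norm_ge_zero order_trans by blast
  obtain k where k: "2 * m = Suc k" using assms(1) by (cases "2*m") auto
  have "twist m z - twist m w = cmod z ^ (2*m) *\<^sub>R (z - w) + (cmod z ^ (2*m) - cmod w ^ (2*m)) *\<^sub>R w"
    by (simp add: twist_def algebra_simps)
  also have "cmod \<dots> \<le> cmod z ^ (2*m) * cmod (z - w) + \<bar>cmod z ^ (2*m) - cmod w ^ (2*m)\<bar> * cmod w"
    by (intro order_trans[OF norm_triangle_ineq]) simp
  also have "\<dots> \<le> R ^ (2*m) * cmod (z - w) + (real (Suc k) * R ^ k * \<bar>cmod z - cmod w\<bar>) * R"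
    using assms R unfolding k by (intro add_mono mult_mono power_mono abs_power_diff_le) auto
  also have "\<dots> = R ^ (2*m) * cmod (z - w) + (real (2*m) * R ^ (2*m)) * \<bar>cmod z - cmod w\<bar>"
    unfolding k by simp
  also have "\<dots> \<le> R ^ (2*m) * cmod (z - w) + (real (2*m) * R ^ (2*m)) * cmod (z - w)"
    using R norm_triangle_ineq3[of z w] by (intro add_mono mult_left_mono) auto
  finally show ?thesis by (simp add: algebra_simps)
qed

lemma continuous_twist: "continuous_on S (twist m)"
  unfolding twist_def by (intro continuous_intros)

definition hvel :: "nat \<Rightarrow> complex \<Rightarrow> complex \<Rightarrow> pt" where
  "hvel m z w = (w, hslope m z w)"

section \<open>Operations that preserve absolute continuity\<close>

lemma abs_cont_01_add:
  assumes f: "abs_cont_01 f" and g: "abs_cont_01 g"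
  shows "abs_cont_01 (\<lambda>s. f s + g s)"
  unfolding abs_cont_01_def
proof (intro allI impI)
  fix e :: real assume "0 < e"
  then have e: "0 < e/2" by simp
  obtain d1 where d1: "0 < d1" "\<And>(n::nat) a b. (\<forall>i<n. 0 \<le> a i \<and> a i \<le> b i \<and> b i \<le> 1) \<and>
      (\<forall>i<n. \<forall>j<n. i \<noteq> j \<longrightarrow> b i \<le> a j \<or> b j \<le> a i) \<and> (\<Sum>i<n. b i - a i) < d1
      \<Longrightarrow> (\<Sum>i<n. norm (f (b i) - f (a i))) < e/2"
    using f[unfolded abs_cont_01_def, rule_format, OF e] by (elim exE conjE) simp
  obtain d2 where d2: "0 < d2" "\<And>(n::nat) a b. (\<forall>i<n. 0 \<le> a i \<and> a i \<le> b i \<and> b i \<le> 1) \<and>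
      (\<forall>i<n. \<forall>j<n. i \<noteq> j \<longrightarrow> b i \<le> a j \<or> b j \<le> a i) \<and> (\<Sum>i<n. b i - a i) < d2
      \<Longrightarrow> (\<Sum>i<n. norm (g (b i) - g (a i))) < e/2"
    using g[unfolded abs_cont_01_def, rule_format, OF e] by (elim exE conjE) simp
  show "\<exists>d>0. \<forall>(n::nat) a b. (\<forall>i<n. 0 \<le> a i \<and> a i \<le> b i \<and> b i \<le> 1) \<and>
      (\<forall>i<n. \<forall>j<n. i \<noteq> j \<longrightarrow> b i \<le> a j \<or> b j \<le> a i) \<and> (\<Sum>i<n. b i - a i) < d \<longrightarrow>
      (\<Sum>i<n. norm (f (b i) + g (b i) - (f (a i) + g (a i)))) < e"
  proof (intro exI[of _ "min d1 d2"] conjI allI impI)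
    fix n :: nat and a b :: "nat \<Rightarrow> real"
    assume H: "(\<forall>i<n. 0 \<le> a i \<and> a i \<le> b i \<and> b i \<le> 1) \<and>
      (\<forall>i<n. \<forall>j<n. i \<noteq> j \<longrightarrow> b i \<le> a j \<or> b j \<le> a i) \<and> (\<Sum>i<n. b i - a i) < min d1 d2"
    have "(\<Sum>i<n. norm (f (b i) + g (b i) - (f (a i) + g (a i)))) 
        \<le> (\<Sum>i<n. norm (f (b i) - f (a i)) + norm (g (b i) - g (a i)))"
      by (intro sum_mono) (metis add_diff_add norm_triangle_ineq)
    also have "\<dots> < e/2 + e/2" unfolding sum.distrib
      by (intro add_strict_mono d1(2) d2(2)) (use H in simp)+
    finally show "(\<Sum>i<n. norm (f (b i) + g (b i) - (f (a i) + g (a i)))) < e" by simp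
  qed (use d1 d2 in auto)
qed

text \<open>Monotonicity of h keeps disjoint intervals disjoint, and its Lipschitz bound controls
  their total length.\<close>

lemma abs_cont_01_compose:
  assumes g: "abs_cont_01 g" and K: "0 < K"
    and h: "\<And>x y. 0 \<le> x \<Longrightarrow> x \<le> y \<Longrightarrow> y \<le> 1 \<Longrightarrow> 0 \<le> h x \<and> h x \<le> h y \<and> h y \<le> 1 \<and> h y - h x \<le> K * (y - x)"
  shows "abs_cont_01 (\<lambda>s. g (h s))"
  unfolding abs_cont_01_def
proof (intro allI impI)
  fix e :: real assume e: "0 < e"
  obtain d where d: "0 < d" "\<And>(n::nat) a b. (\<forall>i<n. 0 \<le> a i \<and> a i \<le> b i \<and> b i \<le> 1) \<and>
      (\<forall>i<n. \<forall>j<n. i \<noteq> j \<longrightarrow> b i \<le> a j \<or> b j \<le> a i) \<and> (\<Sum>i<n. b i - a i) < d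
      \<Longrightarrow> (\<Sum>i<n. norm (g (b i) - g (a i))) < e"
    using g[unfolded abs_cont_01_def, rule_format, OF e] by (elim exE conjE) simp
  show "\<exists>d>0. \<forall>(n::nat) a b. (\<forall>i<n. 0 \<le> a i \<and> a i \<le> b i \<and> b i \<le> 1) \<and>
      (\<forall>i<n. \<forall>j<n. i \<noteq> j \<longrightarrow> b i \<le> a j \<or> b j \<le> a i) \<and> (\<Sum>i<n. b i - a i) < d \<longrightarrow>
      (\<Sum>i<n. norm (g (h (b i)) - g (h (a i)))) < e"
  proof (intro exI[of _ "d/K"] conjI allI impI)
    fix n :: nat and a b :: "nat \<Rightarrow> real"
    assume H: "(\<forall>i<n. 0 \<le> a i \<and> a i \<le> b i \<and> b i \<le> 1) \<and>
      (\<forall>i<n. \<forall>j<n. i \<noteq> j \<longrightarrow> b i \<le> a j \<or> b j \<le> a i) \<and> (\<Sum>i<n. b i - a i) < d/K"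
    show "(\<Sum>i<n. norm (g (h (b i)) - g (h (a i)))) < e"
    proof (rule d(2), intro conjI)
      show "\<forall>i<n. 0 \<le> h (a i) \<and> h (a i) \<le> h (b i) \<and> h (b i) \<le> 1" using H h by blast
      show "\<forall>i<n. \<forall>j<n. i \<noteq> j \<longrightarrow> h (b i) \<le> h (a j) \<or> h (b j) \<le> h (a i)"
      proof (intro allI impI)
        fix i j assume ij: "i < n" "j < n" "i \<noteq> j"
        then consider "b i \<le> a j" | "b j \<le> a i" using H by blast
        then show "h (b i) \<le> h (a j) \<or> h (b j) \<le> h (a i)"
        proof cases
          case 1
          then show ?thesis using h[of "b i" "a j"] H ij by (meson order_trans)
        next
          case 2
          then show ?thesis using h[of "b j" "a i"] H ij by (meson order_trans)
        qed
      qed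
      have "(\<Sum>i<n. h (b i) - h (a i)) \<le> (\<Sum>i<n. K * (b i - a i))"
        using H h by (intro sum_mono) auto
      also have "\<dots> = K * (\<Sum>i<n. b i - a i)" by (simp add: sum_distrib_left)
      also have "\<dots> < K * (d/K)" using H K by (intro mult_strict_left_mono) auto
      finally show "(\<Sum>i<n. h (b i) - h (a i)) < d" using K by simp
    qed
  qed (use d K in auto)
qed

lemma abs_cont_01_lipschitz:
  assumes "\<And>x y. 0 \<le> x \<Longrightarrow> x \<le> y \<Longrightarrow> y \<le> 1 \<Longrightarrow> norm (g y - g x) \<le> K * (y - x)"
  shows "abs_cont_01 g"
  unfolding abs_cont_01_def
proof (intro allI impI)
  fix e :: real assume e: "0 < e"
  show "\<exists>d>0. \<forall>(n::nat) a b. (\<forall>i<n. 0 \<le> a i \<and> a i \<le> b i \<and> b i \<le> 1) \<and>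
      (\<forall>i<n. \<forall>j<n. i \<noteq> j \<longrightarrow> b i \<le> a j \<or> b j \<le> a i) \<and> (\<Sum>i<n. b i - a i) < d \<longrightarrow>
      (\<Sum>i<n. norm (g (b i) - g (a i))) < e"
  proof (intro exI[of _ "e/(\<bar>K\<bar>+1)"] conjI allI impI)
    fix n :: nat and a b :: "nat \<Rightarrow> real"
    assume H: "(\<forall>i<n. 0 \<le> a i \<and> a i \<le> b i \<and> b i \<le> 1) \<and>
      (\<forall>i<n. \<forall>j<n. i \<noteq> j \<longrightarrow> b i \<le> a j \<or> b j \<le> a i) \<and> (\<Sum>i<n. b i - a i) < e/(\<bar>K\<bar>+1)"
    have "(\<Sum>i<n. norm (g (b i) - g (a i))) \<le> (\<Sum>i<n. (\<bar>K\<bar>+1) * (b i - a i))"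
    proof (rule sum_mono)
      fix i assume "i \<in> {..<n}"
      then have "0 \<le> a i" "a i \<le> b i" "b i \<le> 1" using H by auto
      then show "norm (g (b i) - g (a i)) \<le> (\<bar>K\<bar>+1) * (b i - a i)"
        by (intro order_trans[OF assms] mult_right_mono) auto
    qed
    also have "\<dots> = (\<bar>K\<bar>+1) * (\<Sum>i<n. b i - a i)" by (simp add: sum_distrib_left)
    also have "\<dots> < (\<bar>K\<bar>+1) * (e/(\<bar>K\<bar>+1))" using H by (intro mult_strict_left_mono) auto
    finally show "(\<Sum>i<n. norm (g (b i) - g (a i))) < e" by simp
  qed (use e in auto)
qed

section \<open>Length of horizontal curves and first estimates of the distance\<close>

text \<open>Converts almost-everywhere data into the form that the fundamental theorem expects: an
  exceptional null set on which the planar velocity w is set to 0, and the length as an ordinary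
  integral of |w|.\<close>

lemma horizontal_curveD:
  assumes m: "m \<ge> 1" and hor: "horizontal (real m) g \<alpha> \<beta>" and fin: "hlength \<alpha> \<beta> < top"
  obtains N w L where "negligible N" "\<And>s. s \<in> {0..1} - N \<Longrightarrow> (g has_vector_derivative hvel m (fst (g s)) (w s)) (at s)"
    "\<And>s. s \<in> N \<Longrightarrow> w s = 0" "((\<lambda>s. cmod (w s)) has_integral L) {0..1}" "hlength \<alpha> \<beta> = ennreal L" "0 \<le> L"
proof -
  from hor have ac: "abs_cont_01 g" and ae: "AE s in lebesgue. s \<in> {0..1} \<longrightarrow>
        (g has_vector_derivative (\<alpha> s *\<^sub>R Xf m (g s) + \<beta> s *\<^sub>R Yf m (g s))) (at s)"
    by (auto simp: horizontal_def)
  define N where "N = {s. \<not> (s \<in> {0..1} \<longrightarrow> (g has_vector_derivative (\<alpha> s *\<^sub>R Xf m (g s) + \<beta> s *\<^sub>R Yf m (g s))) (at s))}"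
  from ae obtain N' where "N' \<in> null_sets lebesgue" "N \<subseteq> N'"
    unfolding eventually_ae_filter N_def by auto
  then have N: "negligible N" using negligible_iff_null_sets negligible_subset by blast
  define w where "w s = (if s \<in> N then 0 else Complex (\<alpha> s) (\<beta> s))" for s
  have d: "(g has_vector_derivative hvel m (fst (g s)) (w s)) (at s)" if "s \<in> {0..1} - N" for s
    using that by (auto simp: N_def w_def hvel_def hfield_eq[OF m])
  \<comment> \<open>Measurability of the controls is recovered here: integrability of the velocity
    makes its planar part w measurable. Finite length then upgrades this to absolute
    integrability.\<close>
  have "((\<lambda>s. hvel m (fst (g s)) (w s)) has_integral g 1 - g 0) {0..1}"
    by (rule abs_cont_01_has_integral[OF ac N]) (use d in \<open>auto simp: hvel_def w_def zero_prod_def\<close>)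
  from has_integral_linear[OF this bounded_linear_fst]
  have wi: "(w has_integral fst (g 1 - g 0)) {0..1}" by (simp add: o_def hvel_def)
  then have meas: "(\<lambda>s. indicator {0..1} s *\<^sub>R w s) \<in> borel_measurable lebesgue"
    by (rule has_integral_implies_lebesgue_measurable)
  have aeN: "AE s in lebesgue. s \<notin> N" using N by (simp add: negligible_iff_null_sets AE_not_in)
  have "hlength \<alpha> \<beta> = (\<integral>\<^sup>+ s. ennreal (norm (indicator {0..1} s *\<^sub>R w s)) \<partial>lebesgue)"
    unfolding hlength_def using aeN
    by (intro nn_integral_cong_AE) (auto elim!: eventually_mono simp: w_def cmod_def indicator_def)
  with fin meas have "integrable lebesgue (\<lambda>s. indicator {0..1} s *\<^sub>R w s)"
    by (intro integrableI_bounded) auto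
  then have abs: "w absolutely_integrable_on {0..1}" by (simp add: set_integrable_def)
  define L where "L = integral {0..1} (\<lambda>s. cmod (w s))"
  have L: "((\<lambda>s. cmod (w s)) has_integral L) {0..1}"
    using abs by (simp add: absolutely_integrable_on_def L_def integrable_integral)
  have "hlength \<alpha> \<beta> = (\<integral>\<^sup>+ s. ennreal (indicator {0..1} s * cmod (w s)) \<partial>lebesgue)"
    unfolding hlength_def using aeN
    by (intro nn_integral_cong_AE) (auto elim!: eventually_mono simp: w_def cmod_def indicator_def)
  also have "\<dots> = ennreal L" unfolding nn_integral_completion
    using nn_integral_has_integral_lebesgue[OF _ L] by simp
  finally have hl: "hlength \<alpha> \<beta> = ennreal L" .
  show ?thesis
    by (rule that[OF N d _ L hl]) (auto simp: w_def intro: has_integral_nonneg[OF L])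
qed

lemma cc_dist_le_hcurve:
  assumes m: "m \<ge> 1" and ac: "abs_cont_01 g" and N: "negligible N"
    and d: "\<And>s. s \<in> {0..1} - N \<Longrightarrow> (g has_vector_derivative hvel m (fst (g s)) (w s)) (at s)"
    and L: "((\<lambda>s. cmod (w s)) has_integral L) {0..1}"
  shows "cc_dist (real m) (g 0) (g 1) \<le> ennreal L"
proof -
  have "AE s in lebesgue. s \<notin> N" using N by (simp add: negligible_iff_null_sets AE_not_in)
  then have "AE s in lebesgue. s \<in> {0..1} \<longrightarrow> (g has_vector_derivative (Re (w s) *\<^sub>R Xf m (g s) + Im (w s) *\<^sub>R Yf m (g s))) (at s)"
    by (rule eventually_mono) (use d in \<open>auto simp: hfield_eq[OF m] hvel_def\<close>)
  with ac have hor: "horizontal (real m) g (\<lambda>s. Re (w s)) (\<lambda>s. Im (w s))" by (simp add: horizontal_def)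
  have "hlength (\<lambda>s. Re (w s)) (\<lambda>s. Im (w s)) = (\<integral>\<^sup>+ s. ennreal (indicator {0..1} s * cmod (w s)) \<partial>lebesgue)"
    unfolding hlength_def by (intro nn_integral_cong) (auto simp: cmod_def indicator_def)
  also have "\<dots> = ennreal L" unfolding nn_integral_completion
    using nn_integral_has_integral_lebesgue[OF _ L] by simp
  finally show ?thesis using hor unfolding cc_dist_def by (intro Inf_lower) (auto intro!: exI)
qed

lemma cc_dist_less_hcurve:
  assumes m: "m \<ge> 1" and less: "cc_dist (real m) p q < ennreal r"
  shows "\<exists>g N w L. abs_cont_01 g \<and> negligible N \<and>
    (\<forall>s\<in>{0..1} - N. (g has_vector_derivative hvel m (fst (g s)) (w s)) (at s)) \<and> (\<forall>s\<in>N. w s = 0) \<and>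
    ((\<lambda>s. cmod (w s)) has_integral L) {0..1} \<and> 0 \<le> L \<and> L < r \<and> g 0 = p \<and> g 1 = q"
proof -
  from less obtain g \<alpha> \<beta> where g: "horizontal (real m) g \<alpha> \<beta>" "g 0 = p" "g 1 = q" and hl: "hlength \<alpha> \<beta> < ennreal r"
    unfolding cc_dist_def Inf_less_iff by blast
  from hl have "hlength \<alpha> \<beta> < top" using order_less_le_trans top_greatest by blast
  from horizontal_curveD[OF m g(1) this] obtain N w L where
    "negligible N" "\<And>s. s \<in> {0..1} - N \<Longrightarrow> (g has_vector_derivative hvel m (fst (g s)) (w s)) (at s)"
    "\<And>s. s \<in> N \<Longrightarrow> w s = 0" "((\<lambda>s. cmod (w s)) has_integral L) {0..1}" and L: "hlength \<alpha> \<beta> = ennreal L" "0 \<le> L" by metis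
  moreover have "L < r" using hl L by (simp add: ennreal_less_iff)
  moreover have "abs_cont_01 g" using g(1) by (simp add: horizontal_def)
  ultimately show ?thesis using g by blast
qed

text \<open>The curve stays within r of the planar point of p. The height defect is the integral of
  the slope at the moving point minus the slope at p, both applied to w. By the Lipschitz bound on
  \<open>twist\<close> the slopes differ by O(r (|z_p| + r)^(2m)) |w|, and integrating |w| gives the
  second factor r.\<close>

lemma cc_dist_less_imp:
  assumes m: "m \<ge> 1" and less: "cc_dist (real m) p q < ennreal r"
  shows "cmod (fst q - fst p) < r"
    and "\<bar>snd q - snd p - hslope m (fst p) (fst q - fst p)\<bar> \<le> (2 * real m + 1) * r\<^sup>2 * (cmod (fst p) + r) ^ (2*m)"
proof -
  from cc_dist_less_hcurve[OF m less]
  obtain g N w L where ac: "abs_cont_01 g" and N: "negligible N"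
    and d0: "\<forall>s\<in>{0..1} - N. (g has_vector_derivative hvel m (fst (g s)) (w s)) (at s)" and w0: "\<forall>s\<in>N. w s = 0"
    and L: "((\<lambda>s. cmod (w s)) has_integral L) {0..1}" "0 \<le> L" "L < r" and g: "g 0 = p" "g 1 = q"
    by (elim exE conjE) (rule that)
  note d = bspec[OF d0]
  define f where "f s = hvel m (fst (g s)) (w s)" for s
  have I: "(f has_integral (g c - p)) {0..c}" if "0 \<le> c" "c \<le> 1" for c
    unfolding g(1)[symmetric]
    by (rule abs_cont_01_has_integral[OF ac N that]) (use d in \<open>auto simp: f_def hvel_def w0 zero_prod_def\<close>)
  have wi: "(w has_integral (fst (g c) - fst p)) {0..c}" if "0 \<le> c" "c \<le> 1" for c
    using has_integral_linear[OF I[OF that] bounded_linear_fst] by (simp add: o_def f_def hvel_def)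
  have near: "cmod (fst (g c) - fst p) \<le> L" if c: "0 \<le> c" "c \<le> 1" for c
  proof -
    have ii: "(\<lambda>s. cmod (w s)) integrable_on {0..c}"
      using integrable_on_subinterval[OF has_integral_integrable[OF L(1)]] c by auto
    have "cmod (integral {0..c} w) \<le> integral {0..c} (\<lambda>s. cmod (w s))"
      by (rule Henstock_Kurzweil_Integration.integral_norm_bound_integral) (use wi[OF c] ii in \<open>auto simp: has_integral_integrable\<close>)
    also have "\<dots> \<le> integral {0..1} (\<lambda>s. cmod (w s))"
      using c L(1) ii by (intro integral_subset_le) (auto simp: has_integral_integrable)
    finally show ?thesis using wi[OF c] L(1) by (simp add: integral_unique)
  qed
  show "cmod (fst q - fst p) < r" using near[of 1] g L by simp
  define B where "B = (2 * real m + 1) * (cmod (fst p) + r) ^ (2*m) * r"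
  have lin: "bounded_linear (\<lambda>v::pt. snd v - hslope m (fst p) (fst v))"
    by (rule bounded_linear_sub[OF bounded_linear_snd bounded_linear_compose[OF bounded_linear_hslope bounded_linear_fst]])
  have I1: "(f has_integral (q - p)) {0..1}" using I[of 1] g by simp
  have i1: "((\<lambda>s. hslope m (fst (g s)) (w s) - hslope m (fst p) (w s)) has_integral
      (snd q - snd p - hslope m (fst p) (fst q - fst p))) {0..1}"
    using has_integral_linear[OF I1 lin] by (simp add: o_def f_def hvel_def)
  have i2: "((\<lambda>s. B * cmod (w s)) has_integral (B * L)) {0..1}"
    using has_integral_mult_right[OF L(1)] .
  have "\<bar>hslope m (fst (g s)) (w s) - hslope m (fst p) (w s)\<bar> \<le> B * cmod (w s)" if s: "s \<in> {0..1}" for s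
  proof -
    have n: "cmod (fst (g s) - fst p) \<le> r" using near[of s] s L by auto
    have "cmod (fst (g s)) \<le> cmod (fst p) + r" using n norm_triangle_sub[of "fst (g s)" "fst p"] by simp
    then have "cmod (twist m (fst (g s)) - twist m (fst p)) \<le> (2 * real m + 1) * (cmod (fst p) + r) ^ (2*m) * cmod (fst (g s) - fst p)"
      using L by (intro twist_lipschitz[OF m]) auto
    also have "\<dots> \<le> B" unfolding B_def using n L by (intro mult_left_mono) auto
    finally show ?thesis using abs_diff_hslope_le[of m "fst (g s)" "w s" "fst p"]
      by (meson mult_right_mono norm_ge_zero order_trans)
  qed
  then have "\<bar>snd q - snd p - hslope m (fst p) (fst q - fst p)\<bar> \<le> B * L"
    using Henstock_Kurzweil_Integration.integral_norm_bound_integral[OF has_integral_integrable[OF i1] has_integral_integrable[OF i2]]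
    unfolding integral_unique[OF i1] integral_unique[OF i2] by simp
  also have "\<dots> \<le> B * r" using L by (intro mult_left_mono) (auto simp: B_def)
  finally show "\<bar>snd q - snd p - hslope m (fst p) (fst q - fst p)\<bar> \<le> (2 * real m + 1) * r\<^sup>2 * (cmod (fst p) + r) ^ (2*m)"
    by (simp add: B_def power2_eq_square ac_simps)
qed

lemma cc_dist_less_trans:
  assumes m: "m \<ge> 1" and less: "cc_dist (real m) p q < ennreal a" "cc_dist (real m) q r < ennreal b"
  shows "cc_dist (real m) p r < ennreal (a + b)"
proof -
  from cc_dist_less_hcurve[OF m less(1)]
  obtain g N w L where ac: "abs_cont_01 g" and N: "negligible N"
    and d0: "\<forall>s\<in>{0..1} - N. (g has_vector_derivative hvel m (fst (g s)) (w s)) (at s)" and w0: "\<forall>s\<in>N. w s = 0"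
    and L: "((\<lambda>s. cmod (w s)) has_integral L) {0..1}" "0 \<le> L" "L < a" and g: "g 0 = p" "g 1 = q"
    by (elim exE conjE) (rule that)
  note d = bspec[OF d0]
  from cc_dist_less_hcurve[OF m less(2)]
  obtain g' N' w' L' where ac': "abs_cont_01 g'" and N': "negligible N'"
    and d0': "\<forall>s\<in>{0..1} - N'. (g' has_vector_derivative hvel m (fst (g' s)) (w' s)) (at s)" and w0': "\<forall>s\<in>N'. w' s = 0"
    and L': "((\<lambda>s. cmod (w' s)) has_integral L') {0..1}" "0 \<le> L'" "L' < b" and g': "g' 0 = q" "g' 1 = r"
    by (elim exE conjE) (rule that)
  note d' = bspec[OF d0']
  \<comment> \<open>In this form the concatenation is a sum of reparametrisations, hence absolutely continuous.\<close>
  define k where "k s = g (min 1 (2 * s)) + g' (max 0 (2 * s-1)) - q" for s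
  define u where "u s = 2 *\<^sub>R (if s < 1/2 then w (2 * s) else w' (2 * s-1))" for s
  define M where "M = ((\<lambda>s. s / 2) ` N) \<union> ((\<lambda>s. (s + 1) / 2) ` N') \<union> {1/2}"
  have ack: "abs_cont_01 k"
  proof -
    have "abs_cont_01 (\<lambda>s. g (min 1 (2 * s)))" by (rule abs_cont_01_compose[OF ac, of 2]) auto
    moreover have "abs_cont_01 (\<lambda>s. g' (max 0 (2 * s-1)))" by (rule abs_cont_01_compose[OF ac', of 2]) auto
    moreover have "abs_cont_01 (\<lambda>s. - q)" by (rule abs_cont_01_lipschitz[of _ 0]) auto
    ultimately have "abs_cont_01 (\<lambda>s. (g (min 1 (2 * s)) + g' (max 0 (2 * s - 1))) + - q)"
      by (intro abs_cont_01_add)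
    then show ?thesis by (simp add: k_def[abs_def])
  qed
  have M: "negligible M"
  proof -
    have "negligible ((\<lambda>s. s / 2) ` N)"
      by (rule negligible_differentiable_image_negligible[OF _ N]) (auto intro!: derivative_intros simp: differentiable_on_def)
    moreover have "negligible ((\<lambda>s. (s + 1) / 2) ` N')"
      by (rule negligible_differentiable_image_negligible[OF _ N']) (auto intro!: derivative_intros simp: differentiable_on_def)
    ultimately show ?thesis by (simp add: M_def)
  qed
  have dk: "(k has_vector_derivative hvel m (fst (k s)) (u s)) (at s)" if s: "s \<in> {0..1} - M" for s
  proof (cases "s < 1/2")
    case True
    have "2 * s \<notin> N"
    proof
      assume "2 * s \<in> N"
      then have "s \<in> (\<lambda>s. s / 2) ` N" by (intro image_eqI[of _ _ "2 * s"]) auto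
      with s show False by (simp add: M_def)
    qed
    then have "2 * s \<in> {0..1} - N" using s True by auto
    from d[OF this] have "(g has_vector_derivative hvel m (fst (g (2 * s))) (w (2 * s))) (at (2 * s))" .
    then have "((g \<circ> (\<lambda>s. 2 * s)) has_vector_derivative (2 *\<^sub>R hvel m (fst (g (2 * s))) (w (2 * s)))) (at s)"
      by (intro vector_diff_chain_at) (auto intro!: derivative_eq_intros)
    then have "(k has_vector_derivative (2 *\<^sub>R hvel m (fst (g (2 * s))) (w (2 * s)))) (at s)"
      by (rule has_vector_derivative_transform_within_open[where S="{..<1/2}"]) (use True in \<open>auto simp: k_def g'\<close>)
    then show ?thesis using True by (simp add: hvel_def u_def hslope_scaleR k_def g')
  next
    case False
    then have s': "s > 1/2" using s by (auto simp: M_def)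
    have "2 * s - 1 \<notin> N'"
    proof
      assume "2 * s - 1 \<in> N'"
      then have "s \<in> (\<lambda>s. (s + 1) / 2) ` N'" by (intro image_eqI[of _ _ "2 * s - 1"]) auto
      with s show False by (simp add: M_def)
    qed
    then have "2 * s - 1 \<in> {0..1} - N'" using s s' by auto
    from d'[OF this] have "(g' has_vector_derivative hvel m (fst (g' (2 * s-1))) (w' (2 * s-1))) (at (2 * s-1))" .
    then have "((g' \<circ> (\<lambda>s. 2 * s-1)) has_vector_derivative (2 *\<^sub>R hvel m (fst (g' (2 * s-1))) (w' (2 * s-1)))) (at s)"
      by (intro vector_diff_chain_at) (auto intro!: derivative_eq_intros)
    then have "(k has_vector_derivative (2 *\<^sub>R hvel m (fst (g' (2 * s - 1))) (w' (2 * s - 1)))) (at s)"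
      by (rule has_vector_derivative_transform_within_open[where S="{1/2<..}"]) (use s' in \<open>auto simp: k_def g\<close>)
    then show ?thesis using s' by (simp add: hvel_def u_def hslope_scaleR k_def g)
  qed
  have "((\<lambda>s. 2 * cmod (w (2 * s))) has_integral L) {0..1/2}"
    using has_integral_mult_right[OF has_integral_affinity'[of "\<lambda>s. cmod (w s)" L 0 1 2 0], of 2] L(1) by simp
  then have 1: "((\<lambda>s. cmod (u s)) has_integral L) {0..1/2}"
    by (rule has_integral_spike_finite[of "{1/2}", rotated 2]) (auto simp: u_def)
  have "((\<lambda>s. 2 * cmod (w' (2 * s-1))) has_integral L') {1/2..1}"
    using has_integral_mult_right[OF has_integral_affinity'[of "\<lambda>s. cmod (w' s)" L' 0 1 2 "-1"], of 2] L'(1) by simp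
  then have 2: "((\<lambda>s. cmod (u s)) has_integral L') {1/2..1}"
    by (rule has_integral_spike_finite[of "{}", rotated 2]) (auto simp: u_def)
  have "((\<lambda>s. cmod (u s)) has_integral (L + L')) {0..1}"
    by (rule has_integral_combine[OF _ _ 1 2]) auto
  from cc_dist_le_hcurve[OF m ack M dk this] have "cc_dist (real m) (k 0) (k 1) \<le> ennreal (L + L')" .
  also have "\<dots> < ennreal (a + b)" using L L' by (intro ennreal_lessI) auto
  finally show ?thesis by (simp add: k_def g g')
qed

text \<open>The infimum in \<open>cc_dist\<close> is not known to be attained, so the strict version
  is applied with a margin that then tends to 0.\<close>

lemma cc_dist_le_trans:
  assumes m: "m \<ge> 1" and "cc_dist (real m) p q \<le> ennreal a" "cc_dist (real m) q r \<le> ennreal b" "0 \<le> a" "0 \<le> b"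
  shows "cc_dist (real m) p r \<le> ennreal (a + b)"
proof (rule ennreal_le_epsilon)
  fix e :: real assume e: "0 < e"
  have "cc_dist (real m) p r < ennreal ((a + e/2) + (b + e/2))"
  proof (rule cc_dist_less_trans[OF m])
    show "cc_dist (real m) p q < ennreal (a + e/2)" using assms e
      by (intro order_le_less_trans[OF assms(2)] ennreal_lessI) auto
    show "cc_dist (real m) q r < ennreal (b + e/2)" using assms e
      by (intro order_le_less_trans[OF assms(3)] ennreal_lessI) auto
  qed
  also have "(a + e/2) + (b + e/2) = (a + b) + e" by simp
  finally show "cc_dist (real m) p r \<le> ennreal (a + b) + ennreal e" using assms e by simp
qed

section \<open>Explicit horizontal paths: segments, rays and circular arcs\<close>

text \<open>A speed bound over unit time doubles as a length bound. The set K records where the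
  planar projection runs: \<open>cc_dist\<close> forgets it, but estimates of a graph function along
  the path rely on it.\<close>

definition hpath :: "nat \<Rightarrow> complex set \<Rightarrow> real \<Rightarrow> pt \<Rightarrow> pt \<Rightarrow> bool" where
  "hpath m K L p q \<longleftrightarrow> (\<exists>g w. g 0 = p \<and> g 1 = q \<and>
     (\<forall>s\<in>{0..1}. (g has_vector_derivative hvel m (fst (g s)) (w s)) (at s within {0..1}) \<and>
        cmod (w s) \<le> L \<and> fst (g s) \<in> K))"

lemma hpath_cc_dist:
  assumes m: "m \<ge> 1" and "hpath m K L p q"
  shows "cc_dist (real m) p q \<le> ennreal L"
proof -
  from assms(2) obtain g w where g: "g 0 = p" "g 1 = q" and
    d: "\<And>s. s \<in> {0..1} \<Longrightarrow> (g has_vector_derivative hvel m (fst (g s)) (w s)) (at s within {0..1})"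
    and w: "\<And>s. s \<in> {0..1} \<Longrightarrow> cmod (w s) \<le> L" unfolding hpath_def by metis
  have L: "0 \<le> L" by (rule order_trans[OF norm_ge_zero w[of 0]]) simp
  have "continuous_on {0..1} g"
    by (meson d differentiableI_vector differentiable_imp_continuous_on differentiable_on_def)
  then have "continuous_on {0..1} (\<lambda>s. twist m (fst (g s)))"
    by (intro continuous_intros continuous_on_compose2[OF continuous_twist[of UNIV]]) auto
  then obtain T where T: "\<And>s. s \<in> {0..1} \<Longrightarrow> cmod (twist m (fst (g s))) \<le> T"
    using continuous_on_compact_bound[OF compact_Icc] by metis
  have bd: "norm (hvel m (fst (g s)) (w s)) \<le> L + T * L" if s: "s \<in> {0..1}" for s
  proof -
    have "norm (hvel m (fst (g s)) (w s)) \<le> cmod (w s) + \<bar>hslope m (fst (g s)) (w s)\<bar>"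
      unfolding hvel_def norm_Pair by (rule order_trans[OF sqrt_sum_squares_le_sum_abs]) simp
    also have "\<bar>hslope m (fst (g s)) (w s)\<bar> \<le> cmod (twist m (fst (g s))) * cmod (w s)"
      using abs_Im_le_cmod[of "twist m (fst (g s)) * cnj (w s)"] by (simp only: hslope_def norm_mult complex_mod_cnj)
    also have "\<dots> \<le> T * L" using T[OF s] w[OF s] L by (intro mult_mono) (auto intro: order_trans[OF norm_ge_zero])
    finally show ?thesis using w[OF s] by simp
  qed
  have ac: "abs_cont_01 g"
  proof (rule abs_cont_01_lipschitz[of _ "L + T * L"])
    fix x y :: real assume xy: "0 \<le> x" "x \<le> y" "y \<le> 1"
    have "norm (g y - g x) \<le> (L + T * L) * norm (y - x)"
    proof (rule differentiable_bound[of "{0..1}" g "\<lambda>s h. h *\<^sub>R hvel m (fst (g s)) (w s)"])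
      fix s :: real assume s: "s \<in> {0..1}"
      show "(g has_derivative (\<lambda>h. h *\<^sub>R hvel m (fst (g s)) (w s))) (at s within {0..1})"
        using d[OF s] by (simp add: has_vector_derivative_def)
      show "onorm (\<lambda>h. h *\<^sub>R hvel m (fst (g s)) (w s)) \<le> L + T * L"
        using bd[OF s] order_trans[OF norm_ge_zero bd[OF s]]
        by (intro onorm_bound) (auto simp: mult.commute[of "L + T * L"] simp del: add_nonneg_eq_0_iff intro!: mult_left_mono)
    qed (use xy in auto)
    then show "norm (g y - g x) \<le> (L + T * L) * (y - x)" using xy by simp
  qed
  have N: "negligible {0,1::real}" by simp
  have d2: "(g has_vector_derivative hvel m (fst (g s)) (w s)) (at s)" if "s \<in> {0..1} - {0,1}" for s
    using d[of s] that at_within_interior[of s "{0..1}"] by auto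
  have "AE s in lebesgue. s \<notin> {0,1::real}" using N by (simp only: negligible_iff_null_sets AE_not_in)
  then have "AE s in lebesgue. s \<in> {0..1} \<longrightarrow> (g has_vector_derivative (Re (w s) *\<^sub>R Xf m (g s) + Im (w s) *\<^sub>R Yf m (g s))) (at s)"
    by (rule eventually_mono) (use d2 in \<open>auto simp: hfield_eq[OF m] hvel_def\<close>)
  with ac have hor: "horizontal (real m) g (\<lambda>s. Re (w s)) (\<lambda>s. Im (w s))" by (simp add: horizontal_def)
  \<comment> \<open>Bounding the integrand by a constant works for any w, since monotonicity of
    \<open>nn_integral\<close> holds for arbitrary functions.\<close>
  have "hlength (\<lambda>s. Re (w s)) (\<lambda>s. Im (w s)) \<le> (\<integral>\<^sup>+ s. ennreal L * indicator {0..1::real} s \<partial>lebesgue)"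
    unfolding hlength_def by (rule nn_integral_mono) (use w in \<open>auto simp: cmod_def indicator_def intro!: ennreal_leI\<close>)
  also have "\<dots> = ennreal L" by (subst nn_integral_cmult_indicator) auto
  finally have "hlength (\<lambda>s. Re (w s)) (\<lambda>s. Im (w s)) \<le> ennreal L" .
  moreover have "cc_dist (real m) p q \<le> hlength (\<lambda>s. Re (w s)) (\<lambda>s. Im (w s))"
    using hor g unfolding cc_dist_def by (intro Inf_lower) auto
  ultimately show ?thesis by (rule order_trans[rotated])
qed

lemma exists_primitive:
  fixes f :: "real \<Rightarrow> real"
  assumes "continuous_on UNIV f"
  shows "\<exists>F. F 0 = 0 \<and> (\<forall>x. (F has_real_derivative f x) (at x))"
proof -
  define F where "F u = (LBINT y=ereal 0..ereal u. f y)" for u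
  have "(F has_real_derivative f x) (at x)" for x
  proof -
    define a b where "a = min 0 x - 1" and "b = max 0 x + 1"
    have "((\<lambda>u. LBINT y=ereal 0..ereal u. f y) has_vector_derivative f x) (at x within {a..b})"
      by (rule interval_integral_FTC2[OF _ _ continuous_on_subset[OF assms]]) (simp_all add: a_def b_def)
    moreover have "at x within {a..b} = at x"
      by (rule at_within_interior) (auto simp: a_def b_def min_def max_def)
    ultimately show ?thesis by (simp add: has_real_derivative_iff_has_vector_derivative F_def[abs_def])
  qed
  moreover have "F 0 = 0" by (simp add: F_def)
  ultimately show ?thesis by (intro exI[of _ F]) simp
qed

text \<open>Height gained by the horizontal lift of the line s \<mapsto> z + s v. A primitive on the
  whole real line treats both signs of s alike.\<close>

definition rise :: "nat \<Rightarrow> complex \<Rightarrow> complex \<Rightarrow> real \<Rightarrow> real" where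
  "rise m v z = (SOME F. F 0 = 0 \<and> (\<forall>s. (F has_real_derivative hslope m (z + s *\<^sub>R v) v) (at s)))"

lemma rise_0 [simp]: "rise m v z 0 = 0"
  and rise_deriv: "(rise m v z has_real_derivative hslope m (z + s *\<^sub>R v) v) (at s)"
proof -
  have "continuous_on UNIV (\<lambda>s::real. hslope m (z + s *\<^sub>R v) v)"
    unfolding hslope_def by (intro continuous_intros continuous_on_compose2[OF continuous_twist[of UNIV]]) auto
  from someI_ex[OF exists_primitive[OF this], folded rise_def]
  show "rise m v z 0 = 0" "(rise m v z has_real_derivative hslope m (z + s *\<^sub>R v) v) (at s)" by auto
qed

lemma hpath_segment: "hpath m UNIV (\<bar>s\<bar> * cmod v) (z, t) (z + s *\<^sub>R v, t + rise m v z s)"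
  unfolding hpath_def
proof (intro exI conjI ballI)
  let ?g = "\<lambda>u. (z + (u * s) *\<^sub>R v, t + rise m v z (u * s))"
  let ?w = "\<lambda>u::real. s *\<^sub>R v"
  show "?g 0 = (z, t)" "?g 1 = (z + s *\<^sub>R v, t + rise m v z s)" by auto
  fix u :: real assume "u \<in> {0..1}"
  have "((\<lambda>u. rise m v z (u * s)) has_real_derivative (hslope m (z + (u * s) *\<^sub>R v) v * s)) (at u)"
    by (rule DERIV_chain2[OF rise_deriv]) (auto intro!: derivative_eq_intros)
  then have 2: "((\<lambda>u. t + rise m v z (u * s)) has_vector_derivative (s * hslope m (z + (u * s) *\<^sub>R v) v)) (at u)"
    unfolding has_real_derivative_iff_has_vector_derivative
    by (auto intro!: derivative_eq_intros simp: mult.commute)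
  have 1: "((\<lambda>u. z + (u * s) *\<^sub>R v) has_vector_derivative s *\<^sub>R v) (at u)"
    by (auto intro!: derivative_eq_intros)
  show "(?g has_vector_derivative hvel m (fst (?g u)) (?w u)) (at u within {0..1})"
    unfolding hvel_def hslope_scaleR fst_conv
    by (rule has_vector_derivative_at_within[OF has_vector_derivative_Pair[OF 1 2]])
qed auto

lemma hslope_polar: "hslope m (of_real a * cis \<theta>) (of_real c * cis \<theta>) = 0"
proof -
  have "(of_real a * cis \<theta>) * cnj (of_real c * cis \<theta>) = of_real (a * c) * (cis \<theta> * cnj (cis \<theta>))" by (simp add: ac_simps)
  also have "\<dots> = of_real (a * c)" by (simp add: cis_cnj cis_mult)
  finally show ?thesis by (simp add: hslope_def twist_def)
qed

lemma hslope_arc: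
  assumes "0 \<le> a"
  shows "hslope m (of_real a * cis \<theta>) (of_real c * \<i> * cis \<theta>) = - c * a ^ (2*m+1)"
proof -
  have "(of_real a * cis \<theta>) * cnj (of_real c * \<i> * cis \<theta>) = - of_real (a * c) * \<i> * (cis \<theta> * cnj (cis \<theta>))" by (simp add: ac_simps)
  also have "\<dots> = - of_real (a * c) * \<i>" by (simp add: cis_cnj cis_mult)
  finally have "(of_real a * cis \<theta>) * cnj (of_real c * \<i> * cis \<theta>) = - of_real (a * c) * \<i>" .
  moreover have "cmod (of_real a * cis \<theta>) = a" using assms by (simp add: norm_mult)
  ultimately have "twist m (of_real a * cis \<theta>) * cnj (of_real c * \<i> * cis \<theta>) = a ^ (2*m) *\<^sub>R (- of_real (a * c) * \<i>)"
    unfolding twist_def mult_scaleR_left by simp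
  then show ?thesis unfolding hslope_def by simp
qed

text \<open>The height stays constant because y dx - x dy annihilates radial vectors. The ends may
  come in either order, as the loop below runs along rays both outwards and inwards.\<close>

lemma hpath_radial:
  assumes "\<And>x. min a b \<le> x \<Longrightarrow> x \<le> max a b \<Longrightarrow> of_real x * cis \<theta> \<in> K"
  shows "hpath m K \<bar>b - a\<bar> (of_real a * cis \<theta>, t) (of_real b * cis \<theta>, t)"
  unfolding hpath_def
proof (intro exI conjI ballI)
  let ?g = "\<lambda>u::real. (of_real (a + u * (b - a)) * cis \<theta>, t)"
  let ?w = "\<lambda>u::real. of_real (b - a) * cis \<theta>"
  show "?g 0 = (of_real a * cis \<theta>, t)" "?g 1 = (of_real b * cis \<theta>, t)" by auto
  fix u :: real assume u: "u \<in> {0..1}"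
  show "(?g has_vector_derivative hvel m (fst (?g u)) (?w u)) (at u within {0..1})"
    unfolding hvel_def fst_conv hslope_polar
    by (intro has_vector_derivative_Pair) (auto intro!: derivative_eq_intros simp: algebra_simps)
  show "cmod (?w u) \<le> \<bar>b - a\<bar>" by (simp add: norm_mult del: of_real_diff)
  have "min a b \<le> a + u * (b - a)" "a + u * (b - a) \<le> max a b"
    using u convex_bound_le[of a "max a b" b "1-u" u] convex_bound_le[of "-a" "- min a b" "-b" "1-u" u]
    by (auto simp: algebra_simps)
  then show "fst (?g u) \<in> K" unfolding fst_conv by (rule assms)
qed

lemma hpath_arc:
  assumes a: "0 \<le> a" and K: "\<And>x. \<bar>x - \<theta>\<bar> \<le> \<bar>\<delta>\<bar> \<Longrightarrow> of_real a * cis x \<in> K"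
  shows "hpath m K (a * \<bar>\<delta>\<bar>) (of_real a * cis \<theta>, t) (of_real a * cis (\<theta> + \<delta>), t - \<delta> * a ^ (2*m+2))"
  unfolding hpath_def
proof (intro exI conjI ballI)
  let ?g = "\<lambda>u::real. (of_real a * cis (\<theta> + u * \<delta>), t - u * \<delta> * a ^ (2*m+2))"
  let ?w = "\<lambda>u::real. of_real (a * \<delta>) * \<i> * cis (\<theta> + u * \<delta>)"
  show "?g 0 = (of_real a * cis \<theta>, t)" "?g 1 = (of_real a * cis (\<theta> + \<delta>), t - \<delta> * a ^ (2*m+2))" by auto
  fix u :: real assume u: "u \<in> {0..1}"
  have "((\<lambda>u. cis (\<theta> + u * \<delta>)) has_vector_derivative \<delta> *\<^sub>R (\<i> * cis (\<theta> + u * \<delta>))) (at u)"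
    unfolding has_vector_derivative_def by (auto intro!: derivative_eq_intros)
  from has_vector_derivative_mult_right[OF this, of "of_real a"]
  have 1: "((\<lambda>u. of_real a * cis (\<theta> + u * \<delta>)) has_vector_derivative ?w u) (at u)"
    by (simp add: scaleR_conv_of_real mult.assoc)
  have "((\<lambda>u. t - u * \<delta> * a ^ (2*m+2)) has_real_derivative - (1 * \<delta> * a ^ (2*m+2))) (at u)"
    by (auto intro!: derivative_eq_intros)
  then have 2: "((\<lambda>u. t - u * \<delta> * a ^ (2*m+2)) has_vector_derivative - (a * \<delta>) * a ^ (2*m+1)) (at u)"
    unfolding has_real_derivative_iff_has_vector_derivative by (simp add: mult.assoc mult.left_commute)
  show "(?g has_vector_derivative hvel m (fst (?g u)) (?w u)) (at u within {0..1})"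
    unfolding hvel_def fst_conv hslope_arc[OF a]
    by (rule has_vector_derivative_at_within[OF has_vector_derivative_Pair[OF 1 2]])
  show "cmod (?w u) \<le> a * \<bar>\<delta>\<bar>" using a by (simp add: norm_mult abs_mult)
  have "\<bar>u * \<delta>\<bar> \<le> 1 * \<bar>\<delta>\<bar>" unfolding abs_mult using u by (intro mult_right_mono) auto
  then show "fst (?g u) \<in> K" unfolding fst_conv by (intro K) simp
qed

section \<open>Comparison of metric balls with twisted boxes\<close>

lemma hpath_mono:
  assumes "hpath m K L p q" "L \<le> L'"
  shows "hpath m K L' p q"
proof -
  from assms(1) obtain g w where "g 0 = p" "g 1 = q" and
    *: "\<forall>s\<in>{0..1}. (g has_vector_derivative hvel m (fst (g s)) (w s)) (at s within {0..1}) \<and>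
        cmod (w s) \<le> L \<and> fst (g s) \<in> K" unfolding hpath_def by blast
  moreover from * assms(2) have "\<forall>s\<in>{0..1}. (g has_vector_derivative hvel m (fst (g s)) (w s)) (at s within {0..1}) \<and>
        cmod (w s) \<le> L' \<and> fst (g s) \<in> K" by force
  ultimately show ?thesis unfolding hpath_def by blast
qed

lemma cis_lipschitz: "cmod (cis x - cis y) \<le> \<bar>x - y\<bar>"
proof -
  have "cmod (cis x - cis y) \<le> 1 * norm (x - y)"
  proof (rule differentiable_bound[of UNIV cis "\<lambda>x h. h *\<^sub>R (\<i> * cis x)"])
    show "(cis has_derivative (\<lambda>h. h *\<^sub>R (\<i> * cis x))) (at x within UNIV)" for x
      by (auto intro!: derivative_eq_intros)
    show "onorm (\<lambda>h. h *\<^sub>R (\<i> * cis x)) \<le> 1" for x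
      by (rule onorm_bound) (auto simp: norm_mult)
  qed auto
  then show ?thesis by simp
qed

text \<open>Moving out along a ray, turning by \<open>\<delta>\<close>, moving back and turning by \<open>- \<delta>\<close> is a closed planar
  loop; since the form \<open>|z|^(2m) (y dx - x dy)\<close> is \<open>- \<rho>^(2m+2) d\<theta>\<close> in polar coordinates, the lift
  of this loop is explicit.\<close>

lemma polar_loop:
  assumes m: "m \<ge> 1" and h: "0 < h" and \<tau>: "\<bar>\<tau>\<bar> \<le> h\<^sup>2 * (cmod z + h) ^ (2*m)"
  obtains \<delta> p1 p2 p3 where "(cmod z + h) * \<bar>\<delta>\<bar> \<le> h"
    "hpath m (cball z (2*h)) h (z, t) p1" "hpath m (cball z (2*h)) h p1 p2"
    "hpath m (cball z (2*h)) h p2 p3" "hpath m (cball z (2*h)) h p3 (z, t + \<tau>)"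
proof -
  define a \<theta> where "a = cmod z" and "\<theta> = Arg z"
  have z: "z = of_real a * cis \<theta>" using rcis_cmod_Arg[of z] by (simp add: a_def \<theta>_def rcis_def)
  have a: "0 \<le> a" by (simp add: a_def)
  define b where "b = a + h"
  have b: "0 < b" "a < b" using h a by (auto simp: b_def)
  \<comment> \<open>Height per radian lost on the outer arc, less what the inner arc gives back. It
    is at least h b^(2m+1), so the angle \<delta> that produces the climb \<tau> keeps the outer arc
    no longer than h.\<close>
  define D where "D = b ^ (2*m+2) - a ^ (2*m+2)"
  have "a ^ (2*m+2) = a * a ^ (2*m+1)" by simp
  also have "\<dots> \<le> a * b ^ (2*m+1)" using a b by (intro mult_left_mono power_mono) auto
  finally have D: "h * b ^ (2*m+1) \<le> D" by (simp add: D_def b_def algebra_simps)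
  have hb: "0 < h * b ^ (2*m+1)" using h b by simp
  define \<delta> where "\<delta> = - \<tau> / D"
  have \<delta>D: "\<delta> * D = - \<tau>" using D hb by (simp add: \<delta>_def)
  have "\<bar>\<delta>\<bar> * (h * b ^ (2*m+1)) \<le> \<bar>\<delta>\<bar> * D" using D by (intro mult_left_mono) auto
  also have "\<dots> = \<bar>\<tau>\<bar>" using \<delta>D D hb by (metis abs_minus_cancel abs_mult abs_of_pos order_less_le_trans)
  also have "\<dots> \<le> h * (h * b ^ (2*m))" using \<tau> by (simp add: a_def b_def power2_eq_square)
  finally have "(b * \<bar>\<delta>\<bar>) * (h * b ^ (2*m)) \<le> h * (h * b ^ (2*m))" by (simp add: ac_simps)
  then have \<delta>: "b * \<bar>\<delta>\<bar> \<le> h" using h b by (subst (asm) mult_le_cancel_right) auto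
  have near: "of_real x * cis \<phi> \<in> cball z (2*h)" if "a \<le> x" "x \<le> b" "\<bar>\<phi> - \<theta>\<bar> \<le> \<bar>\<delta>\<bar>" for x \<phi>
  proof -
    have "cmod (cis \<phi> - cis \<theta>) \<le> \<bar>\<phi> - \<theta>\<bar>" by (rule cis_lipschitz)
    then have "b * cmod (cis \<phi> - cis \<theta>) \<le> b * \<bar>\<delta>\<bar>" using that b by (intro mult_left_mono) auto
    then have 1: "x * cmod (cis \<phi> - cis \<theta>) \<le> h" using \<delta> that a
      by (meson mult_right_mono norm_ge_zero order_trans)
    have "of_real x * cis \<phi> - z = of_real x * (cis \<phi> - cis \<theta>) + of_real (x - a) * cis \<theta>"
      by (simp add: z algebra_simps)
    also have "cmod \<dots> \<le> x * cmod (cis \<phi> - cis \<theta>) + (x - a)"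
      using that a by (intro order_trans[OF norm_triangle_ineq]) (auto simp: norm_mult simp del: of_real_diff)
    finally show ?thesis using 1 that by (simp add: b_def dist_norm norm_minus_commute)
  qed
  define p1 where "p1 = (of_real b * cis \<theta>, t)"
  define p2 where "p2 = (of_real b * cis (\<theta> + \<delta>), t - \<delta> * b ^ (2*m+2))"
  define p3 where "p3 = (of_real a * cis (\<theta> + \<delta>), t - \<delta> * b ^ (2*m+2))"
  have 1: "hpath m (cball z (2*h)) h (z, t) p1"
    unfolding z p1_def by (rule hpath_mono[OF hpath_radial]) (use near[of _ \<theta>] b in \<open>auto simp: z b_def\<close>)
  have 2: "hpath m (cball z (2*h)) h p1 p2"
    unfolding p1_def p2_def by (rule hpath_mono[OF hpath_arc]) (use near \<delta> b in \<open>auto simp: z\<close>)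
  have 3: "hpath m (cball z (2*h)) h p2 p3"
    unfolding p2_def p3_def by (rule hpath_mono[OF hpath_radial]) (use near[of _ "\<theta> + \<delta>"] b in \<open>auto simp: b_def\<close>)
  have "hpath m (cball z (2*h)) h p3 (of_real a * cis (\<theta> + \<delta> + - \<delta>), t - \<delta> * b ^ (2*m+2) - (- \<delta>) * a ^ (2*m+2))"
    unfolding p3_def
  proof (rule hpath_mono[OF hpath_arc])
    \<comment> \<open>\<open>hpath_arc\<close> asks for a symmetric range of angles about its start
      \<theta> + \<delta>, so angles up to 2|\<delta>| from \<theta> occur; the ball of radius 2h
      has room for them.\<close>
    show "complex_of_real a * cis x \<in> cball z (2*h)" if "\<bar>x - (\<theta> + \<delta>)\<bar> \<le> \<bar>- \<delta>\<bar>" for x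
    proof (cases "\<bar>x - \<theta>\<bar> \<le> \<bar>\<delta>\<bar>")
      case True
      then show ?thesis using near[of a x] b by auto
    next
      case False
      have e: "\<bar>x - \<theta>\<bar> \<le> 2 * \<bar>\<delta>\<bar>" using that by linarith
      have "cmod (cis x - cis \<theta>) \<le> \<bar>x - \<theta>\<bar>" by (rule cis_lipschitz)
      then have "a * cmod (cis x - cis \<theta>) \<le> b * (2 * \<bar>\<delta>\<bar>)" using e a b by (intro mult_mono) auto
      moreover have "of_real a * cis x - z = of_real a * (cis x - cis \<theta>)" by (simp add: z algebra_simps)
      ultimately have "cmod (of_real a * cis x - z) \<le> 2 * h" using \<delta> a by (simp add: norm_mult)
      then show ?thesis by (simp add: dist_norm norm_minus_commute)
    qed
    show "a * \<bar>- \<delta>\<bar> \<le> h" using \<delta> b a mult_right_mono[of a b "\<bar>\<delta>\<bar>"] by simp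
  qed (use a in auto)
  moreover have "t - \<delta> * b ^ (2*m+2) - (- \<delta>) * a ^ (2*m+2) = t + \<tau>"
    using \<delta>D unfolding D_def by (simp only: right_diff_distrib)
  moreover have "(of_real a * cis (\<theta> + \<delta> + - \<delta>)) = z" by (simp add: z)
  ultimately have 4: "hpath m (cball z (2*h)) h p3 (z, t + \<tau>)" by (simp only:)
  show ?thesis using that[OF _ 1 2 3 4] \<delta> by (simp add: a_def b_def)
qed

lemma cc_dist_vertical:
  assumes m: "m \<ge> 1" and h: "0 < h" and \<tau>: "\<bar>\<tau>\<bar> \<le> h\<^sup>2 * (cmod z + h) ^ (2*m)"
  shows "cc_dist (real m) (z, t) (z, t + \<tau>) \<le> ennreal (4 * h)"
proof -
  obtain \<delta> p1 p2 p3 where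
    p: "hpath m (cball z (2*h)) h (z, t) p1" "hpath m (cball z (2*h)) h p1 p2"
    "hpath m (cball z (2*h)) h p2 p3" "hpath m (cball z (2*h)) h p3 (z, t + \<tau>)"
    using polar_loop[OF m h \<tau>] by metis
  note d = p[THEN hpath_cc_dist[OF m]]
  have 2: "cc_dist (real m) (z, t) p2 \<le> ennreal (h + h)" using cc_dist_le_trans[OF m d(1,2)] h by simp
  have 3: "cc_dist (real m) (z, t) p3 \<le> ennreal (h + h + h)" using cc_dist_le_trans[OF m 2 d(3)] h by simp
  have "cc_dist (real m) (z, t) (z, t + \<tau>) \<le> ennreal (h + h + h + h)" using cc_dist_le_trans[OF m 3 d(4)] h by simp
  then show ?thesis by (simp add: algebra_simps)
qed

text \<open>The linear map \<open>hslope m (fst p)\<close> is the first order vertical drift of horizontal curves at \<open>p\<close>.\<close>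

definition hbox :: "nat \<Rightarrow> pt \<Rightarrow> real \<Rightarrow> pt set" where
  "hbox m p r = {q. cmod (fst q - fst p) < r \<and>
     \<bar>snd q - snd p - hslope m (fst p) (fst q - fst p)\<bar> < r\<^sup>2 * (cmod (fst p) + r) ^ (2*m)}"

lemma open_hbox: "open (hbox m p r)"
  unfolding hbox_def hslope_def by (intro open_Collect_conj open_Collect_less continuous_intros)

lemma centre_in_hbox: "0 < r \<Longrightarrow> p \<in> hbox m p r"
  by (auto simp: hbox_def intro!: mult_pos_pos zero_less_power add_nonneg_pos)

text \<open>The point z0 where the slope is frozen may differ from the start z of the line: in flow
  coordinates the lines start beside the centre of the box. All points involved lie within 2r of z0,
  whence the factor 2r.\<close>

lemma rise_approx:
  assumes m: "m \<ge> 1" and v: "cmod v = 1" and z: "cmod (z - z0) \<le> r" and s: "\<bar>s\<bar> \<le> r"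
  shows "\<bar>rise m v z s - s * hslope m z0 v\<bar> \<le> (2 * real m + 1) * (cmod z0 + 2 * r) ^ (2*m) * (2 * r) * \<bar>s\<bar>"
proof -
  let ?B = "(2 * real m + 1) * (cmod z0 + 2 * r) ^ (2*m) * (2 * r)"
  have r: "0 \<le> r" using s by linarith
  have "norm ((\<lambda>s. rise m v z s - s * hslope m z0 v) s - (\<lambda>s. rise m v z s - s * hslope m z0 v) 0) \<le> ?B * norm (s - 0)"
  proof (rule field_differentiable_bound[of "{-r..r}"])
    fix u assume u: "u \<in> {-r..r}"
    show "((\<lambda>s. rise m v z s - s * hslope m z0 v) has_field_derivative (hslope m (z + u *\<^sub>R v) v - hslope m z0 v)) (at u within {-r..r})"
      by (auto intro!: derivative_eq_intros has_field_derivative_at_within[OF rise_deriv])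
    have n: "cmod (z + u *\<^sub>R v - z0) \<le> 2 * r"
      using norm_triangle_ineq[of "z - z0" "u *\<^sub>R v"] z u v by (auto simp: algebra_simps abs_le_iff)
    have n2: "cmod (z + u *\<^sub>R v) \<le> cmod z0 + 2 * r" 
      using norm_triangle_sub[of "z + u *\<^sub>R v" z0] n by simp
    have "\<bar>hslope m (z + u *\<^sub>R v) v - hslope m z0 v\<bar> \<le> cmod (twist m (z + u *\<^sub>R v) - twist m z0)"
      using abs_diff_hslope_le[of m "z + u *\<^sub>R v" v z0] v by simp
    also have "\<dots> \<le> (2 * real m + 1) * (cmod z0 + 2 * r) ^ (2*m) * cmod (z + u *\<^sub>R v - z0)"
      using r n2 by (intro twist_lipschitz[OF m]) auto
    also have "\<dots> \<le> ?B" using n r by (intro mult_left_mono) auto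
    finally show "norm (hslope m (z + u *\<^sub>R v) v - hslope m z0 v) \<le> ?B" by simp
  qed (use s r in auto)
  then show ?thesis by simp
qed

text \<open>The planar position is reached along a lifted segment of length at most r, and the
  remaining height error, of order r^2 (|z_p| + 2r)^(2m), is removed by a vertical loop.\<close>

lemma cc_dist_hbox:
  assumes m: "m \<ge> 1" and r: "0 < r" and q: "q \<in> hbox m p r"
  shows "cc_dist (real m) p q \<le> ennreal ((16 * real m + 17) * r)"
proof -
  obtain z t where p: "p = (z, t)" by force
  obtain z' t' where q': "q = (z', t')" by force
  from q have n: "cmod (z' - z) < r" and tt: "\<bar>t' - t - hslope m z (z' - z)\<bar> < r\<^sup>2 * (cmod z + r) ^ (2*m)"
    by (auto simp: hbox_def p q')
  define s where "s = cmod (z' - z)"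
  define v where "v = (if s = 0 then 1 else (z' - z) /\<^sub>R s)"
  have v: "cmod v = 1" "z' = z + s *\<^sub>R v" by (auto simp: v_def s_def)
  have s: "0 \<le> s" "s < r" using n by (auto simp: s_def)
  define t1 where "t1 = t + rise m v z s"
  define T where "T = (cmod z + 2 * r) ^ (2*m)"
  have T: "(cmod z + r) ^ (2*m) \<le> T" unfolding T_def using r by (intro power_mono) auto
  have T0: "0 \<le> T" by (simp add: T_def r less_imp_le)
  have 1: "cc_dist (real m) p (z', t1) \<le> ennreal r"
    using hpath_cc_dist[OF m hpath_segment[of m s v z t]] s v p
    by (auto simp: t1_def intro: order_trans ennreal_leI)
  have "\<bar>rise m v z s - s * hslope m z v\<bar> \<le> (2 * real m + 1) * T * (2 * r) * \<bar>s\<bar>"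
    unfolding T_def by (rule rise_approx[OF m v(1)]) (use s in auto)
  also have "\<dots> \<le> (2 * real m + 1) * T * (2 * r) * r" using s r T0 by (intro mult_left_mono) auto
  finally have e1: "\<bar>t1 - t - hslope m z (z' - z)\<bar> \<le> (4 * real m + 2) * (r\<^sup>2 * T)"
    by (simp add: t1_def v(2) hslope_scaleR power2_eq_square algebra_simps)
  have e2: "\<bar>t' - t - hslope m z (z' - z)\<bar> \<le> r\<^sup>2 * T" using tt T mult_left_mono[OF T, of "r\<^sup>2"] by simp
  have "\<bar>t' - t1\<bar> \<le> r\<^sup>2 * T + (4 * real m + 2) * (r\<^sup>2 * T)"
    using e1 e2 by linarith
  also have "\<dots> = (4 * real m + 3) * (r\<^sup>2 * T)" by (simp add: algebra_simps)
  finally have e3: "\<bar>t' - t1\<bar> \<le> (4 * real m + 3) * (r\<^sup>2 * T)" .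
  \<comment> \<open>The loop needs h^2 >= (4m + 3) r^2 for the height error and |z'| + h >= |z| + 2r
    for the weight. This h gives both, and r + 4h = (16m + 17) r.\<close>
  define h where "h = (4 * real m + 4) * r"
  have h: "0 < h" using r by (simp add: h_def)
  have "cmod z + 2 * r \<le> cmod z' + h"
  proof -
    have "cmod z \<le> cmod z' + r" using norm_triangle_sub[of z z'] n by (simp add: norm_minus_commute)
    moreover have "3 * r \<le> h" using r m by (simp add: h_def)
    ultimately show ?thesis by simp
  qed
  then have T2: "T \<le> (cmod z' + h) ^ (2*m)" unfolding T_def using r by (intro power_mono) auto
  have "(4 * real m + 3) * r\<^sup>2 \<le> h\<^sup>2"
  proof -
    have "(4 * real m + 3) * r\<^sup>2 \<le> (4 * real m + 4)\<^sup>2 * r\<^sup>2"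
      by (intro mult_right_mono) (auto simp: power2_eq_square algebra_simps)
    then show ?thesis by (simp add: h_def power_mult_distrib)
  qed
  then have "(4 * real m + 3) * r\<^sup>2 * T \<le> h\<^sup>2 * (cmod z' + h) ^ (2*m)"
    using T2 T0 by (intro mult_mono) auto
  then have "\<bar>t' - t1\<bar> \<le> h\<^sup>2 * (cmod z' + h) ^ (2*m)" using e3 by (simp add: mult.assoc)
  from cc_dist_vertical[OF m h this, of t1] have 2: "cc_dist (real m) (z', t1) q \<le> ennreal (4 * h)"
    by (simp add: q')
  have "cc_dist (real m) p q \<le> ennreal (r + 4 * h)" using cc_dist_le_trans[OF m 1 2] r h by simp
  also have "\<dots> \<le> ennreal ((16 * real m + 17) * r)"
    by (rule ennreal_leI) (use r in \<open>simp add: h_def algebra_simps\<close>)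
  finally show ?thesis .
qed

text \<open>Taking 18 instead of 17 turns the closed bound of \<open>cc_dist_hbox\<close> into the
  strict inequality of an open ball.\<close>

lemma hbox_subset_cc_ball:
  assumes m: "m \<ge> 1" and r: "0 < r"
  shows "hbox m p (r / (16 * real m + 18)) \<subseteq> cc_ball (real m) p r"
proof
  fix q assume q: "q \<in> hbox m p (r / (16 * real m + 18))"
  have "cc_dist (real m) p q \<le> ennreal ((16 * real m + 17) * (r / (16 * real m + 18)))"
    by (rule cc_dist_hbox[OF m _ q]) (use r in auto)
  also have "\<dots> < ennreal r" using r by (intro ennreal_lessI) (auto simp: field_simps)
  finally show "q \<in> cc_ball (real m) p r" by (simp add: cc_ball_def)
qed

text \<open>The constant 2m + 1 of the height estimate is absorbed strictly by the square of the
  factor 2m + 2.\<close>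

lemma cc_ball_subset_hbox:
  assumes m: "m \<ge> 1" and r: "0 < r"
  shows "cc_ball (real m) p r \<subseteq> hbox m p ((2 * real m + 2) * r)"
proof
  fix q assume "q \<in> cc_ball (real m) p r"
  then have d: "cc_dist (real m) p q < ennreal r" by (simp add: cc_ball_def)
  let ?R = "(2 * real m + 2) * r"
  have "0 < r * (2 * real m + 1)" using r by (intro mult_pos_pos) auto
  then have R: "r < ?R" by (simp add: algebra_simps)
  have "(2 * real m + 1) * r\<^sup>2 < ?R\<^sup>2"
  proof -
    have "(2 * real m + 1) * r\<^sup>2 < (2 * real m + 2)\<^sup>2 * r\<^sup>2"
      using r by (intro mult_strict_right_mono) (auto simp: power2_eq_square algebra_simps intro!: add_pos_nonneg)
    then show ?thesis by (simp add: power_mult_distrib)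
  qed
  then have "(2 * real m + 1) * r\<^sup>2 * (cmod (fst p) + r) ^ (2*m) < ?R\<^sup>2 * (cmod (fst p) + ?R) ^ (2*m)"
    using r R by (intro mult_less_le_imp_less power_mono) (auto intro!: zero_less_power add_nonneg_pos)
  with cc_dist_less_imp[OF m d] R show "q \<in> hbox m p ?R" by (auto simp: hbox_def)
qed

text \<open>Makes metric balls Borel. Every point of the ball has distance less than some a < r, and
  a small box around it, which is open, lies in the metric ball of radius r - a about it.\<close>

lemma open_cc_ball:
  assumes m: "m \<ge> 1"
  shows "open (cc_ball (real m) p r)"
proof (rule openI)
  fix q assume "q \<in> cc_ball (real m) p r"
  then have d: "cc_dist (real m) p q < ennreal r" by (simp add: cc_ball_def)
  then obtain c where c: "cc_dist (real m) p q = ennreal c" "0 \<le> c"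
    by (cases "cc_dist (real m) p q") auto
  define a where "a = (c + r) / 2"
  have "c < r" using d c by (simp add: ennreal_less_iff)
  then have a: "cc_dist (real m) p q < ennreal a" and ar: "a < r"
    using c by (auto simp: a_def ennreal_less_iff)
  have "open (hbox m q ((r - a) / (16 * real m + 18)))" by (rule open_hbox)
  moreover have "q \<in> hbox m q ((r - a) / (16 * real m + 18))" using ar by (intro centre_in_hbox) auto
  moreover have "hbox m q ((r - a) / (16 * real m + 18)) \<subseteq> cc_ball (real m) p r"
  proof
    fix y assume "y \<in> hbox m q ((r - a) / (16 * real m + 18))"
    then have "cc_dist (real m) q y < ennreal (r - a)"
      using hbox_subset_cc_ball[OF m, of "r - a" q] ar by (auto simp: cc_ball_def)
    from cc_dist_less_trans[OF m a this] show "y \<in> cc_ball (real m) p r" by (simp add: cc_ball_def)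
  qed
  ultimately show "\<exists>e>0. ball q e \<subseteq> cc_ball (real m) p r"
    by (meson open_contains_ball order_trans)
qed

text \<open>By Fubini: the linear drift only translates the vertical fibres, which are intervals of
  length 2 r^2 (|z_p| + r)^(2m) over a disc of radius r.\<close>

lemma emeasure_hbox:
  assumes r: "0 < r"
  shows "emeasure lborel (hbox m p r) = ennreal (2 * pi * (r ^ 4 * (cmod (fst p) + r) ^ (2*m)))"
proof -
  let ?T = "r\<^sup>2 * (cmod (fst p) + r) ^ (2*m)"
  have T: "0 \<le> ?T" using r by simp
  have B: "hbox m p r \<in> sets (lborel \<Otimes>\<^sub>M lborel)"
    using borel_open[OF open_hbox] by (simp only: lborel_prod sets_lborel)
  have "emeasure lborel (hbox m p r) = emeasure (lborel \<Otimes>\<^sub>M lborel) (hbox m p r)" by (simp add: lborel_prod)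
  also have "\<dots> = (\<integral>\<^sup>+ z. emeasure lborel (Pair z -` hbox m p r) \<partial>lborel)"
    by (rule lborel.emeasure_pair_measure_alt[OF B])
  also have "\<dots> = (\<integral>\<^sup>+ z. ennreal (2 * ?T) * indicator (ball (fst p) r) z \<partial>lborel)"
  proof (rule nn_integral_cong)
    fix z :: complex
    show "emeasure lborel (Pair z -` hbox m p r) = ennreal (2 * ?T) * indicator (ball (fst p) r) z"
    proof (cases "z \<in> ball (fst p) r")
      case True
      define c where "c = snd p + hslope m (fst p) (z - fst p)"
      have "Pair z -` hbox m p r = {c - ?T<..<c + ?T}"
        using True by (auto simp: hbox_def c_def dist_norm norm_minus_commute abs_less_iff)
      then show ?thesis using True T by (simp add: emeasure_lborel_Ioo)
    next
      case False
      then have "Pair z -` hbox m p r = {}" by (auto simp: hbox_def dist_norm norm_minus_commute)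
      then show ?thesis using False by simp
    qed
  qed
  also have "\<dots> = ennreal (2 * ?T) * emeasure lborel (ball (fst p) r)"
    by (rule nn_integral_cmult_indicator) simp
  also have "emeasure lborel (ball (fst p) r) = ennreal (pi * r\<^sup>2)"
    using r by (simp add: emeasure_ball unit_ball_vol_2)
  also have "ennreal (2 * ?T) * ennreal (pi * r\<^sup>2) = ennreal (2 * ?T * (pi * r\<^sup>2))"
    using T by (intro ennreal_mult[symmetric]) auto
  also have "2 * ?T * (pi * r\<^sup>2) = 2 * pi * (r ^ 4 * (cmod (fst p) + r) ^ (2*m))"
    by (simp add: power2_eq_square power4_eq_xxxx)
  finally show ?thesis .
qed

section \<open>Hausdorff measure\<close>

definition hcover :: "real \<Rightarrow> pt set \<Rightarrow> ennreal" where
  "hcover \<delta> A = (INF U \<in> {U :: nat \<Rightarrow> pt set. A \<subseteq> (\<Union>i. U i) \<and>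
       (\<forall>i. bounded (U i) \<and> diameter (U i) \<le> \<delta>)}. (\<Sum>i. ennreal (pi / 4 * (diameter (U i))\<^sup>2)))"

lemma hausdorff2_outer_hcover: "hausdorff2_outer A = (SUP \<delta>\<in>{0<..}. hcover \<delta> A)"
  by (simp add: hausdorff2_outer_def hcover_def)

lemma hcover_le:
  assumes "A \<subseteq> (\<Union>i. U i)" "\<And>i. bounded (U i)" "\<And>i. diameter (U i) \<le> \<delta>"
  shows "hcover \<delta> A \<le> (\<Sum>i. ennreal (pi / 4 * (diameter (U i))\<^sup>2))"
  unfolding hcover_def using assms by (intro INF_lower) auto

lemma hcover_lessE:
  assumes "hcover \<delta> A < c"
  obtains U where "A \<subseteq> (\<Union>i. U i)" "\<And>i. bounded (U i)" "\<And>i. diameter (U i) \<le> \<delta>"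
    "(\<Sum>i. ennreal (pi / 4 * (diameter (U i))\<^sup>2)) < c"
  using assms unfolding hcover_def INF_less_iff by blast

lemma hcover_mono: "A \<subseteq> B \<Longrightarrow> hcover \<delta> A \<le> hcover \<delta> B"
  unfolding hcover_def by (intro INF_superset_mono) auto

lemma hcover_antimono: "\<delta>' \<le> \<delta> \<Longrightarrow> hcover \<delta> A \<le> hcover \<delta>' A"
  unfolding hcover_def by (intro INF_superset_mono) (auto intro: order_trans)

lemma hcover_empty: "0 < \<delta> \<Longrightarrow> hcover \<delta> {} = 0"
  using hcover_le[of "{}" "\<lambda>_. {}" \<delta>] by simp

lemma hcover_countably_subadditive: "hcover \<delta> (\<Union>i. A i) \<le> (\<Sum>i. hcover \<delta> (A i))"
proof (rule ennreal_le_epsilon)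
  fix e :: real assume fin: "(\<Sum>i. hcover \<delta> (A i)) < top" and e: "0 < e"
  have "\<exists>U. A i \<subseteq> (\<Union>j. U j) \<and> (\<forall>j. bounded (U j) \<and> diameter (U j) \<le> \<delta>) \<and>
      (\<Sum>j. ennreal (pi / 4 * (diameter (U j))\<^sup>2)) < hcover \<delta> (A i) + ennreal (e * (1/2) ^ Suc i)" for i
  proof -
    have "hcover \<delta> (A i) \<noteq> top" using fin ennreal_suminf_lessD by (metis less_top)
    then have "hcover \<delta> (A i) < hcover \<delta> (A i) + ennreal (e * (1/2) ^ Suc i)"
      using e by (simp add: less_top)
    from hcover_lessE[OF this] show ?thesis by metis
  qed
  then obtain U where U: "\<And>i. A i \<subseteq> (\<Union>j. U i j)" "\<And>i j. bounded (U i j)" "\<And>i j. diameter (U i j) \<le> \<delta>"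
    "\<And>i. (\<Sum>j. ennreal (pi / 4 * (diameter (U i j))\<^sup>2)) < hcover \<delta> (A i) + ennreal (e * (1/2) ^ Suc i)" by metis
  define W where "W k = (case prod_decode k of (i, j) \<Rightarrow> U i j)" for k
  have cover: "(\<Union>i. A i) \<subseteq> (\<Union>k. W k)"
  proof
    fix x assume "x \<in> (\<Union>i. A i)"
    then obtain i j where "x \<in> U i j" using U(1) by blast
    then have "x \<in> W (prod_encode (i, j))" by (simp add: W_def)
    then show "x \<in> (\<Union>k. W k)" by blast
  qed
  have "hcover \<delta> (\<Union>i. A i) \<le> (\<Sum>k. ennreal (pi / 4 * (diameter (W k))\<^sup>2))"
    by (rule hcover_le[OF cover]) (auto simp: W_def U split: prod.splits)
  also have "\<dots> = (\<Sum>k. (\<lambda>(i,j). ennreal (pi / 4 * (diameter (U i j))\<^sup>2)) (prod_decode k))"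
    by (intro suminf_cong) (auto simp: W_def split: prod.splits)
  also have "\<dots> = (\<Sum>i. \<Sum>j. ennreal (pi / 4 * (diameter (U i j))\<^sup>2))"
    by (rule suminf_ennreal_2dimen[where f="\<lambda>(i,j). ennreal (pi / 4 * (diameter (U i j))\<^sup>2)"]) simp
  also have "\<dots> \<le> (\<Sum>i. hcover \<delta> (A i) + ennreal (e * (1/2) ^ Suc i))"
    using U(4) by (intro suminf_le) (auto intro: less_imp_le)
  also have "\<dots> = (\<Sum>i. hcover \<delta> (A i)) + (\<Sum>i. ennreal (e * (1/2) ^ Suc i))"
    by (intro suminf_add[symmetric]) auto
  also have "(\<Sum>i. ennreal (e * (1/2) ^ Suc i)) = ennreal e"
  proof -
    have s: "(\<lambda>i. e * (1/2) ^ Suc i) sums (e * 1)" by (intro sums_mult power_half_series)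
    then show ?thesis using e by (subst suminf_ennreal2) (auto simp: sums_iff)
  qed
  finally show "hcover \<delta> (\<Union>i. A i) \<le> (\<Sum>i. hcover \<delta> (A i)) + ennreal e" .
qed

lemma hausdorff2_outer_mono: "A \<subseteq> B \<Longrightarrow> hausdorff2_outer A \<le> hausdorff2_outer B"
  unfolding hausdorff2_outer_hcover by (intro SUP_mono) (auto intro: hcover_mono)

lemma hausdorff2_outer_empty: "hausdorff2_outer {} = 0"
  unfolding hausdorff2_outer_hcover using hcover_empty by (auto simp: SUP_eq_const intro!: antisym SUP_least)

lemma hausdorff2_outer_UN: "hausdorff2_outer (\<Union>i. A i) \<le> (\<Sum>i. hausdorff2_outer (A i))"
  unfolding hausdorff2_outer_hcover[of "\<Union>i. A i"]
proof (rule SUP_least)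
  fix \<delta> :: real assume d: "\<delta> \<in> {0<..}"
  have "hcover \<delta> (\<Union>i. A i) \<le> (\<Sum>i. hcover \<delta> (A i))" by (rule hcover_countably_subadditive)
  also have "\<dots> \<le> (\<Sum>i. hausdorff2_outer (A i))"
    by (intro suminf_le) (auto simp: hausdorff2_outer_hcover intro!: SUP_upper d)
  finally show "hcover \<delta> (\<Union>i. A i) \<le> (\<Sum>i. hausdorff2_outer (A i))" .
qed

lemma hausdorff2_outer_measure_space: "outer_measure_space UNIV hausdorff2_outer"
  by (simp add: outer_measure_space_def positive_def increasing_def countably_subadditive_def
      hausdorff2_outer_empty hausdorff2_outer_mono hausdorff2_outer_UN)

lemma hausdorff2_outer_Un: "hausdorff2_outer (A \<union> B) \<le> hausdorff2_outer A + hausdorff2_outer B"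
  using hausdorff2_outer_UN[of "binaryset A B"]
  by (simp only: UN_binaryset_eq suminf_binaryset_eq hausdorff2_outer_empty)

text \<open>The diameters of covering sets may be assumed smaller than the gap between two separated sets,
  so a cover of the union splits into covers of the two parts.\<close>

lemma hausdorff2_outer_separated:
  assumes d: "0 < d" and sep: "\<And>x y. x \<in> A \<Longrightarrow> y \<in> B \<Longrightarrow> d \<le> dist x y"
  shows "hausdorff2_outer A + hausdorff2_outer B \<le> hausdorff2_outer (A \<union> B)"
proof -
  have split: "hcover \<delta> A + hcover \<delta> B \<le> hcover \<delta> (A \<union> B)" if \<delta>: "\<delta> < d" for \<delta>
    unfolding hcover_def[of \<delta> "A \<union> B"]
  proof (rule INF_greatest)
    fix U :: "nat \<Rightarrow> pt set" assume "U \<in> {U. A \<union> B \<subseteq> (\<Union>i. U i) \<and> (\<forall>i. bounded (U i) \<and> diameter (U i) \<le> \<delta>)}"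
    then have U: "A \<union> B \<subseteq> (\<Union>i. U i)" "\<And>i. bounded (U i)" "\<And>i. diameter (U i) \<le> \<delta>" by auto
    define V where "V i = (if U i \<inter> A = {} then {} else U i)" for i
    define W where "W i = (if U i \<inter> A = {} then U i else {})" for i
    have VW: "ennreal (pi / 4 * (diameter (V i))\<^sup>2) + ennreal (pi / 4 * (diameter (W i))\<^sup>2) = ennreal (pi / 4 * (diameter (U i))\<^sup>2)" for i
      by (simp add: V_def W_def)
    have dl: "0 \<le> \<delta>" using U(3)[of 0] diameter_ge_0[OF U(2)[of 0]] by linarith
    have "hcover \<delta> A \<le> (\<Sum>i. ennreal (pi / 4 * (diameter (V i))\<^sup>2))"
    proof (rule hcover_le)
      show "A \<subseteq> (\<Union>i. V i)"
      proof
        fix x assume x: "x \<in> A"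
        then obtain i where "x \<in> U i" using U(1) by blast
        with x have "x \<in> V i" by (auto simp: V_def)
        then show "x \<in> (\<Union>i. V i)" by blast
      qed
    qed (use U dl in \<open>auto simp: V_def\<close>)
    moreover have "hcover \<delta> B \<le> (\<Sum>i. ennreal (pi / 4 * (diameter (W i))\<^sup>2))"
    proof (rule hcover_le)
      show "B \<subseteq> (\<Union>i. W i)"
      proof
        fix y assume y: "y \<in> B"
        then obtain i where i: "y \<in> U i" using U(1) by blast
        have "U i \<inter> A = {}"
        proof (rule ccontr)
          assume "U i \<inter> A \<noteq> {}"
          then obtain x where x: "x \<in> U i" "x \<in> A" by blast
          have "dist x y \<le> diameter (U i)" using diameter_bounded_bound[OF U(2) x(1) i] .
          with sep[OF x(2) y] U(3)[of i] \<delta> show False by linarith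
        qed
        then show "y \<in> (\<Union>i. W i)" using i by (auto simp: W_def)
      qed
    qed (use U dl in \<open>auto simp: W_def\<close>)
    ultimately have "hcover \<delta> A + hcover \<delta> B \<le> (\<Sum>i. ennreal (pi / 4 * (diameter (V i))\<^sup>2)) + (\<Sum>i. ennreal (pi / 4 * (diameter (W i))\<^sup>2))"
      by (rule add_mono)
    also have "\<dots> = (\<Sum>i. ennreal (pi / 4 * (diameter (U i))\<^sup>2))"
      unfolding VW[symmetric] by (intro suminf_add) auto
    finally show "hcover \<delta> A + hcover \<delta> B \<le> (\<Sum>i. ennreal (pi / 4 * (diameter (U i))\<^sup>2))" .
  qed
  have "hausdorff2_outer A + hausdorff2_outer B = (SUP \<delta>\<in>{0<..}. SUP \<delta>'\<in>{0<..}. hcover \<delta> A + hcover \<delta>' B)"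
    unfolding hausdorff2_outer_hcover by (simp add: ennreal_SUP_add_left[symmetric] ennreal_SUP_add_right[symmetric])
  also have "\<dots> \<le> hausdorff2_outer (A \<union> B)"
  proof (intro SUP_least)
    fix a b :: real assume ab: "a \<in> {0<..}" "b \<in> {0<..}"
    define c where "c = min (d/2) (min a b)"
    have c: "c < d" "0 < c" "c \<le> a" "c \<le> b" using d ab by (auto simp: c_def)
    have "hcover a A + hcover b B \<le> hcover c A + hcover c B" by (intro add_mono hcover_antimono c)
    also have "\<dots> \<le> hcover c (A \<union> B)" by (rule split[OF c(1)])
    also have "\<dots> \<le> hausdorff2_outer (A \<union> B)" unfolding hausdorff2_outer_hcover using c by (intro SUP_upper) auto
    finally show "hcover a A + hcover b B \<le> hausdorff2_outer (A \<union> B)" .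
  qed
  finally show ?thesis .
qed

text \<open>The classical argument for metric outer measures. The complement of C is exhausted by
  sets at positive distance from C, where additivity is known; the missing part is a union of thin
  shells whose measures form a convergent series, so its tails vanish.\<close>

lemma closed_in_lambda_system:
  assumes C: "closed C"
  shows "C \<in> lambda_system UNIV UNIV hausdorff2_outer"
proof (cases "C = {}")
  case True
  then show ?thesis by (simp add: lambda_system_def hausdorff2_outer_empty)
next
  case ne: False
  let ?H = hausdorff2_outer
  have "?H (C \<inter> X) + ?H ((UNIV - C) \<inter> X) = ?H X" for X
  proof (rule antisym)
    have "?H X \<le> ?H ((C \<inter> X) \<union> ((UNIV - C) \<inter> X))" by (rule hausdorff2_outer_mono) blast
    then show "?H X \<le> ?H (C \<inter> X) + ?H ((UNIV - C) \<inter> X)" using hausdorff2_outer_Un order_trans by blast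
    show "?H (C \<inter> X) + ?H ((UNIV - C) \<inter> X) \<le> ?H X"
    proof (cases "?H X = top")
      case False
      define E where "E n = {x \<in> X. 1 / real (Suc n) \<le> infdist x C}" for n
      define R where "R n = {x \<in> X. 1 / real (Suc (Suc n)) \<le> infdist x C \<and> infdist x C < 1 / real (Suc n)}" for n
      have E1: "?H (C \<inter> X) + ?H (E n) \<le> ?H X" for n
      proof -
        have "?H (C \<inter> X) + ?H (E n) \<le> ?H ((C \<inter> X) \<union> E n)"
        proof (rule hausdorff2_outer_separated[of "1 / real (Suc n)"])
          fix x y assume "x \<in> C \<inter> X" "y \<in> E n"
          then show "1 / real (Suc n) \<le> dist x y"
            using infdist_le[of x C y] by (auto simp: E_def dist_commute)
        qed simp
        also have "\<dots> \<le> ?H X" by (rule hausdorff2_outer_mono) (auto simp: E_def)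
        finally show ?thesis .
      qed
      \<comment> \<open>A point off C has positive distance to it. The first threshold 1/(k+1) not
        exceeding this distance decides whether the point belongs to \<open>E n\<close> or to one of
        the later shells.\<close>
      have decomp: "(UNIV - C) \<inter> X \<subseteq> E n \<union> (\<Union>k. R (k + n))" for n
      proof
        fix x assume x: "x \<in> (UNIV - C) \<inter> X"
        then have pos: "0 < infdist x C" using C ne infdist_pos_not_in_closed by auto
        define P where "P k \<longleftrightarrow> 1 / real (Suc k) \<le> infdist x C" for k
        obtain k0 where "1 / real (Suc k0) < infdist x C" using pos nat_approx_posE by blast
        then have ex: "P k0" by (simp add: P_def)
        define k where "k = (LEAST k. P k)"
        have k: "P k" unfolding k_def by (rule LeastI[of P, OF ex])
        have kl: "\<not> P j" if "j < k" for j using that not_less_Least unfolding k_def by blast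
        show "x \<in> E n \<union> (\<Union>k. R (k + n))"
        proof (cases "k \<le> n")
          case True
          then have "1 / real (Suc n) \<le> 1 / real (Suc k)" by (simp add: frac_le)
          with k x show ?thesis by (auto simp: E_def P_def)
        next
          case False
          then have "k = Suc ((k - Suc n) + n)" by simp
          then obtain j where j: "k = Suc (j + n)" by blast
          then have "x \<in> R (j + n)" using k kl[of "j + n"] x by (auto simp: R_def P_def not_le)
          then show ?thesis by blast
        qed
      qed
      have Rsep: "1 / real (Suc (Suc i)) - 1 / real (Suc (Suc (Suc i))) \<le> dist x y"
        if "x \<in> R i" "y \<in> R j" "i + 2 \<le> j" for x y i j
      proof -
        have "infdist x C \<le> infdist y C + dist x y" by (rule infdist_triangle)
        moreover have "1 / real (Suc j) \<le> 1 / real (Suc (Suc (Suc i)))" using that by (intro frac_le) auto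
        ultimately show ?thesis using that by (auto simp: R_def)
      qed
      \<comment> \<open>Neighbouring shells may touch, but shells of equal parity are separated, so
        their measures add up to at most that of X. The two parities together bound the whole
        series.\<close>
      have fin_sum: "(\<Sum>k<n. ?H (R (2 * k + e))) \<le> ?H X" for n e
      proof -
        have "(\<Sum>k<n. ?H (R (2 * k + e))) \<le> ?H (\<Union>k<n. R (2 * k + e))"
        proof (induction n)
          case (Suc n)
          have "(\<Sum>k<Suc n. ?H (R (2 * k + e))) \<le> ?H (\<Union>k<n. R (2 * k + e)) + ?H (R (2 * n + e))"
            using Suc by (simp add: add_right_mono)
          also have "\<dots> \<le> ?H ((\<Union>k<n. R (2 * k + e)) \<union> R (2 * n + e))"
          proof (cases "n = 0")
            case True
            then show ?thesis by (simp add: hausdorff2_outer_empty)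
          next
            case False
            define c where "c = Min ((\<lambda>i. 1 / real (Suc (Suc i)) - 1 / real (Suc (Suc (Suc i)))) ` {..2 * n + e})"
            have c: "0 < c" unfolding c_def by (subst Min_gr_iff) (auto simp: frac_less2)
            show ?thesis
            proof (rule hausdorff2_outer_separated[OF c])
              fix x y assume "x \<in> (\<Union>k<n. R (2 * k + e))" "y \<in> R (2 * n + e)"
              then obtain k where k: "k < n" "x \<in> R (2 * k + e)" by auto
              have "c \<le> 1 / real (Suc (Suc (2*k+e))) - 1 / real (Suc (Suc (Suc (2*k+e))))"
                unfolding c_def using k by (intro Min_le imageI) auto
              also have "\<dots> \<le> dist x y" by (rule Rsep[OF k(2) \<open>y \<in> _\<close>]) (use k in auto)
              finally show "c \<le> dist x y" .
            qed
          qed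
          also have "(\<Union>k<n. R (2 * k + e)) \<union> R (2 * n + e) = (\<Union>k<Suc n. R (2 * k + e))"
            by (auto simp: less_Suc_eq)
          finally show ?case .
        qed (simp add: hausdorff2_outer_empty)
        also have "\<dots> \<le> ?H X" by (rule hausdorff2_outer_mono) (auto simp: R_def)
        finally show ?thesis .
      qed
      have sumR: "(\<Sum>k. ?H (R k)) < top"
      proof -
        have "(\<Sum>k<n. ?H (R k)) \<le> ?H X + ?H X" for n
        proof -
          have "(\<Sum>k<n. ?H (R k)) \<le> (\<Sum>k<2*n. ?H (R k))" by (rule sum_mono2) auto
          also have "\<dots> = (\<Sum>k<n. ?H (R (2 * k + 0))) + (\<Sum>k<n. ?H (R (2 * k + 1)))"
            by (induction n) (auto simp: algebra_simps)
          also have "\<dots> \<le> ?H X + ?H X" by (intro add_mono fin_sum)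
          finally show ?thesis .
        qed
        then have "(\<Sum>k. ?H (R k)) \<le> ?H X + ?H X" by (intro suminf_le_const) auto
        also have "\<dots> < top" using False by (simp add: less_top)
        finally show ?thesis .
      qed
      have bound: "?H (C \<inter> X) + ?H ((UNIV - C) \<inter> X) \<le> ?H X + (\<Sum>k. ?H (R (k + n)))" for n
      proof -
        have "?H ((UNIV - C) \<inter> X) \<le> ?H (E n \<union> (\<Union>k. R (k + n)))" by (rule hausdorff2_outer_mono[OF decomp])
        also have "\<dots> \<le> ?H (E n) + ?H (\<Union>k. R (k + n))" by (rule hausdorff2_outer_Un)
        also have "\<dots> \<le> ?H (E n) + (\<Sum>k. ?H (R (k + n)))"
          by (rule add_left_mono[OF hausdorff2_outer_UN])
        finally have "?H ((UNIV - C) \<inter> X) \<le> ?H (E n) + (\<Sum>k. ?H (R (k + n)))" .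
        then have "?H (C \<inter> X) + ?H ((UNIV - C) \<inter> X) \<le> (?H (C \<inter> X) + ?H (E n)) + (\<Sum>k. ?H (R (k + n)))"
          by (simp add: add.assoc add_left_mono)
        also have "\<dots> \<le> ?H X + (\<Sum>k. ?H (R (k + n)))" by (rule add_right_mono[OF E1])
        finally show ?thesis .
      qed
      have "(\<lambda>n. \<Sum>k. ?H (R (k + n))) \<longlonglongrightarrow> 0"
      proof -
        have "?H (R k) < top" for k using ennreal_suminf_lessD[OF sumR] .
        then have Ra: "?H (R k) = ennreal (enn2real (?H (R k)))" for k by simp
        define a where "a k = enn2real (?H (R k))" for k
        have Ha: "?H (R k) = ennreal (a k)" for k using Ra by (simp add: a_def)
        have a0: "0 \<le> a k" for k by (simp add: a_def)
        have "(\<Sum>k. ennreal (a k)) \<noteq> top" using sumR by (simp only: Ha[symmetric] less_top)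
        then have sa: "summable a" by (rule summable_suminf_not_top[OF a0])
        have "(\<lambda>n. ennreal (\<Sum>k. a (k + n))) \<longlonglongrightarrow> ennreal 0"
          by (intro tendsto_ennrealI suminf_exist_split2[OF sa])
        moreover have "ennreal (\<Sum>k. a (k + n)) = (\<Sum>k. ?H (R (k + n)))" for n
          unfolding Ha by (rule suminf_ennreal2[symmetric, OF a0 summable_ignore_initial_segment[OF sa]])
        ultimately show ?thesis by simp
      qed
      then have "(\<lambda>n. ?H X + (\<Sum>k. ?H (R (k + n)))) \<longlonglongrightarrow> ?H X + 0" by (intro tendsto_intros)
      then show ?thesis using bound by (intro LIMSEQ_le_const[where X="\<lambda>n. ?H X + (\<Sum>k. ?H (R (k + n)))"]) auto
    qed simp
  qed
  then show ?thesis by (simp add: lambda_system_def)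
qed

lemma hausdorff2_measure_space: "measure_space UNIV (sets borel) hausdorff2_outer"
proof -
  interpret sigma_algebra "UNIV :: pt set" UNIV
    using sigma_algebra_Pow[of "UNIV :: pt set"] by simp
  have ms: "measure_space UNIV (lambda_system UNIV UNIV hausdorff2_outer) hausdorff2_outer"
    by (rule caratheodory_lemma[OF hausdorff2_outer_measure_space])
  then have sa: "sigma_algebra UNIV (lambda_system UNIV UNIV hausdorff2_outer)" by (simp add: measure_space_def)
  have sub: "sets (borel :: pt measure) \<subseteq> lambda_system UNIV UNIV hausdorff2_outer"
  proof -
    have "sets (borel :: pt measure) = sigma_sets UNIV {C. closed C}"
      by (simp add: borel_eq_closed)
    also have "\<dots> \<subseteq> lambda_system UNIV UNIV hausdorff2_outer"
      by (rule sigma_algebra.sigma_sets_subset[OF sa]) (auto intro: closed_in_lambda_system)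
    finally show ?thesis .
  qed
  show ?thesis unfolding measure_space_def
  proof (intro conjI)
    show "sigma_algebra UNIV (sets (borel :: pt measure))" using sets.sigma_algebra_axioms[of "borel :: pt measure"] by simp
    show "positive (sets borel) hausdorff2_outer" by (simp add: positive_def hausdorff2_outer_empty)
    show "countably_additive (sets borel) hausdorff2_outer"
      using ms sub unfolding measure_space_def countably_additive_def by (meson subset_trans subsetD)
  qed
qed

lemma emeasure_hausdorff2: "A \<in> sets borel \<Longrightarrow> emeasure hausdorff2 A = hausdorff2_outer A"
  using hausdorff2_measure_space unfolding hausdorff2_def measure_space_def
  by (intro emeasure_measure_of_sigma) auto

lemma sets_hausdorff2: "sets hausdorff2 = sets borel"
  unfolding hausdorff2_def using sets.sigma_sets_eq[of "borel :: pt measure"] by (subst sets_measure_of) auto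

section \<open>Hausdorff measure of Lipschitz images of rectangles\<close>

abbreviation rect :: "real \<Rightarrow> real \<Rightarrow> (real \<times> real) set" where
  "rect a b \<equiv> {-a..a} \<times> {-b..b}"

lemma emeasure_lborel_rectangle:
  fixes a b c d :: real
  assumes "a \<le> b" "c \<le> d"
  shows "emeasure lborel ({a..b} \<times> {c..d}) = ennreal ((b - a) * (d - c))"
proof -
  have "emeasure lborel ({a..b} \<times> {c..d}) = emeasure (lborel \<Otimes>\<^sub>M lborel) ({a..b} \<times> {c..d})" by (simp add: lborel_prod)
  also have "\<dots> = emeasure lborel {a..b} * emeasure lborel {c..d}"
    by (rule lborel.emeasure_pair_measure_Times) auto
  finally show ?thesis using assms by (simp add: ennreal_mult)
qed

text \<open>The rectangle is cut into squares of side h, at most (3a/h) (3b/h) of them. Each image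
  has diameter at most 2Lh and contributes at most pi L^2 h^2.\<close>

lemma hausdorff2_outer_rect_le:
  fixes F :: "real \<times> real \<Rightarrow> pt"
  assumes a: "0 < a" and b: "0 < b" and L: "0 < L"
    and lip: "\<And>p q. p \<in> rect a b \<Longrightarrow> q \<in> rect a b \<Longrightarrow> norm (F p - F q) \<le> L * (\<bar>fst p - fst q\<bar> + \<bar>snd p - snd q\<bar>)"
  shows "hausdorff2_outer (F ` rect a b) \<le> ennreal (9 * pi * L\<^sup>2 * a * b)"
  unfolding hausdorff2_outer_hcover
proof (rule SUP_least)
  fix \<delta> :: real assume "\<delta> \<in> {0<..}"
  then have \<delta>: "0 < \<delta>" by simp
  \<comment> \<open>h must not exceed the half sides, so that rounding up gives at most 3c/h pieces
    of [-c, c], and 2Lh must not exceed \<delta>.\<close>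
  define h where "h = min (min a b) (\<delta> / (2 * L))"
  have h: "0 < h" "h \<le> a" "h \<le> b" "2 * L * h \<le> \<delta>"
  proof -
    show "0 < h" using a b L \<delta> by (simp add: h_def)
    have "h \<le> \<delta> / (2 * L)" by (simp add: h_def)
    then show "2 * L * h \<le> \<delta>" using L by (simp add: field_simps)
  qed (simp_all add: h_def)
  define cnt where "cnt c = nat \<lceil>2 * c / h\<rceil>" for c
  have cnt: "real (cnt c) * h \<le> 3 * c" "2 * c \<le> real (cnt c) * h" if "h \<le> c" for c
  proof -
    have c: "0 \<le> 2 * c / h" using that h by simp
    then have r: "real (cnt c) = of_int \<lceil>2 * c / h\<rceil>" unfolding cnt_def by simp
    have "real (cnt c) \<le> 2 * c / h + 1" unfolding r by linarith
    then have "real (cnt c) * h \<le> (2 * c / h + 1) * h" using h by (intro mult_right_mono) auto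
    also have "\<dots> = 2 * c + h" using h by (simp add: field_simps)
    finally show "real (cnt c) * h \<le> 3 * c" using that by simp
    have "2 * c / h \<le> real (cnt c)" unfolding r by linarith
    then show "2 * c \<le> real (cnt c) * h" using h by (simp add: field_simps)
  qed
  define I where "I c i = {-c..c} \<inter> {-c + real i * h .. -c + real (Suc i) * h}" for c and i :: nat
  have cover1: "\<exists>i < cnt c. x \<in> I c i" if "h \<le> c" "x \<in> {-c..c}" for c x
  proof -
    define i where "i = nat \<lfloor>(x + c) / h\<rfloor>"
    have nn: "0 \<le> (x + c) / h" using that h by simp
    then have ri: "real i = of_int \<lfloor>(x + c) / h\<rfloor>" by (simp add: i_def)
    have "real i \<le> (x + c) / h" "(x + c) / h < real i + 1" unfolding ri by linarith+
    then have ii: "real i * h \<le> x + c" "x + c < (real i + 1) * h" using h by (auto simp: field_simps)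
    show ?thesis
    proof (cases "i < cnt c")
      case True
      then show ?thesis using ii that by (intro exI[of _ i]) (auto simp: I_def algebra_simps)
    next
      \<comment> \<open>This happens only at the right end x = c, when h divides 2c exactly; the
        last subinterval then contains x.\<close>
      case False
      then have "real (cnt c) * h \<le> real i * h" using h by (intro mult_right_mono) auto
      then have xc: "x = c" "real (cnt c) * h = 2 * c" using ii cnt(2)[OF that(1)] that by auto
      have "0 < cnt c" using xc that h by (cases "cnt c") auto
      then obtain j where j: "cnt c = Suc j" by (cases "cnt c") auto
      have "x \<in> I c j" using xc that h unfolding I_def j by (auto simp: algebra_simps)
      then show ?thesis using j by auto
    qed
  qed
  define N where "N = cnt a * cnt b"
  define U where "U k = (if k < N then F ` (I a (k mod cnt a) \<times> I b (k div cnt a)) else {})" for k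
  have dist_U: "norm (u - v) \<le> 2 * L * h" if "u \<in> U k" "v \<in> U k" for u v k
  proof -
    from that obtain p q where pq: "u = F p" "v = F q" "p \<in> I a (k mod cnt a) \<times> I b (k div cnt a)"
      "q \<in> I a (k mod cnt a) \<times> I b (k div cnt a)" by (auto simp: U_def split: if_splits)
    have "p \<in> rect a b" "q \<in> rect a b" using pq by (auto simp: I_def)
    then have "norm (u - v) \<le> L * (\<bar>fst p - fst q\<bar> + \<bar>snd p - snd q\<bar>)" using lip pq by simp
    also have "\<dots> \<le> L * (h + h)" using pq L by (intro mult_left_mono add_mono) (auto simp: I_def algebra_simps)
    finally show ?thesis by simp
  qed
  have dU: "diameter (U k) \<le> 2 * L * h" for k
    using L h dist_U by (intro diameter_le) auto
  have bU: "bounded (U k)" for k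
    unfolding bounded_two_points dist_norm using dist_U by blast
  have cover: "F ` rect a b \<subseteq> (\<Union>k. U k)"
  proof
    fix u assume "u \<in> F ` rect a b"
    then obtain x y where xy: "u = F (x, y)" "x \<in> {-a..a}" "y \<in> {-b..b}" by auto
    obtain i where i: "i < cnt a" "x \<in> I a i" using cover1[OF h(2) xy(2)] by auto
    obtain j where j: "j < cnt b" "y \<in> I b j" using cover1[OF h(3) xy(3)] by auto
    have "i + cnt a * j < cnt a * Suc j" using i by simp
    also have "\<dots> \<le> cnt a * cnt b" using j by (intro mult_le_mono2) simp
    finally have "i + cnt a * j < N" by (simp add: N_def)
    then have "u \<in> U (i + cnt a * j)" using i j xy by (auto simp: U_def)
    then show "u \<in> (\<Union>k. U k)" by blast
  qed
  have term_le: "ennreal (pi / 4 * (diameter (U k))\<^sup>2) \<le> ennreal (pi * L\<^sup>2 * h\<^sup>2)" for k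
  proof (rule ennreal_leI)
    have "(diameter (U k))\<^sup>2 \<le> (2 * L * h)\<^sup>2" using dU diameter_ge_0[OF bU] by (intro power_mono) auto
    then have "pi / 4 * (diameter (U k))\<^sup>2 \<le> pi / 4 * (2 * L * h)\<^sup>2" by (intro mult_left_mono) auto
    then show "pi / 4 * (diameter (U k))\<^sup>2 \<le> pi * L\<^sup>2 * h\<^sup>2" by (simp add: power_mult_distrib)
  qed
  have "hcover \<delta> (F ` rect a b) \<le> (\<Sum>k. ennreal (pi / 4 * (diameter (U k))\<^sup>2))"
    using dU h(4) by (intro hcover_le[OF cover bU]) (meson order_trans)
  also have "\<dots> = (\<Sum>k<N. ennreal (pi / 4 * (diameter (U k))\<^sup>2))"
    by (rule suminf_finite) (auto simp: U_def)
  also have "\<dots> \<le> of_nat (card {..<N}) * ennreal (pi * L\<^sup>2 * h\<^sup>2)" by (rule sum_bounded_above) (rule term_le)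
  also have "\<dots> = ennreal (real N * (pi * L\<^sup>2 * h\<^sup>2))"
    by (simp add: ennreal_mult ennreal_of_nat_eq_real_of_nat)
  also have "\<dots> \<le> ennreal (9 * pi * L\<^sup>2 * a * b)"
  proof (rule ennreal_leI)
    have "(real (cnt a) * h) * (real (cnt b) * h) \<le> (3 * a) * (3 * b)"
      by (rule mult_mono[OF cnt(1)[OF h(2)] cnt(1)[OF h(3)]]) (use h a in auto)
    then have "(pi * L\<^sup>2) * ((real (cnt a) * h) * (real (cnt b) * h)) \<le> (pi * L\<^sup>2) * ((3 * a) * (3 * b))"
      by (intro mult_left_mono) auto
    then show "real N * (pi * L\<^sup>2 * h\<^sup>2) \<le> 9 * pi * L\<^sup>2 * a * b"
      by (simp add: N_def power2_eq_square ac_simps)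
  qed
  finally show "hcover \<delta> (F ` rect a b) \<le> ennreal (9 * pi * L\<^sup>2 * a * b)" .
qed

text \<open>A cover of the image pulls back to a cover of the rectangle by pieces of size at most L
  times the diameters, so the area 4ab bounds the sum of squared diameters from below. One fixed
  \<delta> suffices because the outer measure is a supremum over \<delta>.\<close>

lemma hausdorff2_outer_rect_ge:
  fixes F :: "real \<times> real \<Rightarrow> pt"
  assumes a: "0 < a" and b: "0 < b" and L: "0 < L"
    and lip: "\<And>p q. p \<in> rect a b \<Longrightarrow> q \<in> rect a b \<Longrightarrow> \<bar>fst p - fst q\<bar> + \<bar>snd p - snd q\<bar> \<le> L * norm (F p - F q)"
  shows "ennreal (pi * a * b / (4 * L\<^sup>2)) \<le> hausdorff2_outer (F ` rect a b)"
proof -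
  have "ennreal (pi * a * b / (4 * L\<^sup>2)) \<le> hcover 1 (F ` rect a b)"
    unfolding hcover_def
  proof (rule INF_greatest)
    fix U :: "nat \<Rightarrow> pt set" assume "U \<in> {U. F ` rect a b \<subseteq> (\<Union>i. U i) \<and> (\<forall>i. bounded (U i) \<and> diameter (U i) \<le> 1)}"
    then have U: "F ` rect a b \<subseteq> (\<Union>i. U i)" "\<And>i. bounded (U i)" by auto
    \<comment> \<open>The preimage of a covering set need not be measurable, so it is enclosed in a
      closed square of side 2L times the diameter; 16 L^2 / pi is the ratio of the area of the
      square to pi/4 times the squared diameter.\<close>
    define \<Phi> where "\<Phi> i W \<longleftrightarrow> W \<in> sets lborel \<and> {p \<in> rect a b. F p \<in> U i} \<subseteq> W \<and> emeasure lborel W \<le> ennreal (16 * L\<^sup>2 / pi) * ennreal (pi / 4 * (diameter (U i))\<^sup>2)" for i W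
    have "\<exists>W. \<Phi> i W" for i
    proof (cases "{p \<in> rect a b. F p \<in> U i} = {}")
      case True
      then show ?thesis unfolding \<Phi>_def by (intro exI[of _ "{}"]) auto
    next
      case False
      then obtain p where p: "p \<in> rect a b" "F p \<in> U i" by blast
      define r where "r = L * diameter (U i)"
      have r: "0 \<le> r" using L diameter_ge_0[OF U(2)] by (simp add: r_def)
      let ?W = "{fst p - r..fst p + r} \<times> {snd p - r..snd p + r}"
      have "{q \<in> rect a b. F q \<in> U i} \<subseteq> ?W"
      proof
        fix q assume "q \<in> {q \<in> rect a b. F q \<in> U i}"
        then have q: "q \<in> rect a b" "F q \<in> U i" by auto
        have "\<bar>fst p - fst q\<bar> + \<bar>snd p - snd q\<bar> \<le> L * norm (F p - F q)" by (rule lip[OF p(1) q(1)])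
        also have "\<dots> \<le> r" unfolding r_def
          using diameter_bounded_bound[OF U(2) p(2) q(2)] L by (intro mult_left_mono) (auto simp: dist_norm)
        finally have "\<bar>fst p - fst q\<bar> \<le> r" "\<bar>snd p - snd q\<bar> \<le> r" by auto
        then show "q \<in> ?W" by (cases q) (auto simp: abs_le_iff)
      qed
      moreover have "?W \<in> sets lborel" by (simp add: borel_closed closed_Times)
      moreover have "emeasure lborel ?W = ennreal (16 * L\<^sup>2 / pi) * ennreal (pi / 4 * (diameter (U i))\<^sup>2)"
      proof -
        have "emeasure lborel ?W = ennreal ((2 * r) * (2 * r))" using r by (subst emeasure_lborel_rectangle) auto
        also have "(2 * r) * (2 * r) = (16 * L\<^sup>2 / pi) * (pi / 4 * (diameter (U i))\<^sup>2)" by (simp add: r_def power2_eq_square)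
        also have "ennreal \<dots> = ennreal (16 * L\<^sup>2 / pi) * ennreal (pi / 4 * (diameter (U i))\<^sup>2)"
          by (rule ennreal_mult) auto
        finally show ?thesis .
      qed
      ultimately show ?thesis unfolding \<Phi>_def by (intro exI[of _ ?W]) simp
    qed
    then obtain W where "\<And>i. \<Phi> i (W i)" by metis
    then have W: "\<And>i. W i \<in> sets lborel" "\<And>i. {p \<in> rect a b. F p \<in> U i} \<subseteq> W i"
      "\<And>i. emeasure lborel (W i) \<le> ennreal (16 * L\<^sup>2 / pi) * ennreal (pi / 4 * (diameter (U i))\<^sup>2)"
      by (auto simp: \<Phi>_def)
    have sub: "rect a b \<subseteq> (\<Union>i. W i)"
    proof
      fix p assume p: "p \<in> rect a b"
      then obtain i where "F p \<in> U i" using U(1) by blast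
      then show "p \<in> (\<Union>i. W i)" using W(2) p by blast
    qed
    have "ennreal (4 * a * b) = emeasure lborel (rect a b)" using a b by (subst emeasure_lborel_rectangle) auto
    also have "\<dots> \<le> emeasure lborel (\<Union>i. W i)" using W by (intro emeasure_mono sub sets.countable_UN) auto
    also have "\<dots> \<le> (\<Sum>i. emeasure lborel (W i))" using W by (intro emeasure_subadditive_countably) auto
    also have "\<dots> \<le> (\<Sum>i. ennreal (16 * L\<^sup>2 / pi) * ennreal (pi / 4 * (diameter (U i))\<^sup>2))" by (intro suminf_le W(3)) auto
    also have "\<dots> = ennreal (16 * L\<^sup>2 / pi) * (\<Sum>i. ennreal (pi / 4 * (diameter (U i))\<^sup>2))" by (rule ennreal_suminf_cmult)
    finally have "ennreal (pi / (16 * L\<^sup>2)) * ennreal (4 * a * b) \<le> ennreal (pi / (16 * L\<^sup>2)) * (ennreal (16 * L\<^sup>2 / pi) * (\<Sum>i. ennreal (pi / 4 * (diameter (U i))\<^sup>2)))"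
      by (rule mult_left_mono) simp
    also have "\<dots> = (\<Sum>i. ennreal (pi / 4 * (diameter (U i))\<^sup>2))"
      using L by (simp add: mult.assoc[symmetric] ennreal_mult[symmetric])
    also have "ennreal (pi / (16 * L\<^sup>2)) * ennreal (4 * a * b) = ennreal (pi * a * b / (4 * L\<^sup>2))"
      using a b by (subst ennreal_mult[symmetric]) (auto simp: field_simps)
    finally show "ennreal (pi * a * b / (4 * L\<^sup>2)) \<le> (\<Sum>i. ennreal (pi / 4 * (diameter (U i))\<^sup>2))" .
  qed
  also have "\<dots> \<le> hausdorff2_outer (F ` rect a b)" unfolding hausdorff2_outer_hcover by (intro SUP_upper) auto
  finally show ?thesis .
qed

lemma rect_image_borel:
  fixes F :: "real \<times> real \<Rightarrow> pt"
  assumes L: "0 < L"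
    and lip: "\<And>p q. p \<in> rect a b \<Longrightarrow> q \<in> rect a b \<Longrightarrow> norm (F p - F q) \<le> L * (\<bar>fst p - fst q\<bar> + \<bar>snd p - snd q\<bar>)"
  shows "F ` rect a b \<in> sets borel"
proof -
  have "(2 * L)-lipschitz_on (rect a b) F"
  proof (rule lipschitz_onI)
    fix p q assume "p \<in> rect a b" "q \<in> rect a b"
    then have "dist (F p) (F q) \<le> L * (\<bar>fst p - fst q\<bar> + \<bar>snd p - snd q\<bar>)" using lip by (simp add: dist_norm)
    also have "\<dots> \<le> L * (dist p q + dist p q)"
      using L dist_fst_le[of p q] dist_snd_le[of p q] by (intro mult_left_mono add_mono) (auto simp: dist_real_def)
    finally show "dist (F p) (F q) \<le> 2 * L * dist p q" by simp
  qed (use L in simp)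
  then have "continuous_on (rect a b) F" by (rule lipschitz_on_continuous_on)
  then have "compact (F ` rect a b)" by (intro compact_continuous_image compact_Times) auto
  then show ?thesis by (intro borel_closed compact_imp_closed)
qed

definition wgt :: "nat \<Rightarrow> pt set \<Rightarrow> pt \<Rightarrow> real" where
  "wgt m \<Omega> x = sqrt ((unit_normal \<Omega> x \<bullet> Xf (real m) x)\<^sup>2 + (unit_normal \<Omega> x \<bullet> Yf (real m) x)\<^sup>2)"

text \<open>\<open>nn_integral\<close> is monotone for arbitrary functions, so a pointwise bound on
  the density is enough even though the normal in it comes from a choice.\<close>

lemma mu_rect_le:
  fixes F :: "real \<times> real \<Rightarrow> pt"
  assumes a: "0 < a" and b: "0 < b" and L: "0 < L" and c: "0 \<le> c"
    and lip: "\<And>p q. p \<in> rect a b \<Longrightarrow> q \<in> rect a b \<Longrightarrow> norm (F p - F q) \<le> L * (\<bar>fst p - fst q\<bar> + \<bar>snd p - snd q\<bar>)"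
    and sub: "E \<inter> frontier \<Omega> \<subseteq> F ` rect a b"
    and w: "\<And>x. x \<in> E \<inter> frontier \<Omega> \<Longrightarrow> wgt m \<Omega> x \<le> c"
  shows "mu (real m) \<Omega> E \<le> ennreal (c * (9 * pi * L\<^sup>2 * a * b))"
proof -
  have bor: "F ` rect a b \<in> sets borel" by (rule rect_image_borel[OF L lip])
  have "mu (real m) \<Omega> E \<le> (\<integral>\<^sup>+ x. ennreal c * indicator (F ` rect a b) x \<partial>hausdorff2)"
    unfolding mu_def wgt_def[symmetric]
  proof (rule nn_integral_mono)
    fix x show "indicator (E \<inter> frontier \<Omega>) x * ennreal (wgt m \<Omega> x) \<le> ennreal c * indicator (F ` rect a b) x"
    proof (cases "x \<in> E \<inter> frontier \<Omega>")
      case True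
      then show ?thesis using ennreal_leI[OF w[OF True]] subsetD[OF sub True] by simp
    qed simp
  qed
  also have "\<dots> = ennreal c * hausdorff2_outer (F ` rect a b)"
    using bor by (subst nn_integral_cmult_indicator) (auto simp: sets_hausdorff2 emeasure_hausdorff2)
  also have "\<dots> \<le> ennreal c * ennreal (9 * pi * L\<^sup>2 * a * b)"
    by (intro mult_left_mono hausdorff2_outer_rect_le a b L lip) auto
  also have "\<dots> = ennreal (c * (9 * pi * L\<^sup>2 * a * b))" using c a b by (simp add: ennreal_mult)
  finally show ?thesis .
qed

lemma mu_rect_ge:
  fixes F :: "real \<times> real \<Rightarrow> pt"
  assumes a: "0 < a" and b: "0 < b" and L: "0 < L" and c: "0 \<le> c"
    and lip: "\<And>p q. p \<in> rect a b \<Longrightarrow> q \<in> rect a b \<Longrightarrow> norm (F p - F q) \<le> L * (\<bar>fst p - fst q\<bar> + \<bar>snd p - snd q\<bar>)"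
    and lip2: "\<And>p q. p \<in> rect a b \<Longrightarrow> q \<in> rect a b \<Longrightarrow> \<bar>fst p - fst q\<bar> + \<bar>snd p - snd q\<bar> \<le> L * norm (F p - F q)"
    and sub: "F ` rect a b \<subseteq> E \<inter> frontier \<Omega>"
    and w: "\<And>x. x \<in> F ` rect a b \<Longrightarrow> c \<le> wgt m \<Omega> x"
  shows "ennreal (c * (pi * a * b / (4 * L\<^sup>2))) \<le> mu (real m) \<Omega> E"
proof -
  have bor: "F ` rect a b \<in> sets borel" by (rule rect_image_borel[OF L lip])
  have "ennreal (c * (pi * a * b / (4 * L\<^sup>2))) = ennreal c * ennreal (pi * a * b / (4 * L\<^sup>2))"
    using c a b by (intro ennreal_mult) auto
  also have "\<dots> \<le> ennreal c * hausdorff2_outer (F ` rect a b)"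
    by (intro mult_left_mono hausdorff2_outer_rect_ge a b L lip2) auto
  also have "\<dots> = (\<integral>\<^sup>+ x. ennreal c * indicator (F ` rect a b) x \<partial>hausdorff2)"
    using bor by (subst nn_integral_cmult_indicator) (auto simp: sets_hausdorff2 emeasure_hausdorff2)
  also have "\<dots> \<le> mu (real m) \<Omega> E"
    unfolding mu_def wgt_def[symmetric]
  proof (rule nn_integral_mono)
    fix x show "ennreal c * indicator (F ` rect a b) x \<le> indicator (E \<inter> frontier \<Omega>) x * ennreal (wgt m \<Omega> x)"
    proof (cases "x \<in> F ` rect a b")
      case True
      then show ?thesis using ennreal_leI[OF w[OF True]] subsetD[OF sub True] by simp
    qed simp
  qed
  finally show ?thesis .
qed

section \<open>Boundary points transversal to a horizontal direction\<close>

lemma hslope_bound: "cmod z \<le> R \<Longrightarrow> \<bar>hslope m z w\<bar> \<le> R ^ (2*m+1) * cmod w"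
  by (rule order_trans[OF abs_hslope_le]) (intro mult_right_mono power_mono, auto)

lemma rise_lipschitz:
  assumes v: "cmod v = 1" and s: "\<bar>s\<bar> \<le> a" "\<bar>s'\<bar> \<le> a" and R: "cmod z + a \<le> R"
  shows "\<bar>rise m v z s - rise m v z s'\<bar> \<le> R ^ (2*m+1) * \<bar>s - s'\<bar>"
proof -
  have "norm (rise m v z s - rise m v z s') \<le> R ^ (2*m+1) * norm (s - s')"
  proof (rule field_differentiable_bound[of "{-a..a}"])
    fix u assume u: "u \<in> {-a..a}"
    show "(rise m v z has_field_derivative hslope m (z + u *\<^sub>R v) v) (at u within {-a..a})"
      by (rule has_field_derivative_at_within[OF rise_deriv])
    have "cmod (z + u *\<^sub>R v) \<le> R" using norm_triangle_ineq[of z "u *\<^sub>R v"] v u R by auto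
    from hslope_bound[OF this, of m v] v show "norm (hslope m (z + u *\<^sub>R v) v) \<le> R ^ (2*m+1)" by simp
  qed (use s in auto)
  then show ?thesis by simp
qed

lemma rise_lipschitz_base:
  assumes m: "m \<ge> 1" and v: "cmod v = 1" and R: "cmod z + \<bar>s\<bar> \<le> R" "cmod z' + \<bar>s\<bar> \<le> R"
  shows "\<bar>rise m v z s - rise m v z' s\<bar> \<le> \<bar>s\<bar> * ((2 * real m + 1) * R ^ (2*m) * cmod (z - z'))"
proof -
  let ?K = "(2 * real m + 1) * R ^ (2*m) * cmod (z - z')"
  have "norm ((\<lambda>s. rise m v z s - rise m v z' s) s - (\<lambda>s. rise m v z s - rise m v z' s) 0) \<le> ?K * norm (s - 0)"
  proof (rule field_differentiable_bound[of "{-\<bar>s\<bar>..\<bar>s\<bar>}"])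
    fix u assume u: "u \<in> {-\<bar>s\<bar>..\<bar>s\<bar>}"
    show "((\<lambda>s. rise m v z s - rise m v z' s) has_field_derivative (hslope m (z + u *\<^sub>R v) v - hslope m (z' + u *\<^sub>R v) v)) (at u within {-\<bar>s\<bar>..\<bar>s\<bar>})"
      by (intro DERIV_diff has_field_derivative_at_within[OF rise_deriv])
    have 1: "cmod (z + u *\<^sub>R v) \<le> R" using norm_triangle_ineq[of z "u *\<^sub>R v"] v u R by auto
    have 2: "cmod (z' + u *\<^sub>R v) \<le> R" using norm_triangle_ineq[of z' "u *\<^sub>R v"] v u R by auto
    have "\<bar>hslope m (z + u *\<^sub>R v) v - hslope m (z' + u *\<^sub>R v) v\<bar> \<le> cmod (twist m (z + u *\<^sub>R v) - twist m (z' + u *\<^sub>R v))"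
      using abs_diff_hslope_le[of m "z + u *\<^sub>R v" v "z' + u *\<^sub>R v"] v by simp
    also have "\<dots> \<le> ?K" using twist_lipschitz[OF m 1 2] by simp
    finally show "norm (hslope m (z + u *\<^sub>R v) v - hslope m (z' + u *\<^sub>R v) v) \<le> ?K" by simp
  qed auto
  then show ?thesis by (simp add: mult.commute)
qed

text \<open>The flow of the unit horizontal field in direction \<open>v\<close>, started on the plane through \<open>p\<close>
  spanned by the horizontal direction \<open>\<i> v\<close> and the vertical direction. The coordinate \<open>\<theta>\<close> is the
  deviation that the box \<open>hbox m p r\<close> controls.\<close>

definition flowout :: "nat \<Rightarrow> complex \<Rightarrow> pt \<Rightarrow> real \<Rightarrow> real \<Rightarrow> real \<Rightarrow> pt" where
  "flowout m v p s y \<theta> = (fst p + y *\<^sub>R (\<i> * v) + s *\<^sub>R v,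
     snd p + hslope m (fst p) (y *\<^sub>R (\<i> * v)) + \<theta> + rise m v (fst p + y *\<^sub>R (\<i> * v)) s)"

lemma cmod_frame:
  assumes "cmod v = 1"
  shows "cmod (y *\<^sub>R (\<i> * v) + s *\<^sub>R v) = sqrt (s\<^sup>2 + y\<^sup>2)"
proof -
  have "y *\<^sub>R (\<i> * v) + s *\<^sub>R v = Complex s y * v" by (simp add: complex_eq_iff algebra_simps)
  then have "cmod (y *\<^sub>R (\<i> * v) + s *\<^sub>R v) = cmod (Complex s y) * cmod v" by (simp only: norm_mult)
  then show ?thesis using assms by (simp add: complex_norm)
qed

lemma frame_bounds:
  assumes "cmod v = 1"
  shows "\<bar>s\<bar> \<le> cmod (y *\<^sub>R (\<i> * v) + s *\<^sub>R v)" "\<bar>y\<bar> \<le> cmod (y *\<^sub>R (\<i> * v) + s *\<^sub>R v)"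
    "cmod (y *\<^sub>R (\<i> * v) + s *\<^sub>R v) \<le> \<bar>s\<bar> + \<bar>y\<bar>"
  unfolding cmod_frame[OF assms] by (auto intro: real_le_rsqrt sqrt_sum_squares_le_sum_abs)

lemma flowout_surj:
  assumes "cmod v = 1"
  obtains s y \<theta> where "q = flowout m v p s y \<theta>"
proof -
  define c where "c = (fst q - fst p) * cnj v"
  have "c * v = (fst q - fst p) * (v * cnj v)" by (simp add: c_def)
  also have "v * cnj v = 1" using assms by (simp add: complex_norm_square[symmetric])
  finally have cv: "c * v = fst q - fst p" by simp
  have "c * v = Im c *\<^sub>R (\<i> * v) + Re c *\<^sub>R v" by (simp add: complex_eq_iff algebra_simps)
  with cv have f: "fst q = fst p + Im c *\<^sub>R (\<i> * v) + Re c *\<^sub>R v" by (simp add: algebra_simps)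
  define \<theta> where "\<theta> = snd q - snd p - hslope m (fst p) (Im c *\<^sub>R (\<i> * v)) - rise m v (fst p + Im c *\<^sub>R (\<i> * v)) (Re c)"
  have "q = flowout m v p (Re c) (Im c) \<theta>" using f by (simp add: flowout_def \<theta>_def prod_eq_iff)
  then show ?thesis by (rule that)
qed

lemma flowout_zero [simp]: "flowout m v p 0 0 0 = p"
  by (simp add: flowout_def)

lemma flowout_deriv:
  "((\<lambda>s. flowout m v p s y \<theta>) has_vector_derivative hvel m (fst (flowout m v p s y \<theta>)) v) (at s)"
proof -
  have 1: "((\<lambda>s. fst p + y *\<^sub>R (\<i> * v) + s *\<^sub>R v) has_vector_derivative v) (at s)"
    by (auto intro!: derivative_eq_intros)
  have "((\<lambda>s. snd p + hslope m (fst p) (y *\<^sub>R (\<i> * v)) + \<theta> + rise m v (fst p + y *\<^sub>R (\<i> * v)) s)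
      has_real_derivative 0 + hslope m (fst p + y *\<^sub>R (\<i> * v) + s *\<^sub>R v) v) (at s)"
    by (intro DERIV_add DERIV_const rise_deriv)
  then have 2: "((\<lambda>s. snd p + hslope m (fst p) (y *\<^sub>R (\<i> * v)) + \<theta> + rise m v (fst p + y *\<^sub>R (\<i> * v)) s)
      has_vector_derivative hslope m (fst p + y *\<^sub>R (\<i> * v) + s *\<^sub>R v) v) (at s)"
    by (simp add: has_real_derivative_iff_has_vector_derivative)
  show ?thesis unfolding flowout_def hvel_def fst_conv by (rule has_vector_derivative_Pair[OF 1 2])
qed

lemma norm_pt_le: "norm (x :: pt) \<le> cmod (fst x) + \<bar>snd x\<bar>"
  unfolding norm_prod_def by (rule order_trans[OF sqrt_sum_squares_le_sum_abs]) simp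

lemma norm_fst_pt_le: "cmod (fst (x::pt)) \<le> norm x" and norm_snd_pt_le: "\<bar>snd (x::pt)\<bar> \<le> norm x"
  unfolding norm_prod_def by (auto intro: real_le_rsqrt)

text \<open>Dominates the derivatives of the flow coordinates where |z| <= R: 1 for the planar part
  and for \<theta>, R^(2m+1) for the slope, and the last term for the change of slope between
  neighbouring flow lines.\<close>

definition flow_const :: "nat \<Rightarrow> real \<Rightarrow> real" where
  "flow_const m R = 1 + R ^ (2*m+1) + (2 * real m + 1) * R ^ (2*m)"

lemma flowout_diff:
  assumes m: "m \<ge> 1" and v: "cmod v = 1" and R: "cmod (fst p) + 3 \<le> R"
    and b: "\<bar>s\<bar> \<le> 1" "\<bar>s'\<bar> \<le> 1" "\<bar>y\<bar> \<le> 1" "\<bar>y'\<bar> \<le> 1"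
  shows "\<bar>snd (flowout m v p s y \<theta>) - snd (flowout m v p s' y' \<theta>') - (\<theta> - \<theta>')\<bar>
      \<le> R ^ (2*m+1) * \<bar>y - y'\<bar> + (2 * real m + 1) * R ^ (2*m) * \<bar>y - y'\<bar> + R ^ (2*m+1) * \<bar>s - s'\<bar>"
proof -
  let ?z = "fst p + y *\<^sub>R (\<i> * v)" and ?z' = "fst p + y' *\<^sub>R (\<i> * v)"
  have R0: "0 \<le> R" using R norm_ge_zero[of "fst p"] by linarith
  have z: "cmod ?z \<le> cmod (fst p) + 1" "cmod ?z' \<le> cmod (fst p) + 1"
    using norm_triangle_ineq[of "fst p" "y *\<^sub>R (\<i> * v)"] norm_triangle_ineq[of "fst p" "y' *\<^sub>R (\<i> * v)"] v b by (auto simp: norm_mult)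
  \<comment> \<open>Three sources of height: the linear drift in y, the change of flow line at equal
    time, and the change of time on one flow line.\<close>
  have "snd (flowout m v p s y \<theta>) - snd (flowout m v p s' y' \<theta>') - (\<theta> - \<theta>') =
     hslope m (fst p) ((y - y') *\<^sub>R (\<i> * v)) + (rise m v ?z s - rise m v ?z' s) + (rise m v ?z' s - rise m v ?z' s')"
    by (simp add: flowout_def hslope_scaleR left_diff_distrib)
  moreover have "\<bar>hslope m (fst p) ((y - y') *\<^sub>R (\<i> * v))\<bar> \<le> R ^ (2*m+1) * \<bar>y - y'\<bar>"
    using hslope_bound[of "fst p" R m "(y - y') *\<^sub>R (\<i> * v)"] R v by (simp add: norm_mult)
  moreover have "\<bar>rise m v ?z s - rise m v ?z' s\<bar> \<le> (2 * real m + 1) * R ^ (2*m) * \<bar>y - y'\<bar>"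
  proof -
    have "\<bar>rise m v ?z s - rise m v ?z' s\<bar> \<le> \<bar>s\<bar> * ((2 * real m + 1) * R ^ (2*m) * cmod (?z - ?z'))"
      by (rule rise_lipschitz_base[OF m v]) (use z b R in auto)
    also have "\<dots> \<le> 1 * ((2 * real m + 1) * R ^ (2*m) * cmod (?z - ?z'))" using b R0 by (intro mult_right_mono) auto
    also have "?z - ?z' = (y - y') *\<^sub>R (\<i> * v)" by (simp add: algebra_simps)
    finally show ?thesis using v by (simp add: norm_mult)
  qed
  moreover have "\<bar>rise m v ?z' s - rise m v ?z' s'\<bar> \<le> R ^ (2*m+1) * \<bar>s - s'\<bar>"
    by (rule rise_lipschitz[OF v b(1,2)]) (use z R in auto)
  ultimately show ?thesis by linarith
qed

lemma flowout_fst_diff: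
  "fst (flowout m v p s y \<theta>) - fst (flowout m v p s' y' \<theta>') = (y - y') *\<^sub>R (\<i> * v) + (s - s') *\<^sub>R v"
  by (simp add: flowout_def algebra_simps)

lemma flowout_lipschitz:
  assumes m: "m \<ge> 1" and v: "cmod v = 1" and R: "cmod (fst p) + 3 \<le> R"
    and b: "\<bar>s\<bar> \<le> 1" "\<bar>s'\<bar> \<le> 1" "\<bar>y\<bar> \<le> 1" "\<bar>y'\<bar> \<le> 1"
  shows "norm (flowout m v p s y \<theta> - flowout m v p s' y' \<theta>') \<le> flow_const m R * (\<bar>s - s'\<bar> + \<bar>y - y'\<bar> + \<bar>\<theta> - \<theta>'\<bar>)"
proof -
  let ?H = "R ^ (2*m+1)" and ?L = "(2 * real m + 1) * R ^ (2*m)"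
  have R0: "0 \<le> R" using R norm_ge_zero[of "fst p"] by linarith
  then have H0: "0 \<le> ?H" "0 \<le> ?L" by auto
  have "norm (flowout m v p s y \<theta> - flowout m v p s' y' \<theta>') \<le> cmod ((y - y') *\<^sub>R (\<i> * v) + (s - s') *\<^sub>R v) + \<bar>snd (flowout m v p s y \<theta>) - snd (flowout m v p s' y' \<theta>')\<bar>"
    using norm_pt_le[of "flowout m v p s y \<theta> - flowout m v p s' y' \<theta>'"] by (simp add: flowout_fst_diff)
  also have "\<dots> \<le> (\<bar>s - s'\<bar> + \<bar>y - y'\<bar>) + (\<bar>\<theta> - \<theta>'\<bar> + (?H * \<bar>y - y'\<bar> + ?L * \<bar>y - y'\<bar> + ?H * \<bar>s - s'\<bar>))"
    using flowout_diff[OF m v R b, of \<theta> \<theta>'] frame_bounds(3)[OF v, of "y - y'" "s - s'"] by linarith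
  also have "\<dots> \<le> flow_const m R * (\<bar>s - s'\<bar> + \<bar>y - y'\<bar> + \<bar>\<theta> - \<theta>'\<bar>)"
  proof -
    have "(s + y) + (t + (H * y + L * y + H * s)) \<le> (1 + H + L) * (s + y + t)"
      if "0 \<le> H" "0 \<le> L" "0 \<le> s" "0 \<le> y" "0 \<le> t" for H L s y t :: real
      using that mult_nonneg_nonneg[of H t] mult_nonneg_nonneg[of L t] mult_nonneg_nonneg[of L s] by (simp add: algebra_simps)
    from this[OF H0] show ?thesis unfolding flow_const_def by simp
  qed
  finally show ?thesis .
qed

text \<open>Only y and \<theta> are recovered: they are the chart parameters of a surface on which s
  is a function of them.\<close>

lemma flowout_inverse_lipschitz:
  assumes m: "m \<ge> 1" and v: "cmod v = 1" and R: "cmod (fst p) + 3 \<le> R"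
    and b: "\<bar>s\<bar> \<le> 1" "\<bar>s'\<bar> \<le> 1" "\<bar>y\<bar> \<le> 1" "\<bar>y'\<bar> \<le> 1"
  shows "\<bar>y - y'\<bar> + \<bar>\<theta> - \<theta>'\<bar> \<le> 2 * flow_const m R * norm (flowout m v p s y \<theta> - flowout m v p s' y' \<theta>')"
proof -
  let ?H = "R ^ (2*m+1)" and ?L = "(2 * real m + 1) * R ^ (2*m)"
  let ?d = "norm (flowout m v p s y \<theta> - flowout m v p s' y' \<theta>')"
  have R0: "0 \<le> R" using R norm_ge_zero[of "fst p"] by linarith
  then have H0: "0 \<le> ?H" "0 \<le> ?L" by auto
  have "cmod ((y - y') *\<^sub>R (\<i> * v) + (s - s') *\<^sub>R v) \<le> ?d"
    using norm_fst_pt_le[of "flowout m v p s y \<theta> - flowout m v p s' y' \<theta>'"] by (simp add: flowout_fst_diff)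
  then have ys: "\<bar>y - y'\<bar> \<le> ?d" "\<bar>s - s'\<bar> \<le> ?d"
    using frame_bounds(1,2)[OF v, where y="y - y'" and s="s - s'"] by linarith+
  have t: "\<bar>snd (flowout m v p s y \<theta>) - snd (flowout m v p s' y' \<theta>')\<bar> \<le> ?d"
    using norm_snd_pt_le[of "flowout m v p s y \<theta> - flowout m v p s' y' \<theta>'"] by simp
  have "?H * \<bar>y - y'\<bar> + ?L * \<bar>y - y'\<bar> + ?H * \<bar>s - s'\<bar> \<le> ?H * ?d + ?L * ?d + ?H * ?d"
    using ys H0 by (intro add_mono mult_left_mono) auto
  then have "\<bar>y - y'\<bar> + \<bar>\<theta> - \<theta>'\<bar> \<le> ?d + (?d + (?H * ?d + ?L * ?d + ?H * ?d))"
    using flowout_diff[OF m v R b, of \<theta> \<theta>'] t ys(1) by linarith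
  also have "\<dots> \<le> 2 * flow_const m R * ?d"
    unfolding flow_const_def using mult_nonneg_nonneg[OF H0(2), of ?d] by (simp add: algebra_simps)
  finally show ?thesis .
qed

text \<open>The error is the rise along a flow line minus its linearisation at p. The size a is kept
  apart from r because the lower bound for \<mu> needs an error that is a small fraction of r^2
  (|z_p| + r)^(2m).\<close>

lemma flowout_box:
  assumes m: "m \<ge> 1" and v: "cmod v = 1" and b: "\<bar>s\<bar> \<le> a" "\<bar>y\<bar> \<le> a" and a: "a \<le> r"
  shows "\<bar>snd (flowout m v p s y \<theta>) - snd p - hslope m (fst p) (fst (flowout m v p s y \<theta>) - fst p) - \<theta>\<bar>
     \<le> (4 * real m + 2) * 4 ^ m * (cmod (fst p) + r) ^ (2*m) * a\<^sup>2"
proof -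
  let ?z = "fst p + y *\<^sub>R (\<i> * v)"
  have a0: "0 \<le> a" using b by linarith
  have "snd (flowout m v p s y \<theta>) - snd p - hslope m (fst p) (fst (flowout m v p s y \<theta>) - fst p) - \<theta>
      = rise m v ?z s - s * hslope m (fst p) v"
    by (simp add: flowout_def hslope_scaleR hslope_add algebra_simps)
  also have "\<bar>\<dots>\<bar> \<le> (2 * real m + 1) * (cmod (fst p) + 2 * a) ^ (2*m) * (2 * a) * \<bar>s\<bar>"
    by (rule rise_approx[OF m v]) (use b v in \<open>auto simp: norm_mult\<close>)
  also have "\<dots> \<le> (2 * real m + 1) * (2 * (cmod (fst p) + r)) ^ (2*m) * (2 * a) * a"
  proof -
    \<comment> \<open>The factor 4^m arises from |z_p| + 2a <= 2 (|z_p| + r).\<close>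
    have "(cmod (fst p) + 2 * a) ^ (2*m) \<le> (2 * (cmod (fst p) + r)) ^ (2*m)"
    proof (rule power_mono)
      have c: "0 \<le> cmod (fst p)" by simp
      show "cmod (fst p) + 2 * a \<le> 2 * (cmod (fst p) + r)" unfolding distrib_left using c a a0 by linarith
      show "0 \<le> cmod (fst p) + 2 * a" using a0 by simp
    qed
    then show ?thesis using a0 a b by (intro mult_mono) auto
  qed
  also have "\<dots> = (4 * real m + 2) * 4 ^ m * (cmod (fst p) + r) ^ (2*m) * a\<^sup>2"
  proof -
    have "(2 * X) ^ (2*m) = 4 ^ m * X ^ (2*m)" for X :: real by (simp add: power_mult_distrib power_mult)
    from this[of "cmod (fst p) + r"] show ?thesis by (simp only:) (simp add: power2_eq_square)
  qed
  finally show ?thesis .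
qed

section \<open>Gradients of defining functions and the unit normal\<close>

lemma smooth_on_gradient:
  fixes f :: "'a::euclidean_space \<Rightarrow> real"
  assumes "smooth_on U f"
  shows "\<exists>G. (\<forall>x\<in>U. (f has_derivative (\<lambda>v. G x \<bullet> v)) (at x)) \<and> continuous_on U G \<and>
    (\<forall>x. \<forall>b\<in>Basis. G x \<bullet> b = iter_pd [b] f x)"
proof -
  have U: "open U" and d: "\<And>bs x. set bs \<subseteq> Basis \<Longrightarrow> x \<in> U \<Longrightarrow> iter_pd bs f differentiable (at x)"
    using assms by (auto simp: smooth_on_def)
  define G where "G x = (\<Sum>b\<in>Basis. frechet_derivative f (at x) b *\<^sub>R b)" for x
  have 1: "(f has_derivative (\<lambda>v. G x \<bullet> v)) (at x)" if "x \<in> U" for x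
  proof -
    have fd: "(f has_derivative frechet_derivative f (at x)) (at x)"
      using d[of "[]" x] that frechet_derivative_works by auto
    then have lin: "linear (frechet_derivative f (at x))" by (rule has_derivative_linear)
    have "frechet_derivative f (at x) v = G x \<bullet> v" for v
    proof -
      have "frechet_derivative f (at x) v = frechet_derivative f (at x) (\<Sum>b\<in>Basis. (v \<bullet> b) *\<^sub>R b)" by (simp add: euclidean_representation)
      also have "\<dots> = (\<Sum>b\<in>Basis. (v \<bullet> b) * frechet_derivative f (at x) b)"
        by (simp add: linear_sum[OF lin] linear_scale[OF lin])
      also have "\<dots> = (\<Sum>b\<in>Basis. frechet_derivative f (at x) b * (b \<bullet> v))"
        by (intro sum.cong) (simp_all add: inner_commute)
      also have "\<dots> = G x \<bullet> v" by (simp add: G_def inner_sum_left)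
      finally show ?thesis .
    qed
    then have "frechet_derivative f (at x) = (\<lambda>v. G x \<bullet> v)" by (rule ext)
    with fd show ?thesis by simp
  qed
  have "continuous_on U (\<lambda>x. frechet_derivative f (at x) b)" if "b \<in> Basis" for b
  proof -
    have "(\<lambda>x. frechet_derivative f (at x) b) differentiable (at x)" if "x \<in> U" for x
      using d[of "[b]" x] that \<open>b \<in> Basis\<close> by simp
    then show ?thesis
      by (intro differentiable_imp_continuous_on) (auto simp: differentiable_on_def intro: differentiable_at_withinI)
  qed
  then have 2: "continuous_on U G" unfolding G_def by (intro continuous_intros) auto
  have 3: "G x \<bullet> b = iter_pd [b] f x" if "b \<in> Basis" for x b
    using that by (simp add: G_def inner_sum_left inner_Basis if_distrib cong: if_cong)
  show ?thesis by (intro exI[of _ G] conjI ballI allI 1 2 3)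
qed

lemma line_derivative:
  fixes f :: "'a::real_inner \<Rightarrow> real"
  assumes "(f has_derivative (\<lambda>v. g \<bullet> v)) (at x)"
  shows "((\<lambda>s. f (x + s *\<^sub>R v)) has_real_derivative g \<bullet> v) (at 0)"
proof -
  have 1: "((\<lambda>s::real. x + s *\<^sub>R v) has_derivative (\<lambda>s. s *\<^sub>R v)) (at 0)" by (auto intro!: derivative_eq_intros)
  have "(f has_derivative (\<lambda>v. g \<bullet> v)) (at (x + 0 *\<^sub>R v))" using assms by simp
  from has_derivative_compose[OF 1 this] show ?thesis
    by (simp add: has_field_derivative_def mult_commute_abs)
qed

text \<open>Where \<rho> > 0 a whole neighbourhood avoids \<open>\<Omega>\<close>. From a zero of
  \<rho> a small step along -g makes \<rho> negative and so enters \<open>\<Omega>\<close>; the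
  nonzero gradient excludes zeros away from the closure of \<open>\<Omega>\<close>.\<close>

lemma defining_fn_frontier:
  assumes \<Omega>: "open \<Omega>" and df: "defining_fn \<Omega> U \<rho>" and x: "x \<in> U"
    and g: "(\<rho> has_derivative (\<lambda>v. g \<bullet> v)) (at x)" "g \<noteq> 0"
  shows "x \<in> frontier \<Omega> \<longleftrightarrow> \<rho> x = 0"
proof -
  have U: "open U" and sub: "\<And>y. y \<in> U \<Longrightarrow> y \<in> \<Omega> \<longleftrightarrow> \<rho> y < 0" using df by (auto simp: defining_fn_def)
  have fr: "frontier \<Omega> = closure \<Omega> - \<Omega>" using \<Omega> by (simp add: frontier_def interior_open)
  have cont: "isCont \<rho> x" using g(1) by (rule has_derivative_continuous)
  show ?thesis
  proof
    assume xf: "x \<in> frontier \<Omega>"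
    then have "\<not> \<rho> x < 0" using sub[OF x] fr by auto
    moreover have "\<not> \<rho> x > 0"
    proof
      assume "\<rho> x > 0"
      then have "eventually (\<lambda>y. \<rho> y > 0) (at x)" using cont by (simp add: isCont_def order_tendstoD)
      then have "eventually (\<lambda>y. \<rho> y > 0) (nhds x)" using \<open>\<rho> x > 0\<close> eventually_nhds_conv_at by blast
      moreover have "eventually (\<lambda>y. y \<in> U) (nhds x)" using U x by (rule eventually_nhds_in_open)
      ultimately have "eventually (\<lambda>y. \<rho> y > 0 \<and> y \<in> U) (nhds x)" by (rule eventually_conj)
      then obtain V where V: "open V" "x \<in> V" "\<forall>y\<in>V. \<rho> y > 0 \<and> y \<in> U" unfolding eventually_nhds by blast
      have "x \<in> closure \<Omega>" using xf fr by auto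
      then obtain y where "y \<in> \<Omega>" "y \<in> V" using V open_Int_closure_eq_empty[of V \<Omega>] by blast
      then show False using V(3) sub[of y] by force
    qed
    ultimately show "\<rho> x = 0" by simp
  next
    assume r0: "\<rho> x = 0"
    have "\<forall>e>0. \<exists>y\<in>\<Omega>. dist y x < e"
    proof (intro allI impI)
      fix e :: real assume e: "0 < e"
      obtain d where d: "0 < d" "ball x d \<subseteq> U" using U x open_contains_ball by blast
      have "((\<lambda>s. \<rho> (x + s *\<^sub>R (- g))) has_real_derivative g \<bullet> (- g)) (at 0)" by (rule line_derivative[OF g(1)])
      moreover have "g \<bullet> (- g) < 0" using g(2) by simp
      ultimately obtain c where c: "0 < c" "\<And>h. 0 < h \<Longrightarrow> h < c \<Longrightarrow> \<rho> (x + h *\<^sub>R (- g)) < \<rho> x"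
        using DERIV_neg_dec_right[of "\<lambda>s. \<rho> (x + s *\<^sub>R (- g))" "g \<bullet> (- g)" 0] by auto
      define h where "h = min (c/2) (min d e / (2 * norm g))"
      have ng: "0 < norm g" using g(2) by simp
      have h: "0 < h" "h < c" "h * norm g < d" "h * norm g < e"
      proof -
        show "0 < h" "h < c" using c d e ng by (auto simp: h_def)
        have "h * norm g \<le> min d e / (2 * norm g) * norm g" using ng by (intro mult_right_mono) (auto simp: h_def)
        also have "\<dots> = min d e / 2" using ng by simp
        finally show "h * norm g < d" "h * norm g < e" using d e by auto
      qed
      let ?y = "x + h *\<^sub>R (- g)"
      have dy: "dist ?y x = h * norm g" using h by (simp add: dist_norm)
      then have "?y \<in> ball x d" using h by (simp add: dist_commute)
      then have "?y \<in> U" using d by blast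
      moreover have "\<rho> ?y < 0" using c(2)[OF h(1,2)] r0 by simp
      ultimately show "\<exists>y\<in>\<Omega>. dist y x < e" using sub dy h by metis
    qed
    then have "x \<in> closure \<Omega>" by (simp add: closure_approachable)
    moreover have "x \<notin> \<Omega>" using sub[OF x] r0 by simp
    ultimately show "x \<in> frontier \<Omega>" using fr by simp
  qed
qed

lemma defining_fn_gradient:
  assumes "defining_fn \<Omega> U \<rho>"
  obtains G where "\<And>x. x \<in> U \<Longrightarrow> (\<rho> has_derivative (\<lambda>v. G x \<bullet> v)) (at x)" "continuous_on U G" "\<And>x. x \<in> U \<Longrightarrow> G x \<noteq> 0"
proof -
  have sm: "smooth_on U \<rho>" and nz: "\<And>x. x \<in> U \<Longrightarrow> frechet_derivative \<rho> (at x) \<noteq> (\<lambda>v. 0)"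
    using assms by (auto simp: defining_fn_def)
  obtain G where G0: "\<forall>x\<in>U. (\<rho> has_derivative (\<lambda>v. G x \<bullet> v)) (at x)" "continuous_on U G"
    using smooth_on_gradient[OF sm] by blast
  note G = bspec[OF G0(1)] G0(2)
  have "G x \<noteq> 0" if "x \<in> U" for x
  proof
    assume "G x = 0"
    then have "(\<rho> has_derivative (\<lambda>v. 0)) (at x)" using G(1)[OF that] by simp
    then have "frechet_derivative \<rho> (at x) = (\<lambda>v. 0)" using frechet_derivative_at by metis
    with nz[OF that] show False by simp
  qed
  with G show ?thesis using that by blast
qed

lemma unit_normal_witness:
  assumes "smooth_boundary \<Omega>" "x \<in> frontier \<Omega>"
  obtains U \<rho> g where "x \<in> U" "defining_fn \<Omega> U \<rho>" "(\<rho> has_derivative (\<lambda>v. g \<bullet> v)) (at x)" "g \<noteq> 0"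
    "unit_normal \<Omega> x = g /\<^sub>R norm g"
proof -
  obtain U \<rho> where U: "x \<in> U" "defining_fn \<Omega> U \<rho>" using assms unfolding smooth_boundary_def by blast
  obtain G where "(\<rho> has_derivative (\<lambda>v. G x \<bullet> v)) (at x)" "G x \<noteq> 0"
    using defining_fn_gradient[OF U(2)] U(1) by metis
  then have "\<exists>N. \<exists>U \<rho> g. x \<in> U \<and> defining_fn \<Omega> U \<rho> \<and> (\<rho> has_derivative (\<lambda>v. g \<bullet> v)) (at x) \<and> g \<noteq> 0 \<and> N = g /\<^sub>R norm g"
    using U by blast
  from someI_ex[OF this, folded unit_normal_def] show ?thesis using that by blast
qed

lemma norm_unit_normal:
  assumes "smooth_boundary \<Omega>" "x \<in> frontier \<Omega>"
  shows "norm (unit_normal \<Omega> x) = 1"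
proof -
  from unit_normal_witness[OF assms] obtain g :: pt where "g \<noteq> 0" "unit_normal \<Omega> x = g /\<^sub>R norm g" by blast
  then show ?thesis by simp
qed

text \<open>The half space \<open>g \<bullet> v < 0\<close> consists of directions that enter \<open>\<Omega>\<close>, whatever the defining
  function; so any two gradients are parallel.\<close>

lemma unit_normal_parallel:
  assumes sb: "smooth_boundary \<Omega>" and \<Omega>: "open \<Omega>" and x: "x \<in> frontier \<Omega>" "x \<in> U"
    and df: "defining_fn \<Omega> U \<rho>" and g: "(\<rho> has_derivative (\<lambda>v. g \<bullet> v)) (at x)" "g \<noteq> 0"
  obtains k where "unit_normal \<Omega> x = k *\<^sub>R g" "\<bar>k\<bar> * norm g = 1"
proof -
  obtain U' \<rho>' g' where w: "x \<in> U'" "defining_fn \<Omega> U' \<rho>'" "(\<rho>' has_derivative (\<lambda>v. g' \<bullet> v)) (at x)" "g' \<noteq> 0"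
    "unit_normal \<Omega> x = g' /\<^sub>R norm g'" using unit_normal_witness[OF sb x(1)] by metis
  have r0: "\<rho> x = 0" "\<rho>' x = 0" using defining_fn_frontier[OF \<Omega> df x(2) g] defining_fn_frontier[OF \<Omega> w(2,1,3,4)] x by auto
  have neg: "g' \<bullet> v \<le> 0" if v: "g \<bullet> v < 0" for v
  proof (rule ccontr)
    assume "\<not> g' \<bullet> v \<le> 0"
    then have pos: "g' \<bullet> v > 0" by simp
    obtain c where c: "0 < c" "\<And>h. 0 < h \<Longrightarrow> h < c \<Longrightarrow> \<rho> (x + h *\<^sub>R v) < 0"
      using DERIV_neg_dec_right[OF line_derivative[OF g(1)] v] r0 by auto
    obtain c' where c': "0 < c'" "\<And>h. 0 < h \<Longrightarrow> h < c' \<Longrightarrow> 0 < \<rho>' (x + h *\<^sub>R v)"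
      using DERIV_pos_inc_right[OF line_derivative[OF w(3)] pos] r0 by auto
    have "open (U \<inter> U')" using df w(2) by (auto simp: defining_fn_def)
    then obtain d where d: "0 < d" "ball x d \<subseteq> U \<inter> U'" using x w(1) open_contains_ball by blast
    define h where "h = min (min c c') (d / (norm v + 1)) / 2"
    have h: "0 < h" "h < c" "h < c'" using c c' d by (auto simp: h_def add_nonneg_pos)
    have "h * norm v < d"
    proof -
      have nv: "0 < norm v + 1" by (simp add: add_nonneg_pos)
      have "h \<le> d / (norm v + 1) / 2" unfolding h_def by (intro divide_right_mono min.cobounded2) simp
      then have "h * (norm v + 1) \<le> d / (norm v + 1) / 2 * (norm v + 1)" using nv by (intro mult_right_mono) auto
      also have "\<dots> = d / 2"
      proof -
        have "d / n / 2 * n = d / 2" if "0 < n" for n :: real using that by simp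
        from this[OF nv] show ?thesis .
      qed
      finally have "h * (norm v + 1) \<le> d / 2" .
      then show ?thesis using h d by (simp add: algebra_simps)
    qed
    then have "x + h *\<^sub>R v \<in> ball x d" using h by (simp add: dist_norm)
    then have "x + h *\<^sub>R v \<in> U \<inter> U'" using d by blast
    then have "\<rho> (x + h *\<^sub>R v) < 0 \<longleftrightarrow> \<rho>' (x + h *\<^sub>R v) < 0"
    proof -
      let ?y = "x + h *\<^sub>R v"
      have "?y \<in> \<Omega> \<inter> U \<longleftrightarrow> ?y \<in> {x\<in>U. \<rho> x < 0}" "?y \<in> \<Omega> \<inter> U' \<longleftrightarrow> ?y \<in> {x\<in>U'. \<rho>' x < 0}"
        using df w(2) unfolding defining_fn_def by blast+
      then show ?thesis using \<open>?y \<in> U \<inter> U'\<close> by blast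
    qed
    with c(2)[OF h(1,2)] c'(2)[OF h(1,3)] show False by simp
  qed
  \<comment> \<open>A direction on the bounding hyperplane is tilted by a small multiple of -g into
    the half space. Used for u and -u, this makes g' vanish on the part of itself orthogonal to
    g.\<close>
  have le: "g' \<bullet> u \<le> 0" if u: "g \<bullet> u = 0" for u
  proof (rule field_le_epsilon)
    fix e :: real assume e: "0 < e"
    define \<epsilon> where "\<epsilon> = e / (\<bar>g' \<bullet> g\<bar> + 1)"
    have \<epsilon>: "0 < \<epsilon>" using e by (simp add: \<epsilon>_def)
    have "g \<bullet> (u - \<epsilon> *\<^sub>R g) < 0" using u \<epsilon> g(2) by (simp add: inner_diff_right)
    from neg[OF this] have "g' \<bullet> u \<le> \<epsilon> * (g' \<bullet> g)" by (simp add: inner_diff_right)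
    also have "\<dots> \<le> \<epsilon> * (\<bar>g' \<bullet> g\<bar> + 1)" using \<epsilon> by (intro mult_left_mono) auto
    also have "\<dots> = e" by (simp add: \<epsilon>_def)
    finally show "g' \<bullet> u \<le> 0 + e" by simp
  qed
  define l where "l = (g' \<bullet> g) / (g \<bullet> g)"
  define u where "u = g' - l *\<^sub>R g"
  have gu: "g \<bullet> u = 0" using g(2) by (simp add: u_def l_def inner_diff_right inner_commute)
  have "g' \<bullet> u = 0" using le[OF gu] le[of "- u"] gu by simp
  then have "u \<bullet> u = 0" using gu by (simp add: u_def inner_diff_left)
  then have g': "g' = l *\<^sub>R g" by (simp add: u_def)
  show ?thesis
  proof (rule that)
    show "unit_normal \<Omega> x = (l / norm g') *\<^sub>R g" using w(5) g' by (simp add: divide_inverse_commute)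
    have "\<bar>l\<bar> * norm g = norm g'" by (simp add: g')
    then show "\<bar>l / norm g'\<bar> * norm g = 1" using w(4) by (simp add: abs_divide field_simps)
  qed
qed

lemma Xf_hvel: "m \<ge> 1 \<Longrightarrow> Xf (real m) p = hvel m (fst p) 1"
  using hfield_eq[of m 1 p 0] by (simp add: hvel_def one_complex.code)

lemma Yf_hvel: "m \<ge> 1 \<Longrightarrow> Yf (real m) p = hvel m (fst p) \<i>"
  using hfield_eq[of m 0 p 1] by (simp add: hvel_def imaginary_unit.code)

text \<open>By Cauchy-Schwarz: the weight is the length of the pair of products of the normal with X
  and Y, and a unit v is a unit combination of these two fields.\<close>

lemma wgt_ge:
  assumes m: "m \<ge> 1" and v: "cmod v = 1"
  shows "\<bar>unit_normal \<Omega> x \<bullet> hvel m (fst x) v\<bar> \<le> wgt m \<Omega> x"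
proof -
  let ?N = "unit_normal \<Omega> x"
  have "hvel m (fst x) v = Re v *\<^sub>R Xf (real m) x + Im v *\<^sub>R Yf (real m) x"
    by (simp add: hfield_eq[OF m] hvel_def)
  then have "?N \<bullet> hvel m (fst x) v = Re v * (?N \<bullet> Xf (real m) x) + Im v * (?N \<bullet> Yf (real m) x)"
    by (simp add: inner_add_right)
  also have "\<bar>\<dots>\<bar> \<le> sqrt ((Re v)\<^sup>2 + (Im v)\<^sup>2) * sqrt ((?N \<bullet> Xf (real m) x)\<^sup>2 + (?N \<bullet> Yf (real m) x)\<^sup>2)"
    using Cauchy_Schwarz_ineq2[of "Complex (Re v) (Im v)" "Complex (?N \<bullet> Xf (real m) x) (?N \<bullet> Yf (real m) x)"]
    by (simp add: inner_complex_def cmod_def)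
  also have "sqrt ((Re v)\<^sup>2 + (Im v)\<^sup>2) = 1" using v by (simp add: cmod_def)
  finally show ?thesis by (simp add: wgt_def)
qed

lemma wgt_le:
  assumes m: "m \<ge> 1" and sb: "smooth_boundary \<Omega>" "x \<in> frontier \<Omega>" and R: "cmod (fst x) \<le> R"
  shows "wgt m \<Omega> x \<le> 2 * (1 + R ^ (2*m+1))"
proof -
  have *: "\<bar>unit_normal \<Omega> x \<bullet> hvel m (fst x) v\<bar> \<le> 1 + R ^ (2*m+1)" if "cmod v = 1" for v
  proof -
    have "\<bar>unit_normal \<Omega> x \<bullet> hvel m (fst x) v\<bar> \<le> norm (hvel m (fst x) v)"
      using Cauchy_Schwarz_ineq2[of "unit_normal \<Omega> x" "hvel m (fst x) v"] norm_unit_normal[OF sb] by simp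
    also have "\<dots> \<le> 1 + R ^ (2*m+1)"
      using norm_pt_le[of "hvel m (fst x) v"] hslope_bound[OF R, of m v] that by (simp add: hvel_def)
    finally show ?thesis .
  qed
  have "wgt m \<Omega> x \<le> \<bar>unit_normal \<Omega> x \<bullet> Xf (real m) x\<bar> + \<bar>unit_normal \<Omega> x \<bullet> Yf (real m) x\<bar>"
    unfolding wgt_def by (rule sqrt_sum_squares_le_sum_abs)
  then show ?thesis using *[of 1] *[of \<i>] by (simp add: Xf_hvel[OF m] Yf_hvel[OF m])
qed

text \<open>The order of magnitude of |B(p, r)| / r, against which \<mu> is measured.\<close>

definition qsize :: "nat \<Rightarrow> pt \<Rightarrow> real \<Rightarrow> real" where
  "qsize m p r = r ^ 3 * (cmod (fst p) + r) ^ (2*m)"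

definition box_comparable :: "nat \<Rightarrow> pt set \<Rightarrow> pt \<Rightarrow> real \<Rightarrow> real \<Rightarrow> bool" where
  "box_comparable m \<Omega> p r C \<longleftrightarrow> ennreal (qsize m p r / C) \<le> mu (real m) \<Omega> (hbox m p r) \<and>
     mu (real m) \<Omega> (hbox m p r) \<le> ennreal (C * qsize m p r)"

lemma mvt_lower_bound:
  fixes f :: "real \<Rightarrow> real"
  assumes "a \<le> b" "\<And>x. a \<le> x \<Longrightarrow> x \<le> b \<Longrightarrow> (f has_real_derivative f' x) (at x)" "\<And>x. a \<le> x \<Longrightarrow> x \<le> b \<Longrightarrow> c \<le> f' x"
  shows "c * (b - a) \<le> f b - f a"
proof (cases "a = b")
  case False
  then have "a < b" using assms(1) by simp
  from MVT2[OF this assms(2)] obtain z where "a < z" "z < b" "f b - f a = (b - a) * f' z" by auto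
  then show ?thesis using assms(3)[of z] \<open>a < b\<close> by (simp add: mult.commute mult_right_mono)
qed simp

text \<open>A hypersurface piece \<open>{\<rho> = 0}\<close> transversal to the horizontal direction \<open>v\<close>: it meets every
  flow line in exactly one point, at a time that is a Lipschitz function of the line.\<close>

locale transversal =
  fixes m :: nat and \<Omega> :: "pt set" and p :: pt and v :: complex and \<rho> :: "pt \<Rightarrow> real" and G :: "pt \<Rightarrow> pt"
    and D :: "pt set" and \<kappa> B R d c0 c1 :: real
  assumes m: "m \<ge> 1" and v: "cmod v = 1" and \<kappa>: "0 < \<kappa>" and B: "0 < B" and R: "cmod (fst p) + 3 \<le> R"
    and d: "0 < d" "d \<le> 1" and D: "convex D"
    and in_D: "\<And>s y \<theta>. \<bar>s\<bar> \<le> d \<Longrightarrow> \<bar>y\<bar> \<le> d \<Longrightarrow> \<bar>\<theta>\<bar> \<le> d \<Longrightarrow> flowout m v p s y \<theta> \<in> D"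
    and deriv: "\<And>x. x \<in> D \<Longrightarrow> (\<rho> has_derivative (\<lambda>w. G x \<bullet> w)) (at x)"
    and trans: "\<And>x. x \<in> D \<Longrightarrow> \<kappa> \<le> G x \<bullet> hvel m (fst x) v"
    and bound: "\<And>x. x \<in> D \<Longrightarrow> norm (G x) \<le> B"
    and front: "\<And>x. x \<in> D \<Longrightarrow> x \<in> frontier \<Omega> \<longleftrightarrow> \<rho> x = 0"
    and wt: "\<And>x. x \<in> D \<Longrightarrow> x \<in> frontier \<Omega> \<Longrightarrow> c0 \<le> wgt m \<Omega> x \<and> wgt m \<Omega> x \<le> c1"
    and c0: "0 < c0" and c1: "0 < c1"
    and p: "p \<in> frontier \<Omega>"
begin

abbreviation "\<Phi> \<equiv> flowout m v p"

definition "K = flow_const m R"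
text \<open>Lipschitz constant of the crossing time: \<rho> changes at rate at most BK across the
  flow lines and at least \<kappa> along them.\<close>

definition "M1 = B * K / \<kappa>"
text \<open>For parameters of this size \<rho> starts within \<kappa> d of 0, so its sign change
  occurs within flow time d.\<close>

definition "d2 = d / (2 * (M1 + 1))"
definition "L = 2 * K * (M1 + 1)"

lemma R1: "1 \<le> R" using R norm_ge_zero[of "fst p"] by linarith

lemma K1: "1 \<le> K" unfolding K_def flow_const_def using R1 by simp

lemma M1: "0 < M1" unfolding M1_def using B K1 \<kappa> by simp

lemma d2: "0 < d2" "d2 \<le> d" "M1 * (2 * d2) \<le> d"
proof -
  show "0 < d2" unfolding d2_def using d M1 by simp
  show "d2 \<le> d" unfolding d2_def using d M1 by (simp add: field_simps)
  show "M1 * (2 * d2) \<le> d" unfolding d2_def using d M1 by (simp add: field_simps)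
qed

lemma L: "0 < L" "2 * K \<le> L" "K * (M1 + 1) \<le> L"
proof -
  have "K * (M1 + 1) > 0" using K1 M1 by simp
  then show "0 < L" "K * (M1 + 1) \<le> L" by (simp_all add: L_def)
  have "2 * K * 1 \<le> L" unfolding L_def using K1 M1 by (intro mult_left_mono) auto
  then show "2 * K \<le> L" by simp
qed

lemma \<rho>_lipschitz:
  assumes "x \<in> D" "y \<in> D"
  shows "\<bar>\<rho> x - \<rho> y\<bar> \<le> B * norm (x - y)"
proof -
  have "norm (\<rho> x - \<rho> y) \<le> B * norm (x - y)"
  proof (rule differentiable_bound[OF D])
    fix z assume z: "z \<in> D"
    show "(\<rho> has_derivative (\<lambda>w. G z \<bullet> w)) (at z within D)" using deriv[OF z] by (rule has_derivative_at_withinI)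
    have "\<bar>G z \<bullet> w\<bar> \<le> B * norm w" for w
      using Cauchy_Schwarz_ineq2[of "G z" w] mult_right_mono[OF bound[OF z], of "norm w"] by simp
    then show "onorm (\<lambda>w. G z \<bullet> w) \<le> B" using B by (intro onorm_bound) auto
  qed (use assms in auto)
  then show ?thesis by simp
qed

lemma \<rho>_increasing:
  assumes "\<bar>s\<bar> \<le> d" "\<bar>s'\<bar> \<le> d" "\<bar>y\<bar> \<le> d" "\<bar>\<theta>\<bar> \<le> d" "s \<le> s'"
  shows "\<kappa> * (s' - s) \<le> \<rho> (\<Phi> s' y \<theta>) - \<rho> (\<Phi> s y \<theta>)"
proof (rule mvt_lower_bound[OF assms(5)])
  fix u assume u: "s \<le> u" "u \<le> s'"
  then have inD: "\<Phi> u y \<theta> \<in> D" using assms by (intro in_D) auto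
  have "((\<lambda>u. \<rho> (\<Phi> u y \<theta>)) has_derivative (\<lambda>h. G (\<Phi> u y \<theta>) \<bullet> (h *\<^sub>R hvel m (fst (\<Phi> u y \<theta>)) v))) (at u)"
    by (rule has_derivative_compose[OF flowout_deriv[unfolded has_vector_derivative_def] deriv[OF inD]])
  then show "((\<lambda>u. \<rho> (\<Phi> u y \<theta>)) has_real_derivative G (\<Phi> u y \<theta>) \<bullet> hvel m (fst (\<Phi> u y \<theta>)) v) (at u)"
    by (simp add: has_field_derivative_def mult_commute_abs)
  show "\<kappa> \<le> G (\<Phi> u y \<theta>) \<bullet> hvel m (fst (\<Phi> u y \<theta>)) v" by (rule trans[OF inD])
qed

lemma \<rho>_expand:
  assumes "\<bar>s\<bar> \<le> d" "\<bar>s'\<bar> \<le> d" "\<bar>y\<bar> \<le> d" "\<bar>\<theta>\<bar> \<le> d"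
  shows "\<kappa> * \<bar>s' - s\<bar> \<le> \<bar>\<rho> (\<Phi> s' y \<theta>) - \<rho> (\<Phi> s y \<theta>)\<bar>"
  using \<rho>_increasing[of s s' y \<theta>] \<rho>_increasing[of s' s y \<theta>] assms by (cases "s \<le> s'") auto

lemma p_zero: "p \<in> D" "\<rho> p = 0"
proof -
  show "p \<in> D" using in_D[of 0 0 0] d by simp
  then show "\<rho> p = 0" using front p by simp
qed

lemma \<rho>_diff:
  assumes "\<bar>s\<bar> \<le> d" "\<bar>y\<bar> \<le> d" "\<bar>\<theta>\<bar> \<le> d" "\<bar>y'\<bar> \<le> d" "\<bar>\<theta>'\<bar> \<le> d"
  shows "\<bar>\<rho> (\<Phi> s y \<theta>) - \<rho> (\<Phi> s y' \<theta>')\<bar> \<le> \<kappa> * M1 * (\<bar>y - y'\<bar> + \<bar>\<theta> - \<theta>'\<bar>)"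
proof -
  have "\<bar>\<rho> (\<Phi> s y \<theta>) - \<rho> (\<Phi> s y' \<theta>')\<bar> \<le> B * norm (\<Phi> s y \<theta> - \<Phi> s y' \<theta>')"
    by (intro \<rho>_lipschitz in_D assms)
  also have "\<dots> \<le> B * (K * (\<bar>s - s\<bar> + \<bar>y - y'\<bar> + \<bar>\<theta> - \<theta>'\<bar>))"
    unfolding K_def using assms d B by (intro mult_left_mono flowout_lipschitz[OF m v R]) auto
  also have "\<dots> = \<kappa> * M1 * (\<bar>y - y'\<bar> + \<bar>\<theta> - \<theta>'\<bar>)" using \<kappa> by (simp add: M1_def)
  finally show ?thesis .
qed

definition "\<psi> y \<theta> = (SOME s. \<bar>s\<bar> \<le> d \<and> \<rho> (\<Phi> s y \<theta>) = 0)"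

text \<open>By the intermediate value theorem: flowing for time d in either direction changes \<rho>
  by at least \<kappa> d, which outweighs its value at time 0.\<close>

lemma crossing:
  assumes "\<bar>y\<bar> \<le> d2" "\<bar>\<theta>\<bar> \<le> d2"
  shows "\<bar>\<psi> y \<theta>\<bar> \<le> d" "\<rho> (\<Phi> (\<psi> y \<theta>) y \<theta>) = 0"
proof -
  have yd: "\<bar>y\<bar> \<le> d" "\<bar>\<theta>\<bar> \<le> d" using assms d2 by auto
  have "\<bar>\<rho> (\<Phi> 0 y \<theta>)\<bar> \<le> \<kappa> * M1 * (\<bar>y\<bar> + \<bar>\<theta>\<bar>)" using \<rho>_diff[of 0 y \<theta> 0 0] yd d p_zero by simp
  also have "\<dots> \<le> \<kappa> * M1 * (2 * d2)" using assms \<kappa> M1 by (intro mult_left_mono) auto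
  also have "\<dots> \<le> \<kappa> * d" using mult_left_mono[OF d2(3), of \<kappa>] \<kappa> by (simp add: mult.assoc)
  finally have 0: "\<bar>\<rho> (\<Phi> 0 y \<theta>)\<bar> \<le> \<kappa> * d" .
  have "\<kappa> * d \<le> \<rho> (\<Phi> d y \<theta>) - \<rho> (\<Phi> 0 y \<theta>)" using \<rho>_increasing[of 0 d y \<theta>] yd d by simp
  then have up: "0 \<le> \<rho> (\<Phi> d y \<theta>)" using 0 by linarith
  have "\<kappa> * d \<le> \<rho> (\<Phi> 0 y \<theta>) - \<rho> (\<Phi> (-d) y \<theta>)" using \<rho>_increasing[of "-d" 0 y \<theta>] yd d by simp
  then have lo: "\<rho> (\<Phi> (-d) y \<theta>) \<le> 0" using 0 by linarith
  have cont: "continuous_on {-d..d} (\<lambda>s. \<rho> (\<Phi> s y \<theta>))"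
  proof (rule continuous_on_compose2[of D \<rho>])
    show "continuous_on D \<rho>" using deriv by (meson continuous_at_imp_continuous_on has_derivative_continuous)
    show "continuous_on {-d..d} (\<lambda>s. \<Phi> s y \<theta>)"
      by (intro continuous_at_imp_continuous_on ballI has_vector_derivative_continuous[OF flowout_deriv])
    show "(\<lambda>s. \<Phi> s y \<theta>) ` {-d..d} \<subseteq> D" using yd by (auto intro!: in_D)
  qed
  obtain s where "-d \<le> s" "s \<le> d" "\<rho> (\<Phi> s y \<theta>) = 0"
    using IVT'[of "\<lambda>s. \<rho> (\<Phi> s y \<theta>)" "-d" 0 d, OF lo up _ cont] d by auto
  then have "\<exists>s. \<bar>s\<bar> \<le> d \<and> \<rho> (\<Phi> s y \<theta>) = 0" by (intro exI[of _ s]) auto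
  from someI_ex[OF this, folded \<psi>_def] show "\<bar>\<psi> y \<theta>\<bar> \<le> d" "\<rho> (\<Phi> (\<psi> y \<theta>) y \<theta>) = 0" by auto
qed

lemma crossing_unique:
  assumes "\<bar>y\<bar> \<le> d2" "\<bar>\<theta>\<bar> \<le> d2" "\<bar>s\<bar> \<le> d" "\<rho> (\<Phi> s y \<theta>) = 0"
  shows "s = \<psi> y \<theta>"
proof -
  have "\<kappa> * \<bar>s - \<psi> y \<theta>\<bar> \<le> \<bar>\<rho> (\<Phi> s y \<theta>) - \<rho> (\<Phi> (\<psi> y \<theta>) y \<theta>)\<bar>"
    by (rule \<rho>_expand) (use assms crossing[OF assms(1,2)] d2 in auto)
  then have "\<kappa> * \<bar>s - \<psi> y \<theta>\<bar> \<le> 0" using crossing[OF assms(1,2)] assms(4) by simp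
  then show ?thesis using \<kappa> by (simp add: mult_le_0_iff)
qed

text \<open>An implicit function estimate without derivatives of \<psi>. Both points are zeros of
  \<rho>, so the change of \<rho> along one flow line between the two times equals the change across
  flow lines at one time.\<close>

lemma \<psi>_lipschitz:
  assumes "\<bar>y\<bar> \<le> d2" "\<bar>\<theta>\<bar> \<le> d2" "\<bar>y'\<bar> \<le> d2" "\<bar>\<theta>'\<bar> \<le> d2"
  shows "\<bar>\<psi> y \<theta> - \<psi> y' \<theta>'\<bar> \<le> M1 * (\<bar>y - y'\<bar> + \<bar>\<theta> - \<theta>'\<bar>)"
proof -
  note c = crossing[OF assms(1,2)] crossing[OF assms(3,4)]
  have dd: "\<bar>y\<bar> \<le> d" "\<bar>\<theta>\<bar> \<le> d" "\<bar>y'\<bar> \<le> d" "\<bar>\<theta>'\<bar> \<le> d" using assms d2 by auto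
  have "\<kappa> * \<bar>\<psi> y \<theta> - \<psi> y' \<theta>'\<bar> \<le> \<bar>\<rho> (\<Phi> (\<psi> y \<theta>) y \<theta>) - \<rho> (\<Phi> (\<psi> y' \<theta>') y \<theta>)\<bar>"
    by (rule \<rho>_expand) (use c dd in auto)
  also have "\<dots> = \<bar>\<rho> (\<Phi> (\<psi> y' \<theta>') y \<theta>) - \<rho> (\<Phi> (\<psi> y' \<theta>') y' \<theta>')\<bar>" using c by simp
  also have "\<dots> \<le> \<kappa> * M1 * (\<bar>y - y'\<bar> + \<bar>\<theta> - \<theta>'\<bar>)" by (rule \<rho>_diff) (use c dd in auto)
  finally have "\<kappa> * \<bar>\<psi> y \<theta> - \<psi> y' \<theta>'\<bar> \<le> \<kappa> * (M1 * (\<bar>y - y'\<bar> + \<bar>\<theta> - \<theta>'\<bar>))" by (simp add: mult.assoc)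
  then show ?thesis using \<kappa> by simp
qed

text \<open>As p itself lies on the hypersurface, uniqueness of the crossing gives \<psi> 0 0 =
  0.\<close>

lemma \<psi>_small:
  assumes "\<bar>y\<bar> \<le> d2" "\<bar>\<theta>\<bar> \<le> d2"
  shows "\<bar>\<psi> y \<theta>\<bar> \<le> M1 * (\<bar>y\<bar> + \<bar>\<theta>\<bar>)"
proof -
  have "(0::real) = \<psi> 0 0" by (rule crossing_unique) (use d2 d p_zero in auto)
  then show ?thesis using \<psi>_lipschitz[OF assms, of 0 0] d2 by simp
qed

definition "F q = \<Phi> (\<psi> (fst q) (snd q)) (fst q) (snd q)"

lemma F_bilipschitz:
  assumes "a \<le> d2" "b \<le> d2" "q \<in> rect a b" "q' \<in> rect a b"
  shows "norm (F q - F q') \<le> L * (\<bar>fst q - fst q'\<bar> + \<bar>snd q - snd q'\<bar>)"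
    and "\<bar>fst q - fst q'\<bar> + \<bar>snd q - snd q'\<bar> \<le> L * norm (F q - F q')"
proof -
  have b: "\<bar>fst q\<bar> \<le> d2" "\<bar>snd q\<bar> \<le> d2" "\<bar>fst q'\<bar> \<le> d2" "\<bar>snd q'\<bar> \<le> d2" using assms by auto
  note c = crossing[OF b(1,2)] crossing[OF b(3,4)]
  let ?e = "\<bar>fst q - fst q'\<bar> + \<bar>snd q - snd q'\<bar>"
  have one: "\<bar>\<psi> (fst q) (snd q)\<bar> \<le> 1" "\<bar>\<psi> (fst q') (snd q')\<bar> \<le> 1" "\<bar>fst q\<bar> \<le> 1" "\<bar>fst q'\<bar> \<le> 1"
    using b c d d2 by auto
  have "norm (F q - F q') \<le> K * (\<bar>\<psi> (fst q) (snd q) - \<psi> (fst q') (snd q')\<bar> + \<bar>fst q - fst q'\<bar> + \<bar>snd q - snd q'\<bar>)"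
    unfolding F_def K_def by (rule flowout_lipschitz[OF m v R one])
  also have "\<dots> \<le> K * (M1 * ?e + ?e)"
    using \<psi>_lipschitz[OF b] K1 by (intro mult_left_mono) auto
  also have "\<dots> = (K * (M1 + 1)) * ?e" by (simp add: algebra_simps)
  also have "\<dots> \<le> L * ?e" using L by (intro mult_right_mono) auto
  finally show "norm (F q - F q') \<le> L * ?e" .
  have "?e \<le> 2 * K * norm (F q - F q')"
    unfolding F_def K_def by (rule flowout_inverse_lipschitz[OF m v R one])
  also have "\<dots> \<le> L * norm (F q - F q')" using L by (intro mult_right_mono) auto
  finally show "?e \<le> L * norm (F q - F q')" .
qed

lemma F_frontier:
  assumes "\<bar>y\<bar> \<le> d2" "\<bar>\<theta>\<bar> \<le> d2"
  shows "F (y, \<theta>) \<in> frontier \<Omega>" "F (y, \<theta>) \<in> D"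
proof -
  show D: "F (y, \<theta>) \<in> D" unfolding F_def fst_conv snd_conv using crossing[OF assms] assms d2 by (intro in_D) auto
  show "F (y, \<theta>) \<in> frontier \<Omega>" using crossing[OF assms] front[OF D] by (simp add: F_def)
qed

definition "A = (4 * real m + 2) * 4 ^ m"
definition "W = R ^ (2*m)"

lemma A: "1 \<le> A"
proof -
  have "1 * 1 \<le> A" unfolding A_def by (intro mult_mono) auto
  then show ?thesis by simp
qed

lemma W: "1 \<le> W" unfolding W_def using R1 by simp

lemma pow_le_W: "0 < r \<Longrightarrow> r \<le> 1 \<Longrightarrow> (cmod (fst p) + r) ^ (2*m) \<le> W"
  unfolding W_def using R by (intro power_mono) auto

text \<open>The boundary inside the box is covered by the chart over a rectangle with half sides r
  and T, and r T is of the order of \<open>qsize\<close>. The bound on r keeps both half sides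
  within the domain of the crossing time.\<close>

lemma mu_hbox_le:
  assumes r: "0 < r" "r \<le> d2 / ((1 + A) * W)"
  shows "mu (real m) \<Omega> (hbox m p r) \<le> ennreal (c1 * (9 * pi * L\<^sup>2 * (1 + A)) * qsize m p r)"
proof -
  let ?X = "(cmod (fst p) + r) ^ (2*m)"
  have AW: "1 * 1 \<le> (1 + A) * W" using A W by (intro mult_mono) auto
  have "d2 / ((1 + A) * W) \<le> d2 / 1" using AW d2 by (intro divide_left_mono) auto
  then have rd: "r \<le> d2" using r by simp
  then have r1: "r \<le> 1" using d2 d by simp
  have X: "0 < ?X" using r by (intro zero_less_power add_nonneg_pos) auto
  \<comment> \<open>The box allows height deviation r^2 (|z_p| + r)^(2m); passing to the coordinate
    \<theta> costs at most A times as much.\<close>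
  define T where "T = (1 + A) * (r\<^sup>2 * ?X)"
  have T: "0 < T" unfolding T_def using A r X by simp
  have "T \<le> (1 + A) * (r * 1 * W)"
    unfolding T_def power2_eq_square using pow_le_W[OF r(1) r1] r r1 A X by (intro mult_left_mono mult_mono) auto
  also have "\<dots> = r * ((1 + A) * W)" by simp
  also have "\<dots> \<le> d2" using r AW by (simp add: pos_le_divide_eq)
  finally have Td: "T \<le> d2" .
  have "mu (real m) \<Omega> (hbox m p r) \<le> ennreal (c1 * (9 * pi * L\<^sup>2 * r * T))"
  proof (rule mu_rect_le[where F=F])
    have sub: "x \<in> F ` rect r T \<and> x \<in> D" if x: "x \<in> hbox m p r \<inter> frontier \<Omega>" for x
    proof -
      obtain s y \<theta> where xx: "x = \<Phi> s y \<theta>" by (rule flowout_surj[OF v])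
      have "fst x - fst p = y *\<^sub>R (\<i> * v) + s *\<^sub>R v" by (simp add: xx flowout_def algebra_simps)
      then have "cmod (y *\<^sub>R (\<i> * v) + s *\<^sub>R v) < r" using x by (simp add: hbox_def)
      then have sy: "\<bar>s\<bar> \<le> r" "\<bar>y\<bar> \<le> r" using frame_bounds(1,2)[OF v, where s=s and y=y] by linarith+
      have "\<bar>snd x - snd p - hslope m (fst p) (fst x - fst p) - \<theta>\<bar> \<le> A * ?X * r\<^sup>2"
        unfolding xx A_def by (rule flowout_box[OF m v sy order_refl])
      moreover have "\<bar>snd x - snd p - hslope m (fst p) (fst x - fst p)\<bar> \<le> r\<^sup>2 * ?X" using x by (simp add: hbox_def)
      ultimately have "\<bar>\<theta>\<bar> \<le> r\<^sup>2 * ?X + A * ?X * r\<^sup>2" by linarith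
      then have \<theta>: "\<bar>\<theta>\<bar> \<le> T" by (simp add: T_def algebra_simps)
      have xD: "x \<in> D" unfolding xx using sy \<theta> rd Td d2 by (intro in_D) auto
      then have "\<rho> x = 0" using front x by simp
      then have "s = \<psi> y \<theta>" using crossing_unique[of y \<theta> s] sy \<theta> rd Td d2 xx by auto
      then have "x = F (y, \<theta>)" by (simp add: F_def xx)
      moreover have "(y, \<theta>) \<in> rect r T" using sy \<theta> by auto
      ultimately show ?thesis using xD by blast
    qed
    then show "hbox m p r \<inter> frontier \<Omega> \<subseteq> F ` rect r T" by blast
    show "wgt m \<Omega> x \<le> c1" if "x \<in> hbox m p r \<inter> frontier \<Omega>" for x using wt[of x] sub[OF that] that by blast
  qed (use r T c1 L F_bilipschitz(1)[OF rd Td] in auto)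
  also have "c1 * (9 * pi * L\<^sup>2 * r * T) = c1 * (9 * pi * L\<^sup>2 * (1 + A)) * qsize m p r"
    by (simp add: T_def qsize_def power2_eq_square power3_eq_cube)
  finally show ?thesis .
qed

text \<open>On the rectangle with half sides e r and e r^2 (|z_p| + r)^(2m) the planar displacement
  is at most e (M1 (1 + W) + 1) r. The denominator makes this at most r/4 and A times the square of
  its ratio to r at most 1/4.\<close>

definition "e = 1 / (4 * (1 + A) * (M1 * (1 + W) + 1)\<^sup>2)"

lemma e: "0 < e" "e \<le> 1/4" "e * (M1 * (1 + W) + 1) \<le> 1/4" "A * (e * (M1 * (1 + W) + 1))\<^sup>2 \<le> 1/4"
proof -
  define n where "n = M1 * (1 + W) + 1"
  have n: "1 \<le> n" using M1 W by (simp add: n_def)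
  have en: "e = 1 / (4 * (1 + A) * n\<^sup>2)" by (simp add: e_def n_def)
  have nn: "1 \<le> n\<^sup>2" "n \<le> n\<^sup>2" using one_le_power[OF n, of 2] self_le_power[OF n, of 2] by auto
  have pos: "0 < 4 * (1 + A) * n\<^sup>2" using A nn by (intro mult_pos_pos) auto
  show e0: "0 < e" unfolding en using pos by simp
  have An: "e * ((1 + A) * n\<^sup>2) = 1/4" unfolding en using A n by simp
  have "e * 1 \<le> e * ((1 + A) * n\<^sup>2)" using A nn e0 mult_mono[of 1 "1 + A" 1 "n\<^sup>2"] by (intro mult_left_mono) auto
  then show "e \<le> 1/4" using An by simp
  have "e * (1 * n) \<le> e * ((1 + A) * n\<^sup>2)" using A nn n e0 by (intro mult_left_mono mult_mono) auto
  then have en4: "e * n \<le> 1/4" using An by simp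
  then show "e * (M1 * (1 + W) + 1) \<le> 1/4" by (simp add: n_def)
  have "A * (e * n)\<^sup>2 = (e * (A * n\<^sup>2)) * e" by (simp add: power2_eq_square)
  also have "\<dots> \<le> (e * ((1 + A) * n\<^sup>2)) * 1"
    using A nn e0 \<open>e \<le> 1/4\<close> by (intro mult_mono mult_left_mono mult_right_mono) auto
  finally show "A * (e * (M1 * (1 + W) + 1))\<^sup>2 \<le> 1/4" using An by (simp add: n_def)
qed

lemma mu_hbox_ge:
  assumes r: "0 < r" "r \<le> d2 / ((1 + A) * W)"
  shows "ennreal (c0 * (pi * e\<^sup>2 / (4 * L\<^sup>2)) * qsize m p r) \<le> mu (real m) \<Omega> (hbox m p r)"
proof -
  let ?X = "(cmod (fst p) + r) ^ (2*m)"
  have AW: "1 * 1 \<le> (1 + A) * W" using A W by (intro mult_mono) auto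
  have "d2 / ((1 + A) * W) \<le> d2 / 1" using AW d2 by (intro divide_left_mono) auto
  then have rd: "r \<le> d2" using r by simp
  then have r1: "r \<le> 1" using d2 d by simp
  have X: "0 < ?X" using r by (intro zero_less_power add_nonneg_pos) auto
  have XW: "?X \<le> W" by (rule pow_le_W[OF r(1) r1])
  define a where "a = e * r"
  define b where "b = e * (r\<^sup>2 * ?X)"
  have ab: "0 < a" "0 < b" using e r X by (auto simp: a_def b_def)
  have "r\<^sup>2 * ?X \<le> (r * 1) * W" unfolding power2_eq_square using r r1 XW X by (intro mult_mono) auto
  \<comment> \<open>The crossing time depends on \<theta> as well as on y, so \<theta> must also be
    controlled linearly in r; this uses r <= 1.\<close>
  then have bW: "b \<le> e * r * W" unfolding b_def using e mult_left_mono[of "r\<^sup>2 * ?X" "r * W" e] by (simp add: mult.assoc)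
  have "e * r \<le> 1 * r" using e r by (intro mult_right_mono) auto
  then have ad: "a \<le> d2" using rd by (simp add: a_def)
  have "e * r * W \<le> 1 * r * ((1 + A) * W)" using e r A W by (intro mult_mono) auto
  also have "\<dots> \<le> d2" using r AW by (simp add: pos_le_divide_eq)
  finally have bd: "b \<le> d2" using bW by simp
  have box: "F q \<in> hbox m p r" if q: "q \<in> rect a b" for q
  proof -
    obtain y \<theta> where qq: "q = (y, \<theta>)" by force
    have y: "\<bar>y\<bar> \<le> a" "\<bar>\<theta>\<bar> \<le> b" using q by (auto simp: qq)
    define s where "s = \<psi> y \<theta>"
    have "\<bar>s\<bar> \<le> M1 * (\<bar>y\<bar> + \<bar>\<theta>\<bar>)" unfolding s_def by (rule \<psi>_small) (use y ad bd in auto)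
    also have "\<dots> \<le> M1 * (e * r + e * r * W)" using y bW M1 by (intro mult_left_mono) (auto simp: a_def)
    also have "\<dots> = M1 * (1 + W) * (e * r)" by (simp add: algebra_simps)
    finally have s: "\<bar>s\<bar> \<le> M1 * (1 + W) * (e * r)" .
    define h where "h = e * (M1 * (1 + W) + 1) * r"
    have hh: "h = M1 * (1 + W) * (e * r) + e * r" by (simp add: h_def algebra_simps)
    have er: "0 < e * r" using e r by simp
    have sh: "\<bar>s\<bar> \<le> h" "\<bar>y\<bar> \<le> h" "\<bar>s\<bar> + \<bar>y\<bar> \<le> h"
    proof -
      have "0 \<le> M1 * (1 + W) * (e * r)" using M1 W er by simp
      then show "\<bar>s\<bar> \<le> h" "\<bar>y\<bar> \<le> h" "\<bar>s\<bar> + \<bar>y\<bar> \<le> h" using s y(1) er unfolding hh a_def by linarith+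
    qed
    have "h \<le> 1/4 * r" unfolding h_def using e(3) r by (intro mult_right_mono) auto
    then have hr: "h < r" "h \<le> r" using r by auto
    have Fq: "F q = \<Phi> s y \<theta>" by (simp add: F_def qq s_def)
    have "fst (F q) - fst p = y *\<^sub>R (\<i> * v) + s *\<^sub>R v" by (simp add: Fq flowout_def algebra_simps)
    then have 1: "cmod (fst (F q) - fst p) < r" using frame_bounds(3)[OF v, of y s] sh(3) hr by simp
    have "\<bar>snd (F q) - snd p - hslope m (fst p) (fst (F q) - fst p) - \<theta>\<bar> \<le> A * ?X * h\<^sup>2"
      unfolding Fq A_def by (rule flowout_box[OF m v sh(1,2) hr(2)])
    also have "A * ?X * h\<^sup>2 = (A * (e * (M1 * (1 + W) + 1))\<^sup>2) * (r\<^sup>2 * ?X)" by (simp add: h_def power_mult_distrib)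
    also have "\<dots> \<le> 1/4 * (r\<^sup>2 * ?X)" using e(4) X by (intro mult_right_mono) auto
    finally have 2: "\<bar>snd (F q) - snd p - hslope m (fst p) (fst (F q) - fst p) - \<theta>\<bar> \<le> 1/4 * (r\<^sup>2 * ?X)" .
    have "\<bar>\<theta>\<bar> \<le> 1/4 * (r\<^sup>2 * ?X)" using y(2) mult_right_mono[OF e(2), of "r\<^sup>2 * ?X"] X by (simp add: b_def)
    moreover have "0 < r\<^sup>2 * ?X" using r X by simp
    ultimately have "\<bar>snd (F q) - snd p - hslope m (fst p) (fst (F q) - fst p)\<bar> < r\<^sup>2 * ?X" using 2 by linarith
    with 1 show ?thesis by (simp add: hbox_def)
  qed
  have "ennreal (c0 * (pi * a * b / (4 * L\<^sup>2))) \<le> mu (real m) \<Omega> (hbox m p r)"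
  proof (rule mu_rect_ge[where F=F])
    have fr: "F q \<in> frontier \<Omega> \<and> F q \<in> D" if "q \<in> rect a b" for q
      using F_frontier[of "fst q" "snd q"] that ad bd by auto
    then show "F ` rect a b \<subseteq> hbox m p r \<inter> frontier \<Omega>" using box by blast
    show "c0 \<le> wgt m \<Omega> x" if "x \<in> F ` rect a b" for x using fr wt that by blast
  qed (use ab c0 L F_bilipschitz[OF ad bd] in auto)
  also have "c0 * (pi * a * b / (4 * L\<^sup>2)) = c0 * (pi * e\<^sup>2 / (4 * L\<^sup>2)) * qsize m p r"
    by (simp add: a_def b_def qsize_def power2_eq_square power3_eq_cube)
  finally show ?thesis .
qed

text \<open>Here and in \<open>cnst\<close> only m, \<kappa>, B, R, d, c0 and c1 enter, not p, so
  that one choice serves a whole neighbourhood.\<close>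

definition "radius = d2 / ((1 + A) * W)"
definition "cnst = max (c1 * (9 * pi * L\<^sup>2 * (1 + A))) (1 / (c0 * (pi * e\<^sup>2 / (4 * L\<^sup>2))))"

lemma radius_pos: "0 < radius"
proof -
  have "0 < (1 + A) * W" using A W by (intro mult_pos_pos) auto
  then show ?thesis unfolding radius_def using d2 by simp
qed

lemma cnst_pos: "0 < cnst"
proof -
  have "0 < c0 * (pi * e\<^sup>2 / (4 * L\<^sup>2))" using c0 e L by simp
  then have "0 < 1 / (c0 * (pi * e\<^sup>2 / (4 * L\<^sup>2)))" by (simp only: zero_less_divide_1_iff)
  then show ?thesis unfolding cnst_def less_max_iff_disj by (rule disjI2)
qed

lemma comparable:
  assumes r: "0 < r" "r \<le> radius"
  shows "box_comparable m \<Omega> p r cnst"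
  unfolding box_comparable_def
proof
  define k where "k = c0 * (pi * e\<^sup>2 / (4 * L\<^sup>2))"
  have q: "0 \<le> qsize m p r" using r by (simp add: qsize_def)
  have k: "0 < k" unfolding k_def using c0 e L by simp
  have "1 / k \<le> cnst" unfolding cnst_def k_def by (rule max.cobounded2)
  then have "1 / cnst \<le> k" using k cnst_pos by (simp add: field_simps)
  then have "qsize m p r / cnst \<le> k * qsize m p r" using mult_right_mono[OF _ q, of "1 / cnst" k] by simp
  then show "ennreal (qsize m p r / cnst) \<le> mu (real m) \<Omega> (hbox m p r)"
    using mu_hbox_ge[OF r[unfolded radius_def], folded k_def] by (meson ennreal_leI order_trans)
  have "c1 * (9 * pi * L\<^sup>2 * (1 + A)) * qsize m p r \<le> cnst * qsize m p r"
    using q by (intro mult_right_mono) (auto simp: cnst_def)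
  then show "mu (real m) \<Omega> (hbox m p r) \<le> ennreal (cnst * qsize m p r)"
    using mu_hbox_le[OF r[unfolded radius_def]] by (meson ennreal_leI order_trans)
qed

end

lemma hvel_uminus: "hvel m z (- w) = - hvel m z w"
  by (simp add: hvel_def hslope_minus)

lemma continuous_hvel: "continuous_on S (\<lambda>x. hvel m (fst x) v)"
  unfolding hvel_def hslope_def
  by (intro continuous_intros continuous_on_compose2[OF continuous_twist[of UNIV]]) auto

text \<open>Transversality to some unit horizontal direction holds at p0 and, by continuity, with
  fixed constants in a ball around it. The locale then applies to all boundary points of a smaller
  ball with the same parameters.\<close>

lemma noncharacteristic_comparable:
  assumes m: "m \<ge> 1" and dom: "bounded_smooth_domain \<Omega>" and p0: "p0 \<in> frontier \<Omega>"
    and nc: "\<not> characteristic (real m) \<Omega> p0"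
  shows "\<exists>\<epsilon>>0. \<exists>r0>0. \<exists>C>0. \<forall>p\<in>frontier \<Omega> \<inter> ball p0 \<epsilon>. \<forall>r. 0 < r \<and> r \<le> r0 \<longrightarrow> box_comparable m \<Omega> p r C"
proof -
  have sb: "smooth_boundary \<Omega>" and op: "open \<Omega>" using dom by (auto simp: bounded_smooth_domain_def)
  obtain U \<rho> g where w: "p0 \<in> U" "defining_fn \<Omega> U \<rho>" "(\<rho> has_derivative (\<lambda>v. g \<bullet> v)) (at p0)" "g \<noteq> 0"
    "unit_normal \<Omega> p0 = g /\<^sub>R norm g" by (rule unit_normal_witness[OF sb p0])
  obtain G where G: "\<And>x. x \<in> U \<Longrightarrow> (\<rho> has_derivative (\<lambda>v. G x \<bullet> v)) (at x)" "continuous_on U G" "\<And>x. x \<in> U \<Longrightarrow> G x \<noteq> 0"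
    using defining_fn_gradient[OF w(2)] by blast
  have U: "open U" using w(2) by (simp add: defining_fn_def)
  have "(\<lambda>v. G p0 \<bullet> v) = (\<lambda>v. g \<bullet> v)" using has_derivative_unique[OF G(1)[OF w(1)] w(3)] .
  from fun_cong[OF this, of "G p0 - g"] have "(G p0 - g) \<bullet> (G p0 - g) = 0" by (simp add: inner_diff_left)
  then have Gg: "G p0 = g" by simp
  have "\<exists>u. cmod u = 1 \<and> g \<bullet> hvel m (fst p0) u \<noteq> 0"
  proof (cases "unit_normal \<Omega> p0 \<bullet> Xf m p0 = 0")
    case True
    then have "unit_normal \<Omega> p0 \<bullet> Yf m p0 \<noteq> 0" using nc p0 by (auto simp: characteristic_def)
    then show ?thesis using w(4,5) by (intro exI[of _ \<i>]) (auto simp: Yf_hvel[OF m])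
  next
    case False
    then show ?thesis using w(4,5) by (intro exI[of _ 1]) (auto simp: Xf_hvel[OF m])
  qed
  then obtain u where u: "cmod u = 1" "g \<bullet> hvel m (fst p0) u \<noteq> 0" by blast
  define v where "v = (if g \<bullet> hvel m (fst p0) u > 0 then u else - u)"
  have v: "cmod v = 1" "0 < g \<bullet> hvel m (fst p0) v" using u by (auto simp: v_def hvel_uminus)
  define \<kappa> where "\<kappa> = (g \<bullet> hvel m (fst p0) v) / 2"
  define B where "B = norm g + 1"
  have \<kappa>: "0 < \<kappa>" "\<kappa> < G p0 \<bullet> hvel m (fst p0) v" using v by (auto simp: \<kappa>_def Gg)
  have B: "0 < B" "norm (G p0) < B" by (auto simp: B_def Gg add_nonneg_pos)
  have "continuous_on U (\<lambda>x. G x \<bullet> hvel m (fst x) v)" by (intro continuous_intros G(2) continuous_hvel)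
  then have "open ((\<lambda>x. G x \<bullet> hvel m (fst x) v) -` {\<kappa><..} \<inter> U)"
    using continuous_on_open_vimage[OF U] open_greaterThan by blast
  moreover have "(\<lambda>x. G x \<bullet> hvel m (fst x) v) -` {\<kappa><..} \<inter> U = {x \<in> U. \<kappa> < G x \<bullet> hvel m (fst x) v}" by auto
  ultimately have "open {x \<in> U. \<kappa> < G x \<bullet> hvel m (fst x) v}" by simp
  moreover have "open {x \<in> U. norm (G x) < B}"
  proof -
    have "open ((\<lambda>x. norm (G x)) -` {..<B} \<inter> U)"
      using continuous_on_open_vimage[OF U] continuous_on_norm[OF G(2)] open_lessThan by blast
    moreover have "(\<lambda>x. norm (G x)) -` {..<B} \<inter> U = {x \<in> U. norm (G x) < B}" by auto
    ultimately show ?thesis by simp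
  qed
  ultimately have "open ({x \<in> U. \<kappa> < G x \<bullet> hvel m (fst x) v} \<inter> {x \<in> U. norm (G x) < B})" (is "open ?S") by (rule open_Int)
  moreover have "p0 \<in> ?S" using w(1) \<kappa> B by simp
  ultimately have "\<exists>\<eta>0>0. cball p0 \<eta>0 \<subseteq> ?S" unfolding open_contains_cball by (rule bspec)
  then obtain \<eta>0 where \<eta>0: "0 < \<eta>0" "cball p0 \<eta>0 \<subseteq> ?S" by blast
  define \<eta> where "\<eta> = min 1 \<eta>0"
  define D where "D = cball p0 \<eta>"
  have \<eta>: "0 < \<eta>" "\<eta> \<le> 1" using \<eta>0 by (auto simp: \<eta>_def)
  have "D \<subseteq> cball p0 \<eta>0" unfolding D_def \<eta>_def by auto
  then have DD: "\<And>x. x \<in> D \<Longrightarrow> x \<in> U \<and> \<kappa> < G x \<bullet> hvel m (fst x) v \<and> norm (G x) < B" using \<eta>0(2) by blast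
  define R where "R = cmod (fst p0) + 4"
  have nearR: "cmod (fst x) \<le> cmod (fst p0) + 1" if "x \<in> D" for x
  proof -
    have "cmod (fst x - fst p0) \<le> 1" using that \<eta> norm_fst_pt_le[of "x - p0"] by (simp add: D_def dist_norm norm_minus_commute)
    then show ?thesis using norm_triangle_sub[of "fst x" "fst p0"] by simp
  qed
  define K where "K = flow_const m R"
  have "1 \<le> R" using norm_ge_zero[of "fst p0"] unfolding R_def by linarith
  then have K: "1 \<le> K" unfolding K_def flow_const_def by simp
  \<comment> \<open>Three coordinates of size at most d move the flow by at most 3Kd <= \<eta>/2,
    which keeps it inside \<open>D\<close> from any p in the half ball.\<close>
  define d where "d = \<eta> / (8 * K)"
  have d: "0 < d" "d \<le> 1" "K * (3 * d) \<le> \<eta> / 2"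
  proof -
    show "0 < d" using \<eta> K by (simp add: d_def)
    have "d \<le> \<eta> / 1" unfolding d_def using \<eta> K by (intro divide_left_mono) auto
    then show "d \<le> 1" using \<eta> by simp
    show "K * (3 * d) \<le> \<eta> / 2" using \<eta> K by (simp add: d_def)
  qed
  \<comment> \<open>The normal is k times the gradient with |k| >= 1/B, and the gradient has product
    at least \<kappa> with the direction v.\<close>
  define c0 where "c0 = \<kappa> / B"
  define c1 where "c1 = 2 * (1 + R ^ (2*m+1))"
  have T: "transversal m \<Omega> p v \<rho> G D \<kappa> B R d c0 c1" if p: "p \<in> frontier \<Omega> \<inter> ball p0 (\<eta>/2)" for p
  proof
    have pD: "p \<in> D" using p \<eta> by (auto simp: D_def)
    show Rp: "cmod (fst p) + 3 \<le> R" using nearR[OF pD] by (simp add: R_def)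
    show "convex D" by (simp add: D_def)
    show "flowout m v p s y \<theta> \<in> D" if st: "\<bar>s\<bar> \<le> d" "\<bar>y\<bar> \<le> d" "\<bar>\<theta>\<bar> \<le> d" for s y \<theta>
    proof -
      have "norm (flowout m v p s y \<theta> - flowout m v p 0 0 0) \<le> K * (\<bar>s - 0\<bar> + \<bar>y - 0\<bar> + \<bar>\<theta> - 0\<bar>)"
        unfolding K_def by (rule flowout_lipschitz[OF m v(1) Rp]) (use st d in auto)
      also have "\<dots> \<le> K * (3 * d)" using st K by (intro mult_left_mono) auto
      also have "\<dots> \<le> \<eta> / 2" by (rule d(3))
      finally have "dist p (flowout m v p s y \<theta>) \<le> \<eta> / 2" by (simp add: dist_norm norm_minus_commute)
      moreover have "dist p0 p < \<eta> / 2" using p by auto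
      ultimately show ?thesis using dist_triangle[of p0 "flowout m v p s y \<theta>" p] by (simp add: D_def)
    qed
    show "x \<in> frontier \<Omega> \<longleftrightarrow> \<rho> x = 0" if "x \<in> D" for x
      using defining_fn_frontier[OF op w(2) _ G(1,3)] DD[OF that] by blast
    show "c0 \<le> wgt m \<Omega> x \<and> wgt m \<Omega> x \<le> c1" if x: "x \<in> D" "x \<in> frontier \<Omega>" for x
    proof
      have xU: "x \<in> U" using DD[OF x(1)] by blast
      obtain k where k: "unit_normal \<Omega> x = k *\<^sub>R G x" "\<bar>k\<bar> * norm (G x) = 1"
        by (rule unit_normal_parallel[OF sb op x(2) xU w(2) G(1)[OF xU] G(3)[OF xU]])
      have "1 \<le> \<bar>k\<bar> * B" unfolding k(2)[symmetric] using DD[OF x(1)] by (intro mult_left_mono) auto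
      then have "c0 \<le> \<bar>k\<bar> * \<kappa>" using mult_left_mono[of 1 "\<bar>k\<bar> * B" \<kappa>] \<kappa> B by (simp add: c0_def field_simps)
      also have "\<dots> \<le> \<bar>k\<bar> * \<bar>G x \<bullet> hvel m (fst x) v\<bar>" using DD[OF x(1)] by (intro mult_left_mono) auto
      also have "\<dots> = \<bar>unit_normal \<Omega> x \<bullet> hvel m (fst x) v\<bar>" by (simp add: k(1) abs_mult)
      also have "\<dots> \<le> wgt m \<Omega> x" by (rule wgt_ge[OF m v(1)])
      finally show "c0 \<le> wgt m \<Omega> x" .
      show "wgt m \<Omega> x \<le> c1" unfolding c1_def by (rule wgt_le[OF m sb x(2)]) (use nearR[OF x(1)] in \<open>simp add: R_def\<close>)
    qed
    show "\<kappa> \<le> G x \<bullet> hvel m (fst x) v" "norm (G x) \<le> B" if "x \<in> D" for x using DD[OF that] by auto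
    show "(\<rho> has_derivative (\<lambda>w. G x \<bullet> w)) (at x)" if "x \<in> D" for x using DD[OF that] G(1) by blast
    show "0 < c0" using \<kappa> B by (simp add: c0_def)
    show "0 < c1" using \<open>1 \<le> R\<close> by (simp add: c1_def add_pos_nonneg)
  qed (use m v \<kappa> B d p in auto)
  have p0b: "p0 \<in> frontier \<Omega> \<inter> ball p0 (\<eta>/2)" using p0 \<eta> by simp
  let ?r = "transversal.radius m \<kappa> B R d" and ?C = "transversal.cnst m \<kappa> B R c0 c1"
  have "0 < ?r" "0 < ?C" using transversal.radius_pos[OF T[OF p0b]] transversal.cnst_pos[OF T[OF p0b]] by auto
  moreover have "0 < \<eta> / 2" using \<eta> by simp
  moreover have "\<forall>p\<in>frontier \<Omega> \<inter> ball p0 (\<eta>/2). \<forall>r. 0 < r \<and> r \<le> ?r \<longrightarrow> box_comparable m \<Omega> p r ?C"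
    using transversal.comparable[OF T] by blast
  ultimately show ?thesis by blast
qed

section \<open>Boundary pieces that are graphs over the horizontal plane\<close>

text \<open>In the frame X, Y this is, up to sign, the horizontal part of the normal vector (-grad
  \<phi>, 1); it vanishes exactly where the graph is characteristic.\<close>

definition tilt :: "nat \<Rightarrow> (complex \<Rightarrow> complex) \<Rightarrow> complex \<Rightarrow> complex" where
  "tilt m g z = g z + \<i> * twist m z"

text \<open>Along horizontal curves \<open>\<phi> - t\<close> changes at the rate \<open>tilt m g z \<bullet> w\<close>, where \<open>g\<close> is the gradient
  of \<open>\<phi>\<close>.\<close>

lemma tilt_inner: "tilt m g z \<bullet> w = g z \<bullet> w - hslope m z w"
  by (simp add: tilt_def hslope_def inner_complex_def algebra_simps)

lemma hpath_graph_change: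
  assumes hp: "hpath m K L P Q"
    and d: "\<And>z. z \<in> K \<Longrightarrow> (\<phi> has_derivative (\<lambda>w. g z \<bullet> w)) (at z)"
    and \<sigma>: "\<And>z. z \<in> K \<Longrightarrow> cmod (tilt m g z) \<le> \<sigma>"
  shows "\<bar>(\<phi> (fst Q) - snd Q) - (\<phi> (fst P) - snd P)\<bar> \<le> \<sigma> * L"
proof -
  from hp obtain \<gamma> w where \<gamma>: "\<gamma> 0 = P" "\<gamma> 1 = Q" and
    h: "\<forall>s\<in>{0..1}. (\<gamma> has_vector_derivative hvel m (fst (\<gamma> s)) (w s)) (at s within {0..1}) \<and> cmod (w s) \<le> L \<and> fst (\<gamma> s) \<in> K"
    unfolding hpath_def by blast
  have "norm ((\<lambda>s. \<phi> (fst (\<gamma> s)) - snd (\<gamma> s)) 1 - (\<lambda>s. \<phi> (fst (\<gamma> s)) - snd (\<gamma> s)) 0) \<le> \<sigma> * L * norm (1 - 0 :: real)"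
  proof (rule differentiable_bound[of "{0..1}" _ "\<lambda>s u. u * (tilt m g (fst (\<gamma> s)) \<bullet> w s)"])
    fix s :: real assume s: "s \<in> {0..1}"
    have dg: "(\<gamma> has_derivative (\<lambda>u. u *\<^sub>R hvel m (fst (\<gamma> s)) (w s))) (at s within {0..1})"
      using h s by (simp add: has_vector_derivative_def)
    have "((\<lambda>s. fst (\<gamma> s)) has_derivative (\<lambda>u. u *\<^sub>R w s)) (at s within {0..1})"
      using has_derivative_fst[OF dg] by (simp add: hvel_def)
    moreover have "(\<phi> has_derivative (\<lambda>w. g (fst (\<gamma> s)) \<bullet> w)) (at (fst (\<gamma> s)))" using d h s by blast
    ultimately have 1: "((\<lambda>s. \<phi> (fst (\<gamma> s))) has_derivative (\<lambda>u. g (fst (\<gamma> s)) \<bullet> (u *\<^sub>R w s))) (at s within {0..1})"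
      by (rule has_derivative_compose)
    have 2: "((\<lambda>s. snd (\<gamma> s)) has_derivative (\<lambda>u. u * hslope m (fst (\<gamma> s)) (w s))) (at s within {0..1})"
      using has_derivative_snd[OF dg] by (simp add: hvel_def)
    show "((\<lambda>s. \<phi> (fst (\<gamma> s)) - snd (\<gamma> s)) has_derivative (\<lambda>u. u * (tilt m g (fst (\<gamma> s)) \<bullet> w s))) (at s within {0..1})"
      using has_derivative_diff[OF 1 2] by (simp add: tilt_inner right_diff_distrib)
    have \<sigma>0: "0 \<le> \<sigma>" using \<sigma> h s norm_ge_zero order_trans by blast
    have "\<bar>tilt m g (fst (\<gamma> s)) \<bullet> w s\<bar> \<le> cmod (tilt m g (fst (\<gamma> s))) * cmod (w s)" by (rule Cauchy_Schwarz_ineq2)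
    also have "\<dots> \<le> \<sigma> * L" using \<sigma> h s \<sigma>0 by (intro mult_mono) auto
    finally have "\<bar>tilt m g (fst (\<gamma> s)) \<bullet> w s\<bar> \<le> \<sigma> * L" .
    then have "norm (u * (tilt m g (fst (\<gamma> s)) \<bullet> w s)) \<le> \<sigma> * L * norm u" for u :: real
      using mult_left_mono[of "\<bar>tilt m g (fst (\<gamma> s)) \<bullet> w s\<bar>" "\<sigma> * L" "\<bar>u\<bar>"] by (simp add: abs_mult mult.commute)
    then show "onorm (\<lambda>u. u * (tilt m g (fst (\<gamma> s)) \<bullet> w s)) \<le> \<sigma> * L"
      using \<open>\<bar>tilt m g (fst (\<gamma> s)) \<bullet> w s\<bar> \<le> \<sigma> * L\<close> by (intro onorm_bound) auto
  qed auto
  then show ?thesis using \<gamma> by simp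
qed

text \<open>Around the polar loop \<open>\<phi>\<close> returns to its value while the lift climbs by \<open>h\<^sup>2 (|z| + h)^(2m)\<close>, so
  \<open>tilt\<close> cannot be small along the whole loop. This replaces an integration of
  \<open>curl tilt = (2m + 2) |z|^(2m)\<close>.\<close>

lemma tilt_large_somewhere:
  assumes m: "m \<ge> 1" and h: "0 < h"
    and d: "\<And>y. y \<in> cball z (2*h) \<Longrightarrow> (\<phi> has_derivative (\<lambda>w. g y \<bullet> w)) (at y)"
  shows "\<exists>y\<in>cball z (2*h). h * (cmod z + h) ^ (2*m) / 8 < cmod (tilt m g y)"
proof (rule ccontr)
  let ?X = "(cmod z + h) ^ (2*m)"
  assume "\<not> ?thesis"
  then have \<sigma>: "\<And>y. y \<in> cball z (2*h) \<Longrightarrow> cmod (tilt m g y) \<le> h * ?X / 8" by (meson not_le)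
  have X: "0 < ?X" using h by (intro zero_less_power add_nonneg_pos) auto
  have "\<bar>h\<^sup>2 * ?X\<bar> \<le> h\<^sup>2 * ?X" using X by simp
  from polar_loop[OF m h this, of 0] obtain p1 p2 p3 where
    p: "hpath m (cball z (2*h)) h (z, 0) p1" "hpath m (cball z (2*h)) h p1 p2"
    "hpath m (cball z (2*h)) h p2 p3" "hpath m (cball z (2*h)) h p3 (z, 0 + h\<^sup>2 * ?X)" by blast
  \<comment> \<open>Each of the four legs changes the difference between graph and height by at most
    S, while the loop climbs by T. With the factor 1/8 the sum 4S is only T/2.\<close>
  define S T where "S = h * ?X / 8 * h" and "T = h\<^sup>2 * ?X"
  note c = p[THEN hpath_graph_change, OF d \<sigma>, folded S_def T_def, unfolded fst_conv snd_conv]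
  have "T \<le> 4 * S" using c by linarith
  then have "h\<^sup>2 * ?X \<le> 4 * (h * ?X / 8 * h)" by (simp only: S_def T_def)
  also have "\<dots> = h\<^sup>2 * ?X / 2" by (simp add: power2_eq_square)
  finally show False using h X by simp
qed

text \<open>The Lipschitz bounds are required at every radius r <= \<delta> with the weight (|z_p| +
  r)^(2m) of that radius; near the axis this is much smaller than the weight at radius
  \<delta>.\<close>

locale graph_piece =
  fixes m :: nat and \<Omega> :: "pt set" and p :: pt and \<phi> :: "complex \<Rightarrow> real" and g :: "complex \<Rightarrow> complex"
    and \<delta> \<Lambda> b :: real
  assumes m: "m \<ge> 1" and p: "snd p = \<phi> (fst p)" and \<delta>: "0 < \<delta>" and \<Lambda>: "1 \<le> \<Lambda>" and b: "0 \<le> b"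
    and deriv: "\<And>z. z \<in> cball (fst p) \<delta> \<Longrightarrow> (\<phi> has_derivative (\<lambda>w. g z \<bullet> w)) (at z)"
    and g_bound: "\<And>z. z \<in> cball (fst p) \<delta> \<Longrightarrow> cmod (g z) \<le> b"
    and g_lip: "\<And>r z w. r \<le> \<delta> \<Longrightarrow> z \<in> cball (fst p) r \<Longrightarrow> w \<in> cball (fst p) r \<Longrightarrow>
        cmod (g z - g w) \<le> \<Lambda> * (cmod (fst p) + r) ^ (2*m) * cmod (z - w)"
    and tilt_lip: "\<And>r z w. r \<le> \<delta> \<Longrightarrow> z \<in> cball (fst p) r \<Longrightarrow> w \<in> cball (fst p) r \<Longrightarrow>
        cmod (tilt m g z - tilt m g w) \<le> \<Lambda> * (cmod (fst p) + r) ^ (2*m) * cmod (z - w)"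
    and graph: "\<And>z. z \<in> cball (fst p) \<delta> \<Longrightarrow> (z, \<phi> z) \<in> frontier \<Omega>"
    and weight: "\<And>z. z \<in> cball (fst p) \<delta> \<Longrightarrow> cmod (tilt m g z) / (1 + b) \<le> wgt m \<Omega> (z, \<phi> z) \<and> wgt m \<Omega> (z, \<phi> z) \<le> cmod (tilt m g z)"
begin

definition "L = 2 * (1 + b)"

lemma L: "0 < L" "2 \<le> L" "1 + b \<le> L" using b by (auto simp: L_def)

lemma \<phi>_lipschitz:
  assumes "z \<in> cball (fst p) \<delta>" "w \<in> cball (fst p) \<delta>"
  shows "\<bar>\<phi> z - \<phi> w\<bar> \<le> b * cmod (z - w)"
proof -
  have "norm (\<phi> z - \<phi> w) \<le> b * norm (z - w)"
  proof (rule differentiable_bound[of "cball (fst p) \<delta>"])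
    fix y assume y: "y \<in> cball (fst p) \<delta>"
    show "(\<phi> has_derivative (\<lambda>w. g y \<bullet> w)) (at y within cball (fst p) \<delta>)" using deriv[OF y] by (rule has_derivative_at_withinI)
    have "\<bar>g y \<bullet> w\<bar> \<le> b * norm w" for w
      using Cauchy_Schwarz_ineq2[of "g y" w] mult_right_mono[OF g_bound[OF y], of "norm w"] by simp
    then show "onorm (\<lambda>w. g y \<bullet> w) \<le> b" using b by (intro onorm_bound) auto
  qed (use assms in auto)
  then show ?thesis by simp
qed

definition "dev z = \<phi> z - \<phi> (fst p) - hslope m (fst p) (z - fst p)"

text \<open>To first order, the deviation tested by the box is the product with the tilt at the
  centre. The remainder is the Taylor remainder of \<phi>, since the drift is linear.\<close>

lemma taylor:
  assumes r: "r \<le> \<delta>" and z: "z \<in> cball (fst p) r"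
  shows "\<bar>dev z - tilt m g (fst p) \<bullet> (z - fst p)\<bar> \<le> \<Lambda> * (cmod (fst p) + r) ^ (2*m) * (cmod (z - fst p))\<^sup>2"
proof -
  define h where "h = cmod (z - fst p)"
  have h: "0 \<le> h" "h \<le> r" using z by (auto simp: h_def dist_norm norm_minus_commute)
  define M where "M = \<Lambda> * (cmod (fst p) + r) ^ (2*m)"
  have r0: "0 \<le> r" using h by linarith
  have M: "0 \<le> M" unfolding M_def using \<Lambda> r0 by simp
  \<comment> \<open>Subtracting the linear part leaves a function whose gradient is an increment of
    g, hence O(h) on the ball of radius h.\<close>
  have "norm ((\<lambda>y. \<phi> y - g (fst p) \<bullet> y) z - (\<lambda>y. \<phi> y - g (fst p) \<bullet> y) (fst p)) \<le> (M * h) * norm (z - fst p)"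
  proof (rule differentiable_bound[of "cball (fst p) h" _ "\<lambda>y w. g y \<bullet> w - g (fst p) \<bullet> w"])
    fix y assume y: "y \<in> cball (fst p) h"
    have yr: "y \<in> cball (fst p) r" "y \<in> cball (fst p) \<delta>" using y h r by auto
    show "((\<lambda>y. \<phi> y - g (fst p) \<bullet> y) has_derivative (\<lambda>w. g y \<bullet> w - g (fst p) \<bullet> w)) (at y within cball (fst p) h)"
      by (intro has_derivative_diff has_derivative_at_withinI[OF deriv[OF yr(2)]] has_derivative_inner_right has_derivative_ident)
    have "cmod (g y - g (fst p)) \<le> M * cmod (y - fst p)" unfolding M_def using g_lip[OF r yr(1)] r0 by simp
    also have "\<dots> \<le> M * h" using M y by (intro mult_left_mono) (auto simp: dist_norm norm_minus_commute)
    finally have "cmod (g y - g (fst p)) \<le> M * h" .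
    then have "\<bar>g y \<bullet> w - g (fst p) \<bullet> w\<bar> \<le> M * h * cmod w" for w
      using Cauchy_Schwarz_ineq2[of "g y - g (fst p)" w] mult_right_mono[of "cmod (g y - g (fst p))" "M * h" "cmod w"] by (simp add: inner_diff_left)
    then show "onorm (\<lambda>w. g y \<bullet> w - g (fst p) \<bullet> w) \<le> M * h" using M h by (intro onorm_bound) auto
  qed (auto simp: h(1) h_def dist_norm norm_minus_commute)
  moreover have "(\<lambda>y. \<phi> y - g (fst p) \<bullet> y) z - (\<lambda>y. \<phi> y - g (fst p) \<bullet> y) (fst p) = dev z - tilt m g (fst p) \<bullet> (z - fst p)"
    by (simp add: dev_def tilt_inner inner_diff_right hslope_diff)
  ultimately have "\<bar>dev z - tilt m g (fst p) \<bullet> (z - fst p)\<bar> \<le> (M * h) * cmod (z - fst p)" by simp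
  then show ?thesis by (simp add: M_def h_def power2_eq_square mult.assoc)
qed

lemma hbox_iff: "(z, \<phi> z) \<in> hbox m p r \<longleftrightarrow> cmod (z - fst p) < r \<and> \<bar>dev z\<bar> < r\<^sup>2 * (cmod (fst p) + r) ^ (2*m)"
  by (simp add: hbox_def dev_def p)

text \<open>Orthonormal planar coordinates about z1, lifted to the graph. In the strip case the
  first coordinate runs along the tilt, the direction in which the strip is thin.\<close>

definition "chart z1 \<zeta> q = (let z = z1 + snd q *\<^sub>R (\<i> * \<zeta>) + fst q *\<^sub>R \<zeta> in (z, \<phi> z))"

lemma chart_diff: "fst (chart z1 \<zeta> q) - fst (chart z1 \<zeta> q') = (snd q - snd q') *\<^sub>R (\<i> * \<zeta>) + (fst q - fst q') *\<^sub>R \<zeta>"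
  by (simp add: chart_def Let_def algebra_simps)

lemma chart_bilipschitz:
  assumes \<zeta>: "cmod \<zeta> = 1" and c: "fst (chart z1 \<zeta> q) \<in> cball (fst p) \<delta>" "fst (chart z1 \<zeta> q') \<in> cball (fst p) \<delta>"
  shows "norm (chart z1 \<zeta> q - chart z1 \<zeta> q') \<le> L * (\<bar>fst q - fst q'\<bar> + \<bar>snd q - snd q'\<bar>)"
    and "\<bar>fst q - fst q'\<bar> + \<bar>snd q - snd q'\<bar> \<le> L * norm (chart z1 \<zeta> q - chart z1 \<zeta> q')"
proof -
  let ?D = "chart z1 \<zeta> q - chart z1 \<zeta> q'" and ?e = "\<bar>fst q - fst q'\<bar> + \<bar>snd q - snd q'\<bar>"
  note fb = frame_bounds[OF \<zeta>, where y="snd q - snd q'" and s="fst q - fst q'", folded chart_diff[of z1 \<zeta> q q']]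
  have s: "snd (chart z1 \<zeta> x) = \<phi> (fst (chart z1 \<zeta> x))" for x by (simp add: chart_def Let_def)
  have "norm ?D \<le> cmod (fst (chart z1 \<zeta> q) - fst (chart z1 \<zeta> q')) + b * cmod (fst (chart z1 \<zeta> q) - fst (chart z1 \<zeta> q'))"
    using norm_pt_le[of ?D] \<phi>_lipschitz[OF c] by (simp add: s)
  also have "\<dots> = (1 + b) * cmod (fst (chart z1 \<zeta> q) - fst (chart z1 \<zeta> q'))" by (simp add: algebra_simps)
  also have "\<dots> \<le> L * ?e" using fb(3) L b by (intro mult_mono) auto
  finally show "norm ?D \<le> L * ?e" .
  have "cmod (fst (chart z1 \<zeta> q) - fst (chart z1 \<zeta> q')) \<le> norm ?D" using norm_fst_pt_le[of ?D] by simp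
  then have "?e \<le> 2 * norm ?D" using fb(1,2) by linarith
  also have "\<dots> \<le> L * norm ?D" using L by (intro mult_right_mono) auto
  finally show "?e \<le> L * norm ?D" .
qed

lemma chart_in_ball:
  assumes "cmod \<zeta> = 1" "q \<in> rect h k" "cmod (z1 - fst p) + h + k \<le> s"
  shows "fst (chart z1 \<zeta> q) \<in> cball (fst p) s"
proof -
  have eq: "fst (chart z1 \<zeta> q) - fst p = (z1 - fst p) + (snd q *\<^sub>R (\<i> * \<zeta>) + fst q *\<^sub>R \<zeta>)"
    by (simp add: chart_def Let_def)
  have "cmod (fst (chart z1 \<zeta> q) - fst p) \<le> cmod (z1 - fst p) + (\<bar>fst q\<bar> + \<bar>snd q\<bar>)"
    unfolding eq using norm_triangle_ineq[of "z1 - fst p" "snd q *\<^sub>R (\<i> * \<zeta>) + fst q *\<^sub>R \<zeta>"] frame_bounds(3)[OF assms(1), of "snd q" "fst q"]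
    by linarith
  also have "\<dots> \<le> s"
  proof -
    have "\<bar>fst q\<bar> \<le> h" "\<bar>snd q\<bar> \<le> k" using assms(2) by auto
    then show ?thesis using assms(3) by linarith
  qed
  finally show ?thesis by (simp add: dist_norm norm_minus_commute)
qed

lemma chart_eq: "chart z1 \<zeta> q = (fst (chart z1 \<zeta> q), \<phi> (fst (chart z1 \<zeta> q)))"
  by (simp add: chart_def Let_def)

text \<open>With f the size of the tilt at the centre, the box meets the graph in a strip of width
  of order min (r, T/f), so the product of width and density stays of order T. The hypothesis on the
  box keeps other sheets of the boundary out of it.\<close>

lemma mu_hbox_le:
  assumes r: "0 < r" "2 * r \<le> \<delta>" and hb: "\<And>x. x \<in> hbox m p r \<inter> frontier \<Omega> \<Longrightarrow> snd x = \<phi> (fst x)"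
  shows "mu (real m) \<Omega> (hbox m p r) \<le> ennreal (9 * pi * L\<^sup>2 * (1 + 2 * \<Lambda>) * qsize m p r)"
proof -
  let ?X = "(cmod (fst p) + r) ^ (2*m)"
  have X: "0 < ?X" using r by (intro zero_less_power add_nonneg_pos) auto
  have rd: "r \<le> \<delta>" using r by linarith
  define f where "f = cmod (tilt m g (fst p))"
  define \<zeta> where "\<zeta> = (if f = 0 then 1 else tilt m g (fst p) /\<^sub>R f)"
  have \<zeta>: "cmod \<zeta> = 1" "tilt m g (fst p) = f *\<^sub>R \<zeta>" by (auto simp: \<zeta>_def f_def)
  have f0: "0 \<le> f" by (simp add: f_def)
  define T where "T = (1 + \<Lambda>) * (r\<^sup>2 * ?X)"
  have T: "0 < T" unfolding T_def using \<Lambda> r X by simp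
  \<comment> \<open>Half width of the strip f |a| <= T inside |a| <= r; the case distinction also
    covers f = 0.\<close>
  define h where "h = (if f * r \<le> T then r else T / f)"
  have h: "0 < h" "h \<le> r" "f * h \<le> T" "\<And>a. \<bar>a\<bar> \<le> r \<Longrightarrow> f * \<bar>a\<bar> \<le> T \<Longrightarrow> \<bar>a\<bar> \<le> h"
  proof -
    have fp: "f * r > T \<Longrightarrow> 0 < f" using T r f0 by (cases "f = 0") auto
    show "0 < h" "h \<le> r" "f * h \<le> T" using r T f0 fp by (auto simp: h_def field_simps not_le)
    show "\<bar>a\<bar> \<le> h" if "\<bar>a\<bar> \<le> r" "f * \<bar>a\<bar> \<le> T" for a using that fp by (auto simp: h_def field_simps not_le)
  qed
  define c where "c = f + \<Lambda> * ?X * r"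
  have c: "0 \<le> c" unfolding c_def using f0 \<Lambda> X r by simp
  have inball: "fst (chart (fst p) \<zeta> q) \<in> cball (fst p) \<delta>" if "q \<in> rect h r" for q
    by (rule chart_in_ball[OF \<zeta>(1) that]) (use h r in simp)
  have "mu (real m) \<Omega> (hbox m p r) \<le> ennreal (c * (9 * pi * L\<^sup>2 * h * r))"
  proof (rule mu_rect_le[where F="chart (fst p) \<zeta>"])
    show "norm (chart (fst p) \<zeta> q - chart (fst p) \<zeta> q') \<le> L * (\<bar>fst q - fst q'\<bar> + \<bar>snd q - snd q'\<bar>)"
      if "q \<in> rect h r" "q' \<in> rect h r" for q q'
      by (rule chart_bilipschitz(1)[OF \<zeta>(1) inball[OF that(1)] inball[OF that(2)]])
    show "hbox m p r \<inter> frontier \<Omega> \<subseteq> chart (fst p) \<zeta> ` rect h r"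
    proof
      fix x assume x: "x \<in> hbox m p r \<inter> frontier \<Omega>"
      define z where "z = fst x"
      have xz: "x = (z, \<phi> z)" using hb[OF x] by (simp add: z_def prod_eq_iff)
      then have zz: "cmod (z - fst p) < r" "\<bar>dev z\<bar> < r\<^sup>2 * ?X" using x hbox_iff by auto
      define u where "u = (z - fst p) * cnj \<zeta>"
      have "u * \<zeta> = (z - fst p) * (\<zeta> * cnj \<zeta>)" by (simp add: u_def)
      also have "\<zeta> * cnj \<zeta> = 1" using \<zeta>(1) by (simp add: complex_norm_square[symmetric])
      finally have "u * \<zeta> = z - fst p" by simp
      moreover have "u * \<zeta> = Im u *\<^sub>R (\<i> * \<zeta>) + Re u *\<^sub>R \<zeta>" by (simp add: complex_eq_iff algebra_simps)
      ultimately have zu: "z - fst p = Im u *\<^sub>R (\<i> * \<zeta>) + Re u *\<^sub>R \<zeta>" by simp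
      have ub: "\<bar>Re u\<bar> \<le> r" "\<bar>Im u\<bar> \<le> r"
        using frame_bounds(1,2)[OF \<zeta>(1), where y="Im u" and s="Re u"] zz(1) zu by auto
      have "\<zeta> \<bullet> \<zeta> = 1" using \<zeta>(1) by (simp add: dot_square_norm)
      moreover have "\<zeta> \<bullet> (\<i> * \<zeta>) = 0" by (simp add: inner_complex_def)
      ultimately have "tilt m g (fst p) \<bullet> (z - fst p) = f * Re u" by (simp add: \<zeta>(2) zu inner_add_right)
      then have "f * \<bar>Re u\<bar> = \<bar>tilt m g (fst p) \<bullet> (z - fst p)\<bar>" using f0 by (simp add: abs_mult)
      also have "\<dots> \<le> \<bar>dev z\<bar> + \<Lambda> * ?X * (cmod (z - fst p))\<^sup>2"
      proof -
        have "z \<in> cball (fst p) r" using zz(1) by (simp add: dist_norm norm_minus_commute)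
        from taylor[OF rd this] show ?thesis by linarith
      qed
      also have "\<dots> \<le> r\<^sup>2 * ?X + \<Lambda> * ?X * r\<^sup>2"
        using zz \<Lambda> X by (intro add_mono mult_left_mono power_mono) auto
      also have "\<dots> = T" by (simp add: T_def algebra_simps)
      finally have "\<bar>Re u\<bar> \<le> h" by (rule h(4)[OF ub(1)])
      then have "(Re u, Im u) \<in> rect h r" using ub by (auto simp: abs_le_iff)
      moreover have "x = chart (fst p) \<zeta> (Re u, Im u)"
      proof -
        have "fst p + Im u *\<^sub>R (\<i> * \<zeta>) + Re u *\<^sub>R \<zeta> = z" using zu by (simp add: algebra_simps)
        then show ?thesis by (simp add: chart_def Let_def xz)
      qed
      ultimately show "x \<in> chart (fst p) \<zeta> ` rect h r" by blast
    qed
    show "wgt m \<Omega> x \<le> c" if x: "x \<in> hbox m p r \<inter> frontier \<Omega>" for x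
    proof -
      define z where "z = fst x"
      have xz: "x = (z, \<phi> z)" using hb[OF x] by (simp add: z_def prod_eq_iff)
      then have zz: "cmod (z - fst p) < r" using x hbox_iff by auto
      then have zb: "z \<in> cball (fst p) r" "z \<in> cball (fst p) \<delta>" using rd by (auto simp: dist_norm norm_minus_commute)
      have "cmod (tilt m g z) \<le> f + cmod (tilt m g z - tilt m g (fst p))" unfolding f_def using norm_triangle_sub[of "tilt m g z" "tilt m g (fst p)"] by simp
      also have "\<dots> \<le> f + \<Lambda> * ?X * cmod (z - fst p)" using tilt_lip[OF rd zb(1), of "fst p"] r by simp
      also have "\<dots> \<le> c" unfolding c_def using zz \<Lambda> X by (intro add_left_mono mult_left_mono) auto
      finally show ?thesis using weight[OF zb(2)] xz by auto
    qed
  qed (use h r c L in auto)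
  also have "\<dots> \<le> ennreal (9 * pi * L\<^sup>2 * (1 + 2 * \<Lambda>) * qsize m p r)"
  proof (rule ennreal_leI)
    have "c * h = f * h + \<Lambda> * ?X * r * h" by (simp add: c_def algebra_simps)
    also have "\<dots> \<le> T + \<Lambda> * ?X * r * r" using h \<Lambda> X r by (intro add_mono mult_left_mono) auto
    also have "\<dots> = (1 + 2 * \<Lambda>) * (r\<^sup>2 * ?X)" by (simp add: T_def power2_eq_square algebra_simps)
    finally have "9 * pi * L\<^sup>2 * r * (c * h) \<le> 9 * pi * L\<^sup>2 * r * ((1 + 2 * \<Lambda>) * (r\<^sup>2 * ?X))" using r by (intro mult_left_mono) auto
    moreover have "c * (9 * pi * L\<^sup>2 * h * r) = 9 * pi * L\<^sup>2 * r * (c * h)" by simp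
    moreover have "9 * pi * L\<^sup>2 * (1 + 2 * \<Lambda>) * qsize m p r = 9 * pi * L\<^sup>2 * r * ((1 + 2 * \<Lambda>) * (r\<^sup>2 * ?X))"
      by (simp add: qsize_def power2_eq_square power3_eq_cube)
    ultimately show "c * (9 * pi * L\<^sup>2 * h * r) \<le> 9 * pi * L\<^sup>2 * (1 + 2 * \<Lambda>) * qsize m p r" by (simp only:)
  qed
  finally show ?thesis .
qed

text \<open>Common frame of both cases of the lower bound: a rectangle that stays in the box and on
  which the tilt is bounded below. Its centre z1 need not be the centre of the box.\<close>

lemma lower_rect:
  assumes \<zeta>: "cmod \<zeta> = 1" and hk: "0 < h" "0 < k" and r: "0 < r" "r \<le> \<delta>" and z1: "cmod (z1 - fst p) + h + k < r"
    and dv: "\<And>q. q \<in> rect h k \<Longrightarrow> \<bar>dev (fst (chart z1 \<zeta> q))\<bar> < r\<^sup>2 * (cmod (fst p) + r) ^ (2*m)"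
    and c: "0 \<le> c" and tl: "\<And>q. q \<in> rect h k \<Longrightarrow> c \<le> cmod (tilt m g (fst (chart z1 \<zeta> q)))"
  shows "ennreal (c / (1 + b) * (pi * h * k / (4 * L\<^sup>2))) \<le> mu (real m) \<Omega> (hbox m p r)"
proof (rule mu_rect_ge[where F="chart z1 \<zeta>"])
  have inb: "fst (chart z1 \<zeta> q) \<in> cball (fst p) (cmod (z1 - fst p) + h + k)" if "q \<in> rect h k" for q
    by (rule chart_in_ball[OF \<zeta> that]) simp
  have inb2: "fst (chart z1 \<zeta> q) \<in> cball (fst p) \<delta>" if "q \<in> rect h k" for q
    using inb[OF that] z1 r by auto
  show "norm (chart z1 \<zeta> q - chart z1 \<zeta> q') \<le> L * (\<bar>fst q - fst q'\<bar> + \<bar>snd q - snd q'\<bar>)"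
    "\<bar>fst q - fst q'\<bar> + \<bar>snd q - snd q'\<bar> \<le> L * norm (chart z1 \<zeta> q - chart z1 \<zeta> q')"
    if "q \<in> rect h k" "q' \<in> rect h k" for q q'
    using chart_bilipschitz[OF \<zeta> inb2[OF that(1)] inb2[OF that(2)]] by auto
  show "chart z1 \<zeta> ` rect h k \<subseteq> hbox m p r \<inter> frontier \<Omega>"
  proof
    fix x assume "x \<in> chart z1 \<zeta> ` rect h k"
    then obtain q where q: "x = chart z1 \<zeta> q" "q \<in> rect h k" by blast
    let ?z = "fst (chart z1 \<zeta> q)"
    have "cmod (?z - fst p) < r" using inb[OF q(2)] z1 by (simp add: dist_norm norm_minus_commute)
    then have "(?z, \<phi> ?z) \<in> hbox m p r" using dv[OF q(2)] hbox_iff by blast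
    moreover have "(?z, \<phi> ?z) \<in> frontier \<Omega>" by (rule graph[OF inb2[OF q(2)]])
    ultimately show "x \<in> hbox m p r \<inter> frontier \<Omega>" using q(1) chart_eq[of z1 \<zeta> q] by simp
  qed
  show "c / (1 + b) \<le> wgt m \<Omega> x" if "x \<in> chart z1 \<zeta> ` rect h k" for x
  proof -
    from that obtain q where q: "x = chart z1 \<zeta> q" "q \<in> rect h k" by blast
    let ?z = "fst (chart z1 \<zeta> q)"
    have "c / (1 + b) \<le> cmod (tilt m g ?z) / (1 + b)" using tl[OF q(2)] b by (intro divide_right_mono) auto
    also have "\<dots> \<le> wgt m \<Omega> (?z, \<phi> ?z)" using weight[OF inb2[OF q(2)]] by blast
    finally show ?thesis using q(1) chart_eq[of z1 \<zeta> q] by simp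
  qed
qed (use hk L c b in auto)

text \<open>Makes \<Lambda> e = 1/16, so that over planar displacements of up to 4er the quadratic
  Taylor error is at most e r^2 (|z_p| + r)^(2m).\<close>

definition "e = 1 / (16 * \<Lambda>)"
text \<open>Loop radius er gives one factor e, the loss in the weight gives e^(2m), and 1/8 comes
  from \<open>tilt_large_somewhere\<close>.\<close>

definition "\<kappa> = e ^ (2*m+1) / 8"
text \<open>The minimum compares density times area, relative to \<open>qsize\<close>, in the two
  cases of \<open>mu_hbox_ge\<close>; the remaining factors are those of
  \<open>lower_rect\<close>.\<close>

definition "lower_const = min (e\<^sup>2 / 2) (\<kappa> / 2 * (\<kappa> / (4 * \<Lambda>))\<^sup>2) / (1 + b) * pi / (4 * L\<^sup>2)"

lemma e: "0 < e" "e \<le> 1/16" "\<Lambda> * e = 1/16"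
  using \<Lambda> by (auto simp: e_def field_simps)

lemma \<kappa>: "0 < \<kappa>" "\<kappa> \<le> e"
proof -
  show "0 < \<kappa>" using e by (simp add: \<kappa>_def)
  have "e ^ (2*m) \<le> 1" using e by (intro power_le_one) auto
  then have "e * e ^ (2*m) \<le> e * 1" using e by (intro mult_left_mono) auto
  then show "\<kappa> \<le> e" using e by (simp add: \<kappa>_def)
qed

text \<open>If the tilt at the centre is at least r (|z_p| + r)^(2m), it varies by at most a
  fraction of itself over distance 2er, and a rectangle across the strip is used. If it is smaller,
  the whole disc of radius 4er lies below the box height, so a square can be placed wherever the
  tilt is large.\<close>

lemma mu_hbox_ge:
  assumes r: "0 < r" "r \<le> \<delta>"
  shows "ennreal (lower_const * qsize m p r) \<le> mu (real m) \<Omega> (hbox m p r)"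
proof -
  let ?X = "(cmod (fst p) + r) ^ (2*m)"
  have X: "0 < ?X" using r by (intro zero_less_power add_nonneg_pos) auto
  define Y where "Y = r\<^sup>2 * ?X"
  have Y: "0 < Y" unfolding Y_def using r X by simp
  define f where "f = cmod (tilt m g (fst p))"
  have f0: "0 \<le> f" by (simp add: f_def)
  have er: "0 < e * r" "e * r \<le> r / 16" using e r mult_right_mono[OF e(2), of r] by auto
  have dev_le: "\<bar>dev z\<bar> \<le> \<bar>tilt m g (fst p) \<bullet> (z - fst p)\<bar> + \<Lambda> * ?X * a\<^sup>2"
    if "cmod (z - fst p) \<le> a" "a \<le> r" for z a
  proof -
    have "\<bar>dev z - tilt m g (fst p) \<bullet> (z - fst p)\<bar> \<le> \<Lambda> * ?X * (cmod (z - fst p))\<^sup>2"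
      by (rule taylor[OF r(2)]) (use that in \<open>simp add: dist_norm norm_minus_commute\<close>)
    also have "\<dots> \<le> \<Lambda> * ?X * a\<^sup>2" using that \<Lambda> X by (intro mult_left_mono power_mono) auto
    finally show ?thesis by linarith
  qed
  have qs: "qsize m p r = r * Y" by (simp add: qsize_def Y_def power2_eq_square power3_eq_cube)
  have final: "ennreal (lower_const * qsize m p r) \<le> ennreal (c / (1 + b) * (pi * h * k / (4 * L\<^sup>2)))"
    if "min (e\<^sup>2 / 2) (\<kappa> / 2 * (\<kappa> / (4 * \<Lambda>))\<^sup>2) * (r * Y) \<le> c * (h * k)" for c h k
  proof (rule ennreal_leI)
    have "lower_const * qsize m p r = min (e\<^sup>2 / 2) (\<kappa> / 2 * (\<kappa> / (4 * \<Lambda>))\<^sup>2) * (r * Y) * (pi / ((1 + b) * (4 * L\<^sup>2)))"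
      by (simp add: lower_const_def qs)
    also have "\<dots> \<le> c * (h * k) * (pi / ((1 + b) * (4 * L\<^sup>2)))"
      using that b by (intro mult_right_mono) auto
    also have "\<dots> = c / (1 + b) * (pi * h * k / (4 * L\<^sup>2))" by simp
    finally show "lower_const * qsize m p r \<le> c / (1 + b) * (pi * h * k / (4 * L\<^sup>2))" .
  qed
  show ?thesis
  proof (cases "r * ?X \<le> f")
    case True
    have fpos: "0 < f" using True r X by (meson less_le_trans mult_pos_pos)
    define \<zeta> where "\<zeta> = tilt m g (fst p) /\<^sub>R f"
    have \<zeta>: "cmod \<zeta> = 1" "tilt m g (fst p) = f *\<^sub>R \<zeta>" using fpos by (auto simp: \<zeta>_def f_def)
    \<comment> \<open>Chosen so that the linear part of the deviation, at most f h, is a fraction e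
      of the box height Y.\<close>
    define h where "h = e * Y / f"
    have h: "0 < h" "f * h = e * Y" using e Y fpos by (auto simp: h_def)
    have "Y \<le> f * r" using mult_right_mono[OF True, of r] r by (simp add: Y_def power2_eq_square ac_simps)
    then have "Y / f \<le> r" using fpos by (simp add: field_simps)
    then have her: "h \<le> e * r" unfolding h_def using e mult_left_mono[of "Y / f" r e] by simp
    have zz: "fst (chart (fst p) \<zeta> q) - fst p = snd q *\<^sub>R (\<i> * \<zeta>) + fst q *\<^sub>R \<zeta>" for q by (simp add: chart_def Let_def)
    have nn: "cmod (fst (chart (fst p) \<zeta> q) - fst p) \<le> 2 * (e * r)" if q: "q \<in> rect h (e * r)" for q
      unfolding zz using frame_bounds(3)[OF \<zeta>(1), of "snd q" "fst q"] her q by (auto simp: abs_le_iff)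
    have "ennreal (f / 2 / (1 + b) * (pi * h * (e * r) / (4 * L\<^sup>2))) \<le> mu (real m) \<Omega> (hbox m p r)"
    proof (rule lower_rect[OF \<zeta>(1) h(1) er(1) r])
      show "cmod (fst p - fst p) + h + e * r < r" unfolding diff_self norm_zero using her er r(1) by linarith
      fix q assume q: "q \<in> rect h (e * r)"
      let ?z = "fst (chart (fst p) \<zeta> q)"
      have "\<zeta> \<bullet> \<zeta> = 1" using \<zeta>(1) by (simp add: dot_square_norm)
      moreover have "\<zeta> \<bullet> (\<i> * \<zeta>) = 0" by (simp add: inner_complex_def)
      ultimately have "tilt m g (fst p) \<bullet> (?z - fst p) = f * fst q" unfolding zz by (simp add: \<zeta>(2) inner_add_right)
      then have "\<bar>tilt m g (fst p) \<bullet> (?z - fst p)\<bar> = f * \<bar>fst q\<bar>" using f0 by (simp add: abs_mult)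
      also have "\<dots> \<le> f * h" using q f0 by (intro mult_left_mono) auto
      finally have 1: "\<bar>tilt m g (fst p) \<bullet> (?z - fst p)\<bar> \<le> e * Y" using h by simp
      have "\<bar>dev ?z\<bar> \<le> e * Y + \<Lambda> * ?X * (2 * (e * r))\<^sup>2"
        using dev_le[OF nn[OF q]] 1 er r by simp
      also have "\<Lambda> * ?X * (2 * (e * r))\<^sup>2 = 4 * (\<Lambda> * e) * e * Y" by (simp add: Y_def power2_eq_square)
      also have "e * Y + 4 * (\<Lambda> * e) * e * Y = 5/4 * (e * Y)" unfolding e(3) by simp
      also have "\<dots> < Y" using mult_right_mono[OF e(2), of Y] Y by simp
      finally show "\<bar>dev ?z\<bar> < r\<^sup>2 * ?X" by (simp add: Y_def)
      have "cmod (tilt m g (fst p) - tilt m g ?z) \<le> \<Lambda> * ?X * cmod (fst p - ?z)"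
      proof (rule tilt_lip[OF r(2)])
        have "2 * (e * r) \<le> r" using er r by linarith
        then have "cmod (?z - fst p) \<le> r" using nn[OF q] by linarith
        then show "?z \<in> cball (fst p) r" by (simp add: dist_norm norm_minus_commute)
      qed (use r in simp)
      also have "\<dots> \<le> \<Lambda> * ?X * (2 * (e * r))" using nn[OF q] \<Lambda> X by (intro mult_left_mono) (auto simp: norm_minus_commute)
      also have "\<dots> = 2 * (\<Lambda> * e) * (r * ?X)" by simp
      also have "\<dots> \<le> f / 8" unfolding e(3) using True by simp
      finally show "f / 2 \<le> cmod (tilt m g ?z)" using norm_triangle_sub[of "tilt m g (fst p)" "tilt m g ?z"] f0 unfolding f_def by linarith
    qed (use f0 in auto)
    moreover have "min (e\<^sup>2 / 2) (\<kappa> / 2 * (\<kappa> / (4 * \<Lambda>))\<^sup>2) * (r * Y) \<le> f / 2 * (h * (e * r))"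
    proof -
      have "min (e\<^sup>2 / 2) (\<kappa> / 2 * (\<kappa> / (4 * \<Lambda>))\<^sup>2) * (r * Y) \<le> e\<^sup>2 / 2 * (r * Y)" using r Y by (intro mult_right_mono) auto
      also have "\<dots> = (f * h) / 2 * (e * r)" unfolding h(2) by (simp add: power2_eq_square)
      finally show ?thesis by simp
    qed
    ultimately show ?thesis using final order_trans by blast
  next
    case False
    have der: "\<And>y. y \<in> cball (fst p) (2 * (e * r)) \<Longrightarrow> (\<phi> has_derivative (\<lambda>w. g y \<bullet> w)) (at y)"
    proof -
      fix y assume y: "y \<in> cball (fst p) (2 * (e * r))"
      have "2 * (e * r) \<le> \<delta>" using er r by linarith
      then have "y \<in> cball (fst p) \<delta>" using y by auto
      then show "(\<phi> has_derivative (\<lambda>w. g y \<bullet> w)) (at y)" by (rule deriv)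
    qed
    from tilt_large_somewhere[OF m er(1) der] obtain z1 where z1: "z1 \<in> cball (fst p) (2 * (e * r))"
      "e * r * (cmod (fst p) + e * r) ^ (2*m) / 8 < cmod (tilt m g z1)" by blast
    \<comment> \<open>The loop has size er, but the weight must be that of radius r; as e <= 1, the
      comparison costs a factor e^(2m).\<close>
    have "(e * (cmod (fst p) + r)) ^ (2*m) \<le> (cmod (fst p) + e * r) ^ (2*m)"
    proof (rule power_mono)
      have "e * cmod (fst p) \<le> 1 * cmod (fst p)" using e by (intro mult_right_mono) auto
      then show "e * (cmod (fst p) + r) \<le> cmod (fst p) + e * r" by (simp add: algebra_simps)
    qed (use e r in simp)
    then have "e * r * (e * (cmod (fst p) + r)) ^ (2*m) / 8 \<le> e * r * (cmod (fst p) + e * r) ^ (2*m) / 8"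
      using er by (intro divide_right_mono mult_left_mono) auto
    then have big: "\<kappa> * (r * ?X) \<le> cmod (tilt m g z1)" using z1(2) by (simp add: \<kappa>_def power_mult_distrib ac_simps)
    \<comment> \<open>Points of the square are within 2k of z1, so the tilt drops by at most half of
      the lower bound found at z1.\<close>
    define k where "k = \<kappa> / (4 * \<Lambda>) * r"
    have "\<kappa> / (4 * \<Lambda>) \<le> \<kappa> / 1" using \<kappa> \<Lambda> by (intro divide_left_mono) auto
    then have ke: "\<kappa> / (4 * \<Lambda>) \<le> e" using \<kappa> by simp
    have k: "0 < k" "k \<le> e * r" using \<kappa> \<Lambda> r ke mult_right_mono[OF ke, of r] by (auto simp: k_def)
    have z1n: "cmod (z1 - fst p) \<le> 2 * (e * r)" using z1(1) by (simp add: dist_norm norm_minus_commute)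
    have one: "cmod (1::complex) = 1" by simp
    have near: "fst (chart z1 1 q) \<in> cball (fst p) (4 * (e * r))" if "q \<in> rect k k" for q
      by (rule chart_in_ball[OF one that]) (use z1n k in simp)
    have "ennreal (\<kappa> * (r * ?X) / 2 / (1 + b) * (pi * k * k / (4 * L\<^sup>2))) \<le> mu (real m) \<Omega> (hbox m p r)"
    proof (rule lower_rect[OF one k(1) k(1) r])
      show "cmod (z1 - fst p) + k + k < r" using z1n k er r by linarith
      fix q assume q: "q \<in> rect k k"
      let ?z = "fst (chart z1 1 q)"
      have n4: "cmod (?z - fst p) \<le> 4 * (e * r)" using near[OF q] by (simp add: dist_norm norm_minus_commute)
      have "\<bar>tilt m g (fst p) \<bullet> (?z - fst p)\<bar> \<le> f * cmod (?z - fst p)" unfolding f_def by (rule Cauchy_Schwarz_ineq2)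
      also have "\<dots> \<le> (r * ?X) * (4 * (e * r))" using False n4 f0 r X by (intro mult_mono) auto
      also have "\<dots> = 4 * e * Y" by (simp add: Y_def power2_eq_square)
      finally have "\<bar>dev ?z\<bar> \<le> 4 * e * Y + \<Lambda> * ?X * (4 * (e * r))\<^sup>2" using dev_le[OF n4] er r by simp
      also have "\<Lambda> * ?X * (4 * (e * r))\<^sup>2 = 16 * (\<Lambda> * e) * e * Y" by (simp add: Y_def power2_eq_square)
      also have "4 * e * Y + 16 * (\<Lambda> * e) * e * Y = 5 * (e * Y)" unfolding e(3) by simp
      also have "\<dots> < Y" using mult_right_mono[OF e(2), of Y] Y by simp
      finally show "\<bar>dev ?z\<bar> < r\<^sup>2 * ?X" by (simp add: Y_def)
      have zz1: "cmod (z1 - ?z) \<le> 2 * k"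
      proof -
        have "?z - z1 = snd q *\<^sub>R (\<i> * 1) + fst q *\<^sub>R 1" by (simp add: chart_def Let_def)
        then have "cmod (?z - z1) \<le> \<bar>fst q\<bar> + \<bar>snd q\<bar>" using frame_bounds(3)[OF one, of "snd q" "fst q"] by simp
        also have "\<dots> \<le> 2 * k" using q by auto
        finally show ?thesis by (simp add: norm_minus_commute)
      qed
      have "cmod (tilt m g z1 - tilt m g ?z) \<le> \<Lambda> * ?X * cmod (z1 - ?z)"
      proof (rule tilt_lip[OF r(2)])
        have "4 * (e * r) \<le> r" "2 * (e * r) \<le> r" using er r by auto
        then have "cmod (?z - fst p) \<le> r" "cmod (z1 - fst p) \<le> r" using n4 z1n by auto
        then show "?z \<in> cball (fst p) r" "z1 \<in> cball (fst p) r" by (simp_all add: dist_norm norm_minus_commute)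
      qed
      also have "\<dots> \<le> \<Lambda> * ?X * (2 * k)" using zz1 \<Lambda> X by (intro mult_left_mono) auto
      also have "\<dots> = \<kappa> * (r * ?X) / 2" using \<Lambda> by (simp add: k_def)
      finally show "\<kappa> * (r * ?X) / 2 \<le> cmod (tilt m g ?z)"
        using norm_triangle_sub[of "tilt m g z1" "tilt m g ?z"] big by linarith
    qed (use \<kappa> r X in auto)
    moreover have "min (e\<^sup>2 / 2) (\<kappa> / 2 * (\<kappa> / (4 * \<Lambda>))\<^sup>2) * (r * Y) \<le> \<kappa> * (r * ?X) / 2 * (k * k)"
    proof -
      have "min (e\<^sup>2 / 2) (\<kappa> / 2 * (\<kappa> / (4 * \<Lambda>))\<^sup>2) * (r * Y) \<le> \<kappa> / 2 * (\<kappa> / (4 * \<Lambda>))\<^sup>2 * (r * Y)" using r Y by (intro mult_right_mono) auto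
      also have "\<dots> = \<kappa> * (r * ?X) / 2 * (k * k)" by (simp add: k_def Y_def power2_eq_square)
      finally show ?thesis .
    qed
    ultimately show ?thesis using final order_trans by blast
  qed
qed

definition "cnst = max (9 * pi * L\<^sup>2 * (1 + 2 * \<Lambda>)) (1 / lower_const)"

lemma lower_const_pos: "0 < lower_const"
  unfolding lower_const_def using e \<kappa> \<Lambda> b L by (simp add: min_def)

lemma cnst_pos: "0 < cnst"
proof -
  have "0 < 1 / lower_const" using lower_const_pos by (simp only: zero_less_divide_1_iff)
  then show ?thesis unfolding cnst_def less_max_iff_disj by (rule disjI2)
qed

lemma comparable:
  assumes r: "0 < r" "2 * r \<le> \<delta>" and hb: "\<And>x. x \<in> hbox m p r \<inter> frontier \<Omega> \<Longrightarrow> snd x = \<phi> (fst x)"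
  shows "box_comparable m \<Omega> p r cnst"
  unfolding box_comparable_def
proof
  have q: "0 \<le> qsize m p r" using r by (simp add: qsize_def)
  have "1 / lower_const \<le> cnst" unfolding cnst_def by (rule max.cobounded2)
  then have "1 / cnst \<le> lower_const" using lower_const_pos cnst_pos by (simp add: field_simps)
  then have 1: "qsize m p r / cnst \<le> lower_const * qsize m p r" using mult_right_mono[OF _ q, of "1 / cnst" lower_const] by simp
  have "ennreal (lower_const * qsize m p r) \<le> mu (real m) \<Omega> (hbox m p r)" by (rule mu_hbox_ge) (use r in auto)
  with 1 show "ennreal (qsize m p r / cnst) \<le> mu (real m) \<Omega> (hbox m p r)" by (meson ennreal_leI order_trans)
  have "9 * pi * L\<^sup>2 * (1 + 2 * \<Lambda>) * qsize m p r \<le> cnst * qsize m p r"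
    using q by (intro mult_right_mono) (auto simp: cnst_def)
  then show "mu (real m) \<Omega> (hbox m p r) \<le> ennreal (cnst * qsize m p r)"
    using mu_hbox_le[OF r hb] by (meson ennreal_leI order_trans)
qed

end

section \<open>Admissible graphs near characteristic points\<close>

lemma powr_of_nat: "0 \<le> x \<Longrightarrow> 0 < n \<Longrightarrow> x powr (real n) = x ^ n" for x :: real
  by (cases "x = 0") (auto simp: powr_realpow)

lemma cmod_le_inner_basis: "cmod w \<le> \<bar>w \<bullet> 1\<bar> + \<bar>w \<bullet> \<i>\<bar>"
  by (simp add: inner_complex_def cmod_le)

text \<open>Second-order bounds become Lipschitz bounds of the gradient by the mean value inequality
  on a convex set. The bound X of |y| on that set stays free, so that it can shrink with the box; 4C
  is the sum of 2C for each of two components.\<close>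

lemma admissible_gradient:
  assumes m: "m \<ge> 1" and sm: "smooth_on A \<phi>" and C: "0 < C"
    and bd: "\<forall>z\<in>A. \<forall>bs. set bs \<subseteq> Basis \<longrightarrow>
        (length bs = 3 \<longrightarrow> \<bar>iter_pd bs \<phi> z\<bar> \<le> C * cmod z powr (2*real m - 1)) \<and>
        (length bs = 2 \<longrightarrow> \<bar>iter_pd bs \<phi> z\<bar> \<le> C * cmod z powr (2*real m)) \<and>
        (length bs = 1 \<longrightarrow> \<bar>iter_pd bs \<phi> z\<bar> \<le> C * cmod z powr (2*real m + 1))"
  shows "\<exists>g. (\<forall>z\<in>A. (\<phi> has_derivative (\<lambda>w. g z \<bullet> w)) (at z) \<and> cmod (g z) \<le> 4 * C * cmod z ^ (2*m+1)) \<and>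
    (\<forall>S X z w. convex S \<and> S \<subseteq> A \<and> (\<forall>y\<in>S. cmod y \<le> X) \<and> z \<in> S \<and> w \<in> S \<longrightarrow>
       cmod (g z - g w) \<le> 4 * C * X ^ (2*m) * cmod (z - w))"
proof -
  have B: "(1::complex) \<in> Basis" "\<i> \<in> Basis" by (auto simp: Basis_complex_def)
  from smooth_on_gradient[OF sm] obtain g where g0: "\<forall>z\<in>A. (\<phi> has_derivative (\<lambda>w. g z \<bullet> w)) (at z)"
    and gb0: "\<forall>z. \<forall>b\<in>Basis. g z \<bullet> b = iter_pd [b] \<phi> z" by (elim exE conjE)
  note g = bspec[OF g0] and gb = gb0[rule_format]
  have g1: "\<bar>g z \<bullet> b\<bar> \<le> C * cmod z ^ (2*m+1)" if "z \<in> A" "b \<in> Basis" for z b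
  proof -
    have "\<bar>iter_pd [b] \<phi> z\<bar> \<le> C * cmod z powr (2*real m + 1)" using bd[rule_format, of z "[b]"] that by simp
    also have "2*real m + 1 = real (2*m+1)" by simp
    also have "cmod z powr (real (2*m+1)) = cmod z ^ (2*m+1)" by (rule powr_of_nat) auto
    finally show ?thesis using gb[OF that(2)] by simp
  qed
  have bound: "cmod (g z) \<le> 4 * C * cmod z ^ (2*m+1)" if z: "z \<in> A" for z
  proof -
    have "cmod (g z) \<le> C * cmod z ^ (2*m+1) + C * cmod z ^ (2*m+1)"
      using cmod_le_inner_basis[of "g z"] g1[OF z B(1)] g1[OF z B(2)] by linarith
    also have "\<dots> \<le> 4 * C * cmod z ^ (2*m+1)" using C by simp
    finally show ?thesis .
  qed
  have lip: "cmod (g z - g w) \<le> 4 * C * X ^ (2*m) * cmod (z - w)"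
    if S: "convex S" "S \<subseteq> A" "\<And>y. y \<in> S \<Longrightarrow> cmod y \<le> X" and zw: "z \<in> S" "w \<in> S" for S X z w
  proof -
    have "\<bar>iter_pd [b] \<phi> z - iter_pd [b] \<phi> w\<bar> \<le> 2 * C * X ^ (2*m) * cmod (z - w)" if b: "b \<in> Basis" for b
    proof -
      have "smooth_on A (iter_pd [b] \<phi>)"
        unfolding smooth_on_def
      proof (intro conjI allI impI ballI)
        show "open A" using sm by (simp add: smooth_on_def)
        fix bs y assume bs: "set bs \<subseteq> (Basis :: complex set)" and y: "y \<in> A"
        have "set (b # bs) \<subseteq> Basis" using b bs by simp
        then have "iter_pd (b # bs) \<phi> differentiable at y"
          using sm y unfolding smooth_on_def by blast
        then show "iter_pd bs (iter_pd [b] \<phi>) differentiable at y" by simp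
      qed
      from smooth_on_gradient[OF this] obtain H where H0: "\<forall>y\<in>A. (iter_pd [b] \<phi> has_derivative (\<lambda>v. H y \<bullet> v)) (at y)"
        and Hb0: "\<forall>y. \<forall>c\<in>Basis. H y \<bullet> c = iter_pd [c] (iter_pd [b] \<phi>) y" by (elim exE conjE)
      note H = bspec[OF H0] and Hb = Hb0[rule_format]
      have H1: "\<bar>H y \<bullet> c\<bar> \<le> C * X ^ (2*m)" if y: "y \<in> S" and c: "c \<in> Basis" for y c
      proof -
        have "\<bar>iter_pd [b, c] \<phi> y\<bar> \<le> C * cmod y powr (2*real m)" using bd[rule_format, of y "[b, c]"] b c y S by auto
        also have "2 * real m = real (2*m)" by simp
        also have "cmod y powr (real (2*m)) = cmod y ^ (2*m)" by (rule powr_of_nat) (use m in auto)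
        finally have "\<bar>H y \<bullet> c\<bar> \<le> C * cmod y ^ (2*m)" using Hb[OF c] by simp
        also have "\<dots> \<le> C * X ^ (2*m)" using C S(3)[OF y] by (intro mult_left_mono power_mono) auto
        finally show ?thesis .
      qed
      have "norm (iter_pd [b] \<phi> z - iter_pd [b] \<phi> w) \<le> 2 * C * X ^ (2*m) * norm (z - w)"
      proof (rule differentiable_bound[OF S(1)])
        fix y assume y: "y \<in> S"
        show "(iter_pd [b] \<phi> has_derivative (\<lambda>v. H y \<bullet> v)) (at y within S)" by (rule has_derivative_at_withinI, rule H) (use S y in blast)
        have Hn: "cmod (H y) \<le> 2 * C * X ^ (2*m)"
          using cmod_le_inner_basis[of "H y"] H1[OF y B(1)] H1[OF y B(2)] by linarith
        have "\<bar>H y \<bullet> v\<bar> \<le> 2 * C * X ^ (2*m) * cmod v" for v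
          using Cauchy_Schwarz_ineq2[of "H y" v] mult_right_mono[OF Hn, of "cmod v"] by simp
        then show "onorm (\<lambda>v. H y \<bullet> v) \<le> 2 * C * X ^ (2*m)" using order_trans[OF norm_ge_zero Hn] by (intro onorm_bound) auto
      qed (use zw in auto)
      then show ?thesis by simp
    qed
    then have "\<bar>(g z - g w) \<bullet> b\<bar> \<le> 2 * C * X ^ (2*m) * cmod (z - w)" if "b \<in> Basis" for b
      using gb[OF that] that by (simp add: inner_diff_left)
    from this[OF B(1)] this[OF B(2)] cmod_le_inner_basis[of "g z - g w"] show ?thesis by linarith
  qed
  have lips: "\<forall>S X z w. convex S \<and> S \<subseteq> A \<and> (\<forall>y\<in>S. cmod y \<le> X) \<and> z \<in> S \<and> w \<in> S \<longrightarrow>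
       cmod (g z - g w) \<le> 4 * C * X ^ (2*m) * cmod (z - w)"
  proof (intro allI impI)
    fix S X z w assume "convex S \<and> S \<subseteq> A \<and> (\<forall>y\<in>S. cmod y \<le> X) \<and> z \<in> S \<and> w \<in> S"
    then show "cmod (g z - g w) \<le> 4 * C * X ^ (2*m) * cmod (z - w)" by (intro lip[of S X z w]) auto
  qed
  show ?thesis by (intro exI[of _ g] conjI ballI g bound lips)
qed

text \<open>Any defining function vanishes along the graph near the point, so its gradient
  annihilates the tangent vectors (w, g . w) and is a multiple of (-g, 1).\<close>

lemma graph_normal:
  assumes sb: "smooth_boundary \<Omega>" and op: "open \<Omega>" and A: "open A" "z \<in> A"
    and d: "(\<phi> has_derivative (\<lambda>w. g \<bullet> w)) (at z)" and fr: "\<And>y. y \<in> A \<Longrightarrow> (y, \<phi> y) \<in> frontier \<Omega>"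
  obtains k where "unit_normal \<Omega> (z, \<phi> z) = k *\<^sub>R (- g, 1)" "\<bar>k\<bar> * norm (- g, 1::real) = 1"
proof -
  obtain U \<rho> N where w: "(z, \<phi> z) \<in> U" "defining_fn \<Omega> U \<rho>" "(\<rho> has_derivative (\<lambda>v. N \<bullet> v)) (at (z, \<phi> z))" "N \<noteq> 0"
    "unit_normal \<Omega> (z, \<phi> z) = N /\<^sub>R norm N" by (rule unit_normal_witness[OF sb fr[OF A(2)]])
  obtain G where G: "\<And>x. x \<in> U \<Longrightarrow> (\<rho> has_derivative (\<lambda>v. G x \<bullet> v)) (at x)" "\<And>x. x \<in> U \<Longrightarrow> G x \<noteq> 0"
    using defining_fn_gradient[OF w(2)] by metis
  have dgr: "((\<lambda>y. (y, \<phi> y)) has_derivative (\<lambda>w. (w, g \<bullet> w))) (at z)" by (intro has_derivative_Pair has_derivative_ident d)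
  have 1: "((\<lambda>y. \<rho> (y, \<phi> y)) has_derivative (\<lambda>w. N \<bullet> (w, g \<bullet> w))) (at z)"
    by (rule has_derivative_compose[OF dgr w(3)])
  have "isCont (\<lambda>y. (y, \<phi> y)) z" using dgr by (rule has_derivative_continuous)
  then have "eventually (\<lambda>y. (y, \<phi> y) \<in> U) (at z)"
    using w(1,2) by (intro topological_tendstoD[of _ "(z, \<phi> z)"]) (auto simp: isCont_def defining_fn_def)
  moreover have "eventually (\<lambda>y. y \<in> A) (at z)" using A by (rule eventually_at_in_open')
  ultimately have ev: "eventually (\<lambda>y. \<rho> (y, \<phi> y) = 0) (at z)"
  proof eventually_elim
    case (elim y)
    then show ?case using defining_fn_frontier[OF op w(2) elim(1) G(1)[OF elim(1)] G(2)[OF elim(1)]] fr by blast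
  qed
  have at: "\<rho> (z, \<phi> z) = 0" using defining_fn_frontier[OF op w(2,1,3,4)] fr[OF A(2)] by blast
  have "((\<lambda>y. 0::real) has_derivative (\<lambda>w. N \<bullet> (w, g \<bullet> w))) (at z)"
    by (rule has_derivative_transform_eventually[OF 1 ev at UNIV_I])
  from has_derivative_unique[OF this has_derivative_const] have z: "N \<bullet> (w, g \<bullet> w) = 0" for w by (rule fun_cong)
  define \<tau> where "\<tau> = snd N"
  have "(fst N + \<tau> *\<^sub>R g) \<bullet> w = 0" for w using z[of w] by (simp add: inner_prod_def \<tau>_def inner_add_left)
  from this[of "fst N + \<tau> *\<^sub>R g"] have "fst N + \<tau> *\<^sub>R g = 0" by simp
  then have "fst N = - (\<tau> *\<^sub>R g)" by (rule eq_neg_iff_add_eq_0[THEN iffD2])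
  then have N: "N = \<tau> *\<^sub>R (- g, 1)" by (simp add: prod_eq_iff \<tau>_def)
  show ?thesis
  proof (rule that)
    show "unit_normal \<Omega> (z, \<phi> z) = (\<tau> / norm N) *\<^sub>R (- g, 1)" unfolding w(5) by (subst N) (simp add: divide_inverse_commute)
    have "norm N = norm (\<tau> *\<^sub>R (- g, 1::real))" using N by (rule arg_cong)
    then have "\<bar>\<tau>\<bar> * norm (- g, 1::real) = norm N" by (simp only: norm_scaleR)
    then show "\<bar>\<tau> / norm N\<bar> * norm (- g, 1::real) = 1" using w(4) by (simp add: abs_divide)
  qed
qed

text \<open>The weight equals |k| |tilt|, where 1/|k| is the norm of (-g, 1) and lies between 1 and
  1 + b.\<close>

lemma graph_weight:
  assumes m: "m \<ge> 1" and N: "unit_normal \<Omega> (z, t) = k *\<^sub>R (- g z, 1)" "\<bar>k\<bar> * norm (- g z, 1::real) = 1"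
    and b: "cmod (g z) \<le> b"
  shows "cmod (tilt m g z) / (1 + b) \<le> wgt m \<Omega> (z, t)" "wgt m \<Omega> (z, t) \<le> cmod (tilt m g z)"
proof -
  have i: "unit_normal \<Omega> (z, t) \<bullet> hvel m z v = - k * (tilt m g z \<bullet> v)" for v
    by (simp add: N(1) hvel_def inner_prod_def tilt_inner algebra_simps)
  have "wgt m \<Omega> (z, t) = sqrt (k\<^sup>2 * ((Re (tilt m g z))\<^sup>2 + (Im (tilt m g z))\<^sup>2))"
    unfolding wgt_def Xf_hvel[OF m] Yf_hvel[OF m] fst_conv i
    by (simp add: inner_complex_def power_mult_distrib distrib_left)
  then have w: "wgt m \<Omega> (z, t) = \<bar>k\<bar> * cmod (tilt m g z)" by (simp add: real_sqrt_mult cmod_def)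
  have n1: "norm (- g z, 1::real) \<le> 1 + b" using norm_pt_le[of "(- g z, 1)"] b by simp
  have n2: "1 \<le> norm (- g z, 1::real)" using norm_snd_pt_le[of "(- g z, 1)"] by simp
  have "\<bar>k\<bar> * 1 \<le> 1" using mult_left_mono[OF n2, of "\<bar>k\<bar>"] N(2) by simp
  then show "wgt m \<Omega> (z, t) \<le> cmod (tilt m g z)" unfolding w using mult_right_mono[of "\<bar>k\<bar>" 1 "cmod (tilt m g z)"] by simp
  have "1 \<le> \<bar>k\<bar> * (1 + b)" using mult_left_mono[OF n1, of "\<bar>k\<bar>"] N(2) by simp
  moreover have "0 < 1 + b" using n1 n2 by linarith
  ultimately have "1 / (1 + b) \<le> \<bar>k\<bar>" by (simp add: field_simps)
  from mult_right_mono[OF this, of "cmod (tilt m g z)"]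
  show "cmod (tilt m g z) / (1 + b) \<le> wgt m \<Omega> (z, t)" unfolding w by simp
qed

lemma tilt_lipschitz:
  assumes m: "m \<ge> 1" and X: "cmod z \<le> X" "cmod w \<le> X" and g: "cmod (g z - g w) \<le> C * X ^ (2*m) * cmod (z - w)"
  shows "cmod (tilt m g z - tilt m g w) \<le> (C + 2 * real m + 1) * X ^ (2*m) * cmod (z - w)"
proof -
  have "tilt m g z - tilt m g w = (g z - g w) + \<i> * (twist m z - twist m w)" by (simp add: tilt_def algebra_simps)
  also have "cmod \<dots> \<le> cmod (g z - g w) + cmod (twist m z - twist m w)"
    by (rule order_trans[OF norm_triangle_ineq]) (simp add: norm_mult)
  also have "\<dots> \<le> C * X ^ (2*m) * cmod (z - w) + (2 * real m + 1) * X ^ (2*m) * cmod (z - w)"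
    by (rule add_mono[OF g twist_lipschitz[OF m X]])
  finally show ?thesis by (simp add: algebra_simps)
qed

text \<open>Keeps small boxes inside the Euclidean neighbourhood in which the boundary is known to
  be a graph.\<close>

lemma hbox_small:
  assumes R: "cmod (fst p) + 1 \<le> R" and r: "0 < r" "r \<le> 1" and x: "x \<in> hbox m p r"
  shows "norm (x - p) \<le> (1 + R ^ (2*m) + R ^ (2*m+1)) * r"
proof -
  have f: "cmod (fst x - fst p) \<le> r" and s: "\<bar>snd x - snd p - hslope m (fst p) (fst x - fst p)\<bar> \<le> r\<^sup>2 * (cmod (fst p) + r) ^ (2*m)"
    using x by (auto simp: hbox_def)
  have "r\<^sup>2 * (cmod (fst p) + r) ^ (2*m) \<le> (r * 1) * R ^ (2*m)"
    unfolding power2_eq_square using r R by (intro mult_mono power_mono) auto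
  moreover have "\<bar>hslope m (fst p) (fst x - fst p)\<bar> \<le> R ^ (2*m+1) * r"
  proof -
    have pR: "cmod (fst p) \<le> R" using R by linarith
    have "\<bar>hslope m (fst p) (fst x - fst p)\<bar> \<le> R ^ (2*m+1) * cmod (fst x - fst p)" by (rule hslope_bound[OF pR])
    also have "\<dots> \<le> R ^ (2*m+1) * r" using f order_trans[OF norm_ge_zero pR] by (intro mult_left_mono) auto
    finally show ?thesis .
  qed
  ultimately have "\<bar>snd x - snd p\<bar> \<le> R ^ (2*m) * r + R ^ (2*m+1) * r" using s by (simp add: mult.commute)
  then show ?thesis using norm_pt_le[of "x - p"] f by (simp add: algebra_simps)
qed

text \<open>The graph piece is set up at every boundary point near p0, characteristic or not, with
  the same \<delta>, \<Lambda> and b.\<close>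

lemma characteristic_comparable:
  assumes m: "m \<ge> 1" and dom: "admissible_domain (real m) \<Omega>" and ch: "characteristic (real m) \<Omega> p0"
  shows "\<exists>\<epsilon>>0. \<exists>r0>0. \<exists>C>0. \<forall>p\<in>frontier \<Omega> \<inter> ball p0 \<epsilon>. \<forall>r. 0 < r \<and> r \<le> r0 \<longrightarrow> box_comparable m \<Omega> p r C"
proof -
  have sb: "smooth_boundary \<Omega>" and op: "open \<Omega>" using dom by (auto simp: admissible_domain_def bounded_smooth_domain_def)
  have p0: "p0 \<in> frontier \<Omega>" using ch by (simp add: characteristic_def)
  from dom ch obtain U where U: "open U" "p0 \<in> U" "admissible_graph (real m) (frontier \<Omega> \<inter> U)"
    unfolding admissible_domain_def by blast
  from U(3) obtain A \<phi> C where A: "open A" and sm: "smooth_on A \<phi>" and gr: "frontier \<Omega> \<inter> U = (\<lambda>z. (z, \<phi> z)) ` A"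
    and C: "0 < C" and bd: "\<forall>z\<in>A. \<forall>bs. set bs \<subseteq> Basis \<longrightarrow>
        (length bs = 3 \<longrightarrow> \<bar>iter_pd bs \<phi> z\<bar> \<le> C * cmod z powr (2*real m - 1)) \<and>
        (length bs = 2 \<longrightarrow> \<bar>iter_pd bs \<phi> z\<bar> \<le> C * cmod z powr (2*real m)) \<and>
        (length bs = 1 \<longrightarrow> \<bar>iter_pd bs \<phi> z\<bar> \<le> C * cmod z powr (2*real m + 1))"
    unfolding admissible_graph_def by blast
  from admissible_gradient[OF m sm C bd] obtain g where
    g12: "\<forall>z\<in>A. (\<phi> has_derivative (\<lambda>w. g z \<bullet> w)) (at z) \<and> cmod (g z) \<le> 4 * C * cmod z ^ (2*m+1)" and
    g3: "\<forall>S X z w. convex S \<and> S \<subseteq> A \<and> (\<forall>y\<in>S. cmod y \<le> X) \<and> z \<in> S \<and> w \<in> S \<longrightarrow>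
       cmod (g z - g w) \<le> 4 * C * X ^ (2*m) * cmod (z - w)" by (elim exE conjE)
  have g: "\<And>z. z \<in> A \<Longrightarrow> (\<phi> has_derivative (\<lambda>w. g z \<bullet> w)) (at z)"
    "\<And>z. z \<in> A \<Longrightarrow> cmod (g z) \<le> 4 * C * cmod z ^ (2*m+1)" using g12 by blast+
  have grD: "fst x \<in> A \<and> snd x = \<phi> (fst x)" if "x \<in> frontier \<Omega>" "x \<in> U" for x
  proof -
    have "x \<in> (\<lambda>z. (z, \<phi> z)) ` A" using that gr by blast
    then show ?thesis by auto
  qed
  have fr: "\<And>y. y \<in> A \<Longrightarrow> (y, \<phi> y) \<in> frontier \<Omega>" using gr by auto
  have z0: "fst p0 \<in> A" using grD p0 U by blast
  obtain \<epsilon>1 where \<epsilon>1: "0 < \<epsilon>1" "ball p0 \<epsilon>1 \<subseteq> U" using U open_contains_ball by blast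
  obtain \<epsilon>2 where \<epsilon>2: "0 < \<epsilon>2" "ball (fst p0) \<epsilon>2 \<subseteq> A" using A z0 open_contains_ball by blast
  \<comment> \<open>A third of the available radius leaves room for a step of length \<delta> from
    p0 to p and another from p into a ball or box about p.\<close>
  define \<delta> where "\<delta> = min 1 (min \<epsilon>1 \<epsilon>2) / 3"
  have \<delta>: "0 < \<delta>" "\<delta> \<le> 1/3" "3 * \<delta> \<le> \<epsilon>1" "3 * \<delta> \<le> \<epsilon>2" using \<epsilon>1 \<epsilon>2 by (auto simp: \<delta>_def)
  define R where "R = cmod (fst p0) + 2"
  have R1: "1 \<le> R" using norm_ge_zero[of "fst p0"] unfolding R_def by linarith
  define b where "b = 4 * C * R ^ (2*m+1)"
  define \<Lambda> where "\<Lambda> = 4 * C + 2 * real m + 1"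
  have piece: "graph_piece m \<Omega> p \<phi> g \<delta> \<Lambda> b \<and> cmod (fst p) + 1 \<le> R" if p: "p \<in> frontier \<Omega> \<inter> ball p0 \<delta>" for p
  proof -
    have "p \<in> U" using p \<epsilon>1 \<delta> by auto
    then have ps: "snd p = \<phi> (fst p)" using grD p by blast
    have near: "cmod (fst p - fst p0) < \<delta>" using p norm_fst_pt_le[of "p - p0"] by (simp add: dist_norm norm_minus_commute)
    have sub: "cball (fst p) \<delta> \<subseteq> A"
    proof
      fix z assume "z \<in> cball (fst p) \<delta>"
      then have "dist (fst p0) z < \<epsilon>2" using near \<delta> dist_triangle[of "fst p0" z "fst p"] by (simp add: dist_norm norm_minus_commute)
      then show "z \<in> A" using \<epsilon>2 by auto
    qed
    have zR: "cmod z \<le> R" if "z \<in> cball (fst p) \<delta>" for z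
    proof -
      have "cmod (z - fst p) \<le> \<delta>" using that by (simp add: dist_norm norm_minus_commute)
      then have "cmod (z - fst p0) \<le> 1" using near \<delta> norm_triangle_ineq[of "z - fst p" "fst p - fst p0"] by simp
      then show ?thesis using norm_triangle_sub[of z "fst p0"] by (simp add: R_def)
    qed
    have pR: "cmod (fst p) + 1 \<le> R" using near \<delta> norm_triangle_sub[of "fst p" "fst p0"] by (simp add: R_def)
    have bz: "cmod (g z) \<le> b" if "z \<in> cball (fst p) \<delta>" for z
    proof -
      have "cmod (g z) \<le> 4 * C * cmod z ^ (2*m+1)" using g(2) sub that by blast
      also have "\<dots> \<le> b" unfolding b_def using zR[OF that] C by (intro mult_left_mono power_mono) auto
      finally show ?thesis .
    qed
    have lip: "cmod (g z - g w) \<le> 4 * C * (cmod (fst p) + r) ^ (2*m) * cmod (z - w)" "cmod z \<le> cmod (fst p) + r" "cmod w \<le> cmod (fst p) + r"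
      if r: "r \<le> \<delta>" and zw: "z \<in> cball (fst p) r" "w \<in> cball (fst p) r" for r z w
    proof -
      have X: "cmod y \<le> cmod (fst p) + r" if "y \<in> cball (fst p) r" for y
        using that norm_triangle_sub[of y "fst p"] by (simp add: dist_norm norm_minus_commute)
      show "cmod z \<le> cmod (fst p) + r" "cmod w \<le> cmod (fst p) + r" using X zw by auto
      show "cmod (g z - g w) \<le> 4 * C * (cmod (fst p) + r) ^ (2*m) * cmod (z - w)"
      proof (rule g3[rule_format], intro conjI ballI)
        show "cball (fst p) r \<subseteq> A" using sub subset_cball[OF r, of "fst p"] by blast
      qed (use X zw convex_cball in auto)
    qed
    have "graph_piece m \<Omega> p \<phi> g \<delta> \<Lambda> b"
    proof
      show "1 \<le> \<Lambda>" "0 \<le> b" using C R1 by (auto simp: \<Lambda>_def b_def)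
      show "(\<phi> has_derivative (\<lambda>w. g z \<bullet> w)) (at z)" if "z \<in> cball (fst p) \<delta>" for z using g(1) sub that by blast
      show "(z, \<phi> z) \<in> frontier \<Omega>" if "z \<in> cball (fst p) \<delta>" for z using fr sub that by blast
      show "cmod (g z - g w) \<le> \<Lambda> * (cmod (fst p) + r) ^ (2*m) * cmod (z - w)"
        if r: "r \<le> \<delta>" and zw: "z \<in> cball (fst p) r" "w \<in> cball (fst p) r" for r z w
      proof -
        have "0 \<le> cmod (fst p) + r" using order_trans[OF norm_ge_zero lip(2)[OF that]] .
        then have "4 * C * ((cmod (fst p) + r) ^ (2*m) * cmod (z - w)) \<le> \<Lambda> * ((cmod (fst p) + r) ^ (2*m) * cmod (z - w))"
          by (intro mult_right_mono) (auto simp: \<Lambda>_def)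
        then show ?thesis using lip(1)[OF that] by (simp add: mult.assoc)
      qed
      show "cmod (tilt m g z - tilt m g w) \<le> \<Lambda> * (cmod (fst p) + r) ^ (2*m) * cmod (z - w)"
        if r: "r \<le> \<delta>" and zw: "z \<in> cball (fst p) r" "w \<in> cball (fst p) r" for r z w
        unfolding \<Lambda>_def by (rule tilt_lipschitz[OF m lip(2,3,1)[OF that]])
      show "cmod (tilt m g z) / (1 + b) \<le> wgt m \<Omega> (z, \<phi> z) \<and> wgt m \<Omega> (z, \<phi> z) \<le> cmod (tilt m g z)"
        if z: "z \<in> cball (fst p) \<delta>" for z
      proof -
        have zA: "z \<in> A" using sub z by blast
        obtain k where k: "unit_normal \<Omega> (z, \<phi> z) = k *\<^sub>R (- g z, 1)" "\<bar>k\<bar> * norm (- g z, 1::real) = 1"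
          by (rule graph_normal[OF sb op A zA g(1)[OF zA] fr])
        show ?thesis using graph_weight[where g=g and z=z, OF m k bz[OF z]] by blast
      qed
    qed (use m ps \<delta> bz in auto)
    with pR show ?thesis by blast
  qed
  define M where "M = 1 + R ^ (2*m) + R ^ (2*m+1)"
  have M: "1 \<le> M" using R1 by (simp add: M_def)
  \<comment> \<open>By \<open>hbox_small\<close> the box then stays within \<delta> of p, and 2 r0
    <= \<delta> holds as the upper bound requires.\<close>
  define r0 where "r0 = \<delta> / (2 * M)"
  have r0: "0 < r0" "M * r0 \<le> \<delta>" "2 * r0 \<le> \<delta>"
  proof -
    show "0 < r0" "M * r0 \<le> \<delta>" using \<delta> M by (auto simp: r0_def)
    have "\<delta> / (2 * M) \<le> \<delta> / (2 * 1)" using \<delta> M by (intro divide_left_mono mult_left_mono) auto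
    then show "2 * r0 \<le> \<delta>" by (simp add: r0_def)
  qed
  let ?C = "graph_piece.cnst m \<Lambda> b"
  have "\<forall>p\<in>frontier \<Omega> \<inter> ball p0 \<delta>. \<forall>r. 0 < r \<and> r \<le> r0 \<longrightarrow> box_comparable m \<Omega> p r ?C"
  proof (intro ballI allI impI)
    fix p r assume p: "p \<in> frontier \<Omega> \<inter> ball p0 \<delta>" and r: "0 < r \<and> r \<le> r0"
    have P: "graph_piece m \<Omega> p \<phi> g \<delta> \<Lambda> b" and pR: "cmod (fst p) + 1 \<le> R" using piece[OF p] by auto
    have r1: "r \<le> 1" using r r0 \<delta> by linarith
    show "box_comparable m \<Omega> p r ?C"
    proof (rule graph_piece.comparable[OF P])
      show "0 < r" "2 * r \<le> \<delta>" using r r0 by auto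
      fix x assume x: "x \<in> hbox m p r \<inter> frontier \<Omega>"
      have "norm (x - p) \<le> M * r" unfolding M_def using hbox_small[OF pR _ r1] r x by blast
      also have "\<dots> \<le> M * r0" using r M by (intro mult_left_mono) auto
      also have "\<dots> \<le> \<delta>" by (rule r0(2))
      finally have "dist p0 x < \<epsilon>1" using p \<delta> dist_triangle[of p0 x p] by (simp add: dist_norm norm_minus_commute)
      then have "x \<in> U" using \<epsilon>1 by auto
      then show "snd x = \<phi> (fst x)" using grD x by blast
    qed
  qed
  moreover have "0 < ?C" using graph_piece.cnst_pos piece p0 \<delta> by (metis IntI centre_in_ball)
  ultimately show ?thesis using \<delta>(1) r0(1) by blast
qed

section \<open>Uniform constants by compactness, and passage from boxes to metric balls\<close>

lemma box_comparable_mono: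
  assumes "box_comparable m \<Omega> p r C" "0 < C" "C \<le> C'" "0 < r"
  shows "box_comparable m \<Omega> p r C'"
proof -
  have q: "0 \<le> qsize m p r" using assms by (simp add: qsize_def)
  have "qsize m p r / C' \<le> qsize m p r / C" using q assms by (intro divide_left_mono) auto
  moreover have "C * qsize m p r \<le> C' * qsize m p r" using q assms by (intro mult_right_mono) auto
  ultimately show ?thesis using assms(1) unfolding box_comparable_def by (meson ennreal_leI order_trans)
qed

lemma boundary_comparable:
  assumes m: "m \<ge> 1" and dom: "admissible_domain (real m) \<Omega>"
  shows "\<exists>r0>0. \<exists>C>0. \<forall>p\<in>frontier \<Omega>. \<forall>r. 0 < r \<and> r \<le> r0 \<longrightarrow> box_comparable m \<Omega> p r C"
proof -
  have bsd: "bounded_smooth_domain \<Omega>" using dom by (simp add: admissible_domain_def)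
  then have cpt: "compact (frontier \<Omega>)" by (auto simp: bounded_smooth_domain_def intro: compact_frontier_bounded)
  have "\<forall>q\<in>frontier \<Omega>. \<exists>\<epsilon>>0. \<exists>r0>0. \<exists>C>0. \<forall>p\<in>frontier \<Omega> \<inter> ball q \<epsilon>. \<forall>r. 0 < r \<and> r \<le> r0 \<longrightarrow> box_comparable m \<Omega> p r C"
    using characteristic_comparable[OF m dom] noncharacteristic_comparable[OF m bsd] by blast
  then obtain \<epsilon> \<rho> C where loc: "\<And>q. q \<in> frontier \<Omega> \<Longrightarrow> 0 < \<epsilon> q \<and> 0 < \<rho> q \<and> 0 < C q \<and>
      (\<forall>p\<in>frontier \<Omega> \<inter> ball q (\<epsilon> q). \<forall>r. 0 < r \<and> r \<le> \<rho> q \<longrightarrow> box_comparable m \<Omega> p r (C q))" by metis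
  have "frontier \<Omega> \<subseteq> (\<Union>q\<in>frontier \<Omega>. ball q (\<epsilon> q))" using loc by force
  then obtain P where P: "P \<subseteq> frontier \<Omega>" "finite P" "frontier \<Omega> \<subseteq> (\<Union>q\<in>P. ball q (\<epsilon> q))"
    using compactE_image[OF cpt, of "frontier \<Omega>" "\<lambda>q. ball q (\<epsilon> q)"] by (metis open_ball)
  \<comment> \<open>Inserting 1 keeps the minimum, and likewise the maximum below, well defined
    should the finite cover be empty.\<close>
  define r0 where "r0 = Min (insert 1 (\<rho> ` P))"
  define K where "K = Max (insert 1 (C ` P))"
  have "0 < r0" unfolding r0_def using P loc by (subst Min_gr_iff) auto
  moreover have "0 < K" unfolding K_def using P by (subst Max_gr_iff) auto
  moreover have "box_comparable m \<Omega> p r K" if p: "p \<in> frontier \<Omega>" and r: "0 < r" "r \<le> r0" for p r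
  proof -
    obtain q where q: "q \<in> P" "p \<in> ball q (\<epsilon> q)" using P p by blast
    have "r0 \<le> \<rho> q" unfolding r0_def using P q by (intro Min_le) auto
    moreover have "C q \<le> K" unfolding K_def using P q by (intro Max_ge) auto
    ultimately show ?thesis using loc[of q] q P p r by (intro box_comparable_mono[of m \<Omega> p r "C q" K]) auto
  qed
  ultimately show ?thesis by blast
qed

text \<open>A doubling property: it compares the outer and inner boxes between which a metric ball
  is enclosed.\<close>

lemma qsize_scale:
  assumes "0 < a" "1 \<le> s"
  shows "qsize m p (s * a) \<le> s ^ (2*m+3) * qsize m p a"
proof -
  have "1 * cmod (fst p) \<le> s * cmod (fst p)" using assms by (intro mult_right_mono) auto
  then have "(cmod (fst p) + s * a) ^ (2*m) \<le> (s * (cmod (fst p) + a)) ^ (2*m)"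
    using assms by (intro power_mono) (auto simp: algebra_simps)
  then have "(s * a) ^ 3 * (cmod (fst p) + s * a) ^ (2*m) \<le> (s * a) ^ 3 * (s * (cmod (fst p) + a)) ^ (2*m)"
    using assms by (intro mult_left_mono) auto
  then show ?thesis by (simp add: qsize_def power_mult_distrib power_add ac_simps)
qed

lemma mu_mono: "E \<subseteq> E' \<Longrightarrow> mu m \<Omega> E \<le> mu m \<Omega> E'"
  unfolding mu_def by (intro nn_integral_mono) (auto simp: indicator_def)

theorem theorem1p2:
  fixes m :: nat and \<Omega> :: "pt set"
  assumes "m \<ge> 1" and "admissible_domain (real m) \<Omega>"
  shows "\<exists>C>0. \<exists>r0>0. \<forall>p\<in>frontier \<Omega>. \<forall>r. 0 < r \<and> r \<le> r0 \<longrightarrow>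
     ennreal (1 / C) * emeasure lebesgue (cc_ball (real m) p r) / ennreal r
        \<le> mu (real m) \<Omega> (cc_ball (real m) p r) \<and>
     mu (real m) \<Omega> (cc_ball (real m) p r)
        \<le> ennreal C * emeasure lebesgue (cc_ball (real m) p r) / ennreal r"
proof -
  obtain r1 C where r1: "0 < r1" and C: "0 < C" and
    comp: "\<And>p r. p \<in> frontier \<Omega> \<Longrightarrow> 0 < r \<Longrightarrow> r \<le> r1 \<Longrightarrow> box_comparable m \<Omega> p r C"
    using boundary_comparable[OF assms] by blast
  define k where "k = 16 * real m + 18"
  define K where "K = 2 * real m + 2"
  have kK: "1 \<le> k" "1 \<le> K" by (auto simp: k_def K_def)
  define S where "S = (K * k) ^ (2*m+3)"
  have Kk: "1 \<le> K * k" using kK mult_mono[of 1 K 1 k] by simp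
  have S: "1 \<le> S" unfolding S_def using Kk by (rule one_le_power)
  \<comment> \<open>2 pi K S C is required by the lower estimate and C S k by the upper one; their
    sum dominates both.\<close>
  define D where "D = C * S * (2 * pi * K + k)"
  have "0 < 2 * pi * K + k" using kK by (intro add_pos_pos mult_pos_pos) auto
  then have D: "0 < D" unfolding D_def using C S by simp
  have D1: "2 * pi * K * S * C \<le> D" "C * S * k \<le> D"
    unfolding D_def using C S kK by (auto simp: algebra_simps)
  show ?thesis
  proof (rule exI[of _ D], rule conjI[OF D], rule exI[of _ "r1 / K"], intro conjI ballI allI impI)
    show "0 < r1 / K" using r1 kK by simp
  next
    fix p r assume p: "p \<in> frontier \<Omega>" and r: "0 < r \<and> r \<le> r1 / K"
    let ?B = "cc_ball (real m) p r"
    have r0: "0 < r" and Kr: "K * r \<le> r1" using r kK by (auto simp: field_simps)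
    have rk: "r / k \<le> r1"
    proof -
      have "r / k \<le> r / 1" using r0 kK by (intro divide_left_mono) auto
      also have "\<dots> \<le> K * r" using r0 kK by simp
      finally show ?thesis using Kr by simp
    qed
    have sub: "hbox m p (r / k) \<subseteq> ?B" "?B \<subseteq> hbox m p (K * r)"
      unfolding k_def K_def using hbox_subset_cc_ball[OF assms(1) r0] cc_ball_subset_hbox[OF assms(1) r0] by auto
    define q where "q = qsize m p (r / k)"
    have q0: "0 \<le> q" using r0 kK by (simp add: q_def qsize_def)
    have "qsize m p ((K * k) * (r / k)) \<le> S * q"
      unfolding S_def q_def by (rule qsize_scale) (use r0 kK Kk in auto)
    then have qS: "qsize m p (K * r) \<le> S * q" using kK by simp
    \<comment> \<open>The volume is the radius times \<open>qsize\<close> up to 2 pi, so dividing by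
      r produces the quantity already compared with \<mu>.\<close>
    have vol: "emeasure lborel (hbox m p a) = ennreal (2 * pi * a * qsize m p a)" if "0 < a" for a
      using emeasure_hbox[OF that, of m p] by (simp add: qsize_def power4_eq_xxxx power3_eq_cube mult.assoc)
    have bor: "?B \<in> sets borel" "hbox m p a \<in> sets borel" for a
      using open_cc_ball[OF assms(1)] open_hbox by (auto intro: borel_open)
    have lb: "emeasure lebesgue ?B = emeasure lborel ?B" using bor by simp
    have Bup: "emeasure lborel ?B \<le> ennreal (2 * pi * (K * r) * (S * q))"
    proof -
      have "emeasure lborel ?B \<le> emeasure lborel (hbox m p (K * r))" using sub bor by (intro emeasure_mono) auto
      also have "\<dots> = ennreal (2 * pi * (K * r) * qsize m p (K * r))" by (rule vol) (use r0 kK in auto)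
      also have "\<dots> \<le> ennreal (2 * pi * (K * r) * (S * q))" using qS r0 kK by (intro ennreal_leI mult_left_mono) auto
      finally show ?thesis .
    qed
    have Blo: "ennreal (2 * pi * (r / k) * q) \<le> emeasure lborel ?B"
    proof -
      have "ennreal (2 * pi * (r / k) * q) = emeasure lborel (hbox m p (r / k))"
        unfolding q_def by (rule vol[symmetric]) (use r0 kK in auto)
      also have "\<dots> \<le> emeasure lborel ?B" using sub bor by (intro emeasure_mono) auto
      finally show ?thesis .
    qed
    \<comment> \<open>The ball lies in a box and has finite volume, so the remaining estimates take
      place in the reals.\<close>
    obtain \<beta> where \<beta>: "emeasure lborel ?B = ennreal \<beta>" "0 \<le> \<beta>"
      using Bup by (cases "emeasure lborel ?B") (auto simp: top_unique)
    have \<beta>up: "\<beta> \<le> 2 * pi * (K * r) * (S * q)" and \<beta>lo: "2 * pi * (r / k) * q \<le> \<beta>"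
      using Bup Blo \<beta> q0 r0 kK S by (auto simp: ennreal_le_iff)
    have mlo: "ennreal (q / C) \<le> mu (real m) \<Omega> ?B"
      using comp[OF p _ rk] r0 kK mu_mono[OF sub(1)] unfolding box_comparable_def q_def by (meson divide_pos_pos order_trans less_le_trans zero_less_one)
    have mup: "mu (real m) \<Omega> ?B \<le> ennreal (C * (S * q))"
    proof -
      have "0 < K * r" using r0 kK by simp
      then have "mu (real m) \<Omega> (hbox m p (K * r)) \<le> ennreal (C * qsize m p (K * r))"
        using comp[OF p _ Kr] unfolding box_comparable_def by blast
      also have "\<dots> \<le> ennreal (C * (S * q))" using qS C by (intro ennreal_leI mult_left_mono) auto
      finally show ?thesis using mu_mono[OF sub(2)] order_trans by blast
    qed
    have "1 / D * \<beta> / r \<le> q / C"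
    proof -
      have "\<beta> * C \<le> 2 * pi * (K * r) * (S * q) * C" using \<beta>up C by (intro mult_right_mono) auto
      also have "\<dots> = (2 * pi * K * S * C) * (q * r)" by simp
      also have "\<dots> \<le> D * (q * r)" using D1(1) q0 r0 by (intro mult_right_mono) auto
      finally show ?thesis using D C r0 by (simp add: field_simps)
    qed
    moreover have "ennreal (1 / D) * emeasure lebesgue ?B / ennreal r = ennreal (1 / D * \<beta> / r)"
      unfolding lb \<beta>(1) using D \<beta>(2) r0 by (simp add: ennreal_mult[symmetric] divide_ennreal)
    ultimately show "ennreal (1 / D) * emeasure lebesgue ?B / ennreal r \<le> mu (real m) \<Omega> ?B"
      using mlo by (metis ennreal_leI order_trans)
    have "C * (S * q) \<le> D * \<beta> / r"
    proof -
      have "C * (S * q) * r = (C * S * k) * ((r / k) * q)" using kK by simp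
      also have "\<dots> \<le> D * ((r / k) * q)" using D1(2) q0 r0 kK by (intro mult_right_mono) auto
      also have "\<dots> \<le> D * \<beta>"
      proof -
        have "1 * ((r / k) * q) \<le> (2 * pi) * ((r / k) * q)" using q0 r0 kK pi_ge_two by (intro mult_right_mono) auto
        then have "(r / k) * q \<le> \<beta>" using \<beta>lo by simp
        then show ?thesis using D by (intro mult_left_mono) auto
      qed
      finally show ?thesis using r0 by (simp add: field_simps)
    qed
    moreover have "ennreal D * emeasure lebesgue ?B / ennreal r = ennreal (D * \<beta> / r)"
      unfolding lb \<beta>(1) using D \<beta>(2) r0 by (simp add: ennreal_mult[symmetric] divide_ennreal)
    ultimately show "mu (real m) \<Omega> ?B \<le> ennreal D * emeasure lebesgue ?B / ennreal r"
      using mup by (metis ennreal_leI order_trans)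
  qed
qed

end
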